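(* On a smooth surface $M$, let $([\nabla],[h])$ be an exact Riemannian signature Einstein AH structure with negative weighted scalar curvature $R$. Let $\hat M$, the Thomas connection $\hat\nabla$ of $[\nabla]$, the function $\tilde R$, and the tensors $g_{IJ}=\tfrac12\hat\nabla_Id\tilde v_J$ and $f_{IJ}=\hat\nabla_IdF_J$ on $\hat M$ be as defined in the context. Then: (a) $g_{IJ}$ forms with $\hat\nabla$ a Lorentzian signature Monge–Ampère Hessian metric structure, such that the level surfaces of $\tilde R$ are smoothly immersed and, with respect to $g_{IJ}$, are spacelike, umbilic, and have constant mean curvature; (b) $f_{IJ}$ forms with $\hat\nabla$ a Riemannian signature Einstein Hessian structure, such that the level surfaces of $\tilde R$ are totally geodesic with respect to $f_{IJ}$.
   Context: A projective structure $[\nabla]$ is a class of torsion-free affine connections with the same unparametrized geodesics. An AH structure on a surface is a pair $([\nabla],[h])$ of a projective structure and a conformal structure. Let $H_{ij}=|\det h|^{-1/2}h_{ij}$ (independent of $h\in[h]$), with inverse $H^{ij}$. The aligned representative is the unique torsion-free $\nabla\in[\nabla]$ with $\nabla_{[i}H_{j]k}=0$; henceforth $\nabla$ denotes it. Curvature: $2\nabla_{[i}\nabla_{j]}X^k=R_{ijp}{}^kX^p$, $R_{ij}=R_{pij}{}^p$, $R=H^{ij}R_{ij}$ (weighted scalar curvature, a section of $|\mathrm{Det}\,T^*M|$), $F_{ij}=-R_{[ij]}$. The AH structure is Einstein if $R_{(ij)}=\tfrac12RH_{ij}$ and $\nabla_iR+2H^{pq}\nabla_qF_{ip}=0$; exact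 if some $h\in[h]$ satisfies $\nabla|\det h|=0$ (then $F=0$ and an Einstein structure has $\nabla R=0$ and $[\nabla]$ projectively flat). $\rho:\hat M\to M$ is the principal $\mathbb R^\times$-bundle whose third power is the complement of the zero section in $\mathrm{Det}\,T^*M$, so each $\theta\in\hat M$ over $x$ has a cube $\theta^3\in \mathrm{Det}\,T_x^*M\setminus\{0\}$ and $(r\theta)^3=r^3\theta^3$. $\mathbb E$ is the vector field generating the dilations $\theta\mapsto e^t\theta$. The connection $\nabla$ induces a principal connection $\beta$ on $\hat M$ (via $\mathrm{Det}\,T^*M$), with $\beta(\mathbb E)=1$; $\hat X$ denotes the horizontal lift of a vector field $X$ on $M$. The Thomas connection $\hat\nabla$ is the torsion-free connection on $\hat M$ with $\hat\nabla_I\mathbb E^J=\delta_I{}^J$ and $\hat\nabla_{\hat X}\hat Y=\widehat{\nabla_XY}+P(X,Y)\mathbb E$, where $P_{ij}=-R_{(ij)}-\tfrac13R_{[ij]}$; it does not depend on the choice of representative of $[\nabla]$, and is flat iff $[\nabla]$ is projectively flat. $\tilde R$ is the negative function on $\hat M$ with $R_x=\tilde R(\theta)|\theta^3|$ (homogeneous of degree $-3$). Set $\tilde v=(\tilde R/2)^{-2/3}=2^{2/3}|\tilde R|^{-2/3}>0$ (homogeneous of degree $2$) and $F=-\tfrac32\log\tilde v$. (Since $\nabla R=0$, $\beta=\tfrac12 d\log\tilde v$; and $g_{IJ}=\tilde v(\beta_I\beta_J+\tfrac12\rho^*(RH)_{IJ})$, $f_{IJ}=-3\tilde v^{-1}g_{IJ}+6\beta_I\beta_J$.)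 A pair $(\hat\nabla,g)$ of a flat torsion-free affine connection and a pseudo-Riemannian metric is a Hessian metric if $g=\hat\nabla dF$ for a globally defined function $F$. With $\mu$ a local $\hat\nabla$-parallel volume form, its Ricci (Kähler affine) tensor is $-\hat\nabla_Id(\log|\det g/\mu^2|)_J$; the metric is Einstein if this is a constant multiple of $g$, and Monge–Ampère if this vanishes. Lorentzian signature here means one positive and two negative directions; "spacelike" for a surface means the restriction of $g$ to its tangent spaces is (negative) definite, i.e. its normal has the positive sign. *)

theory Defs
  imports "HOL-Analysis.Analysis"
begin

section \<open>Smooth functions\<close>

primrec Ck_on :: "nat \<Rightarrow> 'a::real_normed_vector set \<Rightarrow> ('a \<Rightarrow> 'b::real_normed_vector) \<Rightarrow> bool" where
  "Ck_on 0 S f \<longleftrightarrow> continuous_on S f"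
| "Ck_on (Suc k) S f \<longleftrightarrow>
     (\<forall>x\<in>S. f differentiable (at x)) \<and> (\<forall>v. Ck_on k S (\<lambda>x. frechet_derivative f (at x) v))"

text \<open>Used for open \<open>S\<close> only.\<close>
definition smooth_on :: "'a::real_normed_vector set \<Rightarrow> ('a \<Rightarrow> 'b::real_normed_vector) \<Rightarrow> bool" where
  "smooth_on S f \<longleftrightarrow> (\<forall>k. Ck_on k S f)"

definition pd :: "'n::finite \<Rightarrow> (real^'n \<Rightarrow> 'b::real_normed_vector) \<Rightarrow> real^'n \<Rightarrow> 'b" where
  "pd i f y = frechet_derivative f (at y) (axis i 1)"


section \<open>Manifolds\<close>

text \<open>
  A chart is a pair of its domain and its coordinate map (whose values outside the domain are
  irrelevant). A manifold is given by a (not necessarily maximal) atlas, which also determines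
  the point set and the topology.
\<close>

type_synonym ('a, 'n) chart = "'a set \<times> ('a \<Rightarrow> real^'n)"

definition cimg :: "('a, 'n::finite) chart \<Rightarrow> (real^'n) set" where
  "cimg c = snd c ` fst c"

definition chart_inv :: "('a, 'n::finite) chart \<Rightarrow> real^'n \<Rightarrow> 'a" where
  "chart_inv c = inv_into (fst c) (snd c)"

definition points :: "('a, 'n::finite) chart set \<Rightarrow> 'a set" where
  "points A = (\<Union>c\<in>A. fst c)"

definition atlas_topology :: "('a, 'n::finite) chart set \<Rightarrow> 'a topology" where
  "atlas_topology A =
     topology (\<lambda>W. W \<subseteq> points A \<and> (\<forall>c\<in>A. open (snd c ` (W \<inter> fst c))))"

definition overlap :: "('a, 'n::finite) chart \<Rightarrow> ('a, 'n) chart \<Rightarrow> (real^'n) set" where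
  "overlap c d = snd c ` (fst c \<inter> fst d)"

definition transition :: "('a, 'n::finite) chart \<Rightarrow> ('a, 'n) chart \<Rightarrow> real^'n \<Rightarrow> real^'n" where
  "transition c d = (\<lambda>y. snd d (chart_inv c y))"

text \<open>Row \<open>k\<close>, column \<open>i\<close>: the derivative of the \<open>k\<close>-th \<open>d\<close>-coordinate by the \<open>i\<close>-th
  \<open>c\<close>-coordinate.\<close>
definition jac :: "('a, 'n::finite) chart \<Rightarrow> ('a, 'n) chart \<Rightarrow> real^'n \<Rightarrow> real^'n^'n" where
  "jac c d y = matrix (frechet_derivative (transition c d) (at y))"

definition smooth_atlas :: "('a, 'n::finite) chart set \<Rightarrow> bool" where
  "smooth_atlas A \<longleftrightarrow>
     (\<forall>c\<in>A. inj_on (snd c) (fst c) \<and> open (cimg c)) \<and>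
     (\<forall>c\<in>A. \<forall>d\<in>A. open (overlap c d) \<and> smooth_on (overlap c d) (transition c d)) \<and>
     Hausdorff_space (atlas_topology A) \<and> second_countable (atlas_topology A)"

lemma openin_atlas_topology:
  assumes "\<And>c. c \<in> A \<Longrightarrow> inj_on (snd c) (fst c)" "\<And>c. c \<in> A \<Longrightarrow> open (cimg c)"
  shows "openin (atlas_topology A) W \<longleftrightarrow>
    W \<subseteq> points A \<and> (\<forall>c\<in>A. open (snd c ` (W \<inter> fst c)))"
proof -
  let ?P = "\<lambda>W. W \<subseteq> points A \<and> (\<forall>c\<in>A. open (snd c ` (W \<inter> fst c)))"
  have "istopology ?P"
    unfolding istopology_def
  proof (intro conjI allI impI)
    fix S T assume S: "?P S" and T: "?P T"
    have "snd c ` (S \<inter> T \<inter> fst c) = snd c ` (S \<inter> fst c) \<inter> snd c ` (T \<inter> fst c)"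
      if "c \<in> A" for c
    proof -
      have "S \<inter> T \<inter> fst c = (S \<inter> fst c) \<inter> (T \<inter> fst c)" by blast
      then show ?thesis
        by (metis inj_on_image_Int[OF assms(1)[OF that]] Int_lower2)
    qed
    with S T show "S \<inter> T \<subseteq> points A" "\<forall>c\<in>A. open (snd c ` (S \<inter> T \<inter> fst c))"
      by auto
  next
    fix K assume K: "\<forall>W\<in>K. ?P W"
    have "snd c ` (\<Union>K \<inter> fst c) = (\<Union>W\<in>K. snd c ` (W \<inter> fst c))" for c
      by blast
    moreover have "open (\<Union>W\<in>K. snd c ` (W \<inter> fst c))" if "c \<in> A" for c
      using K that by blast
    ultimately show "\<forall>c\<in>A. open (snd c ` (\<Union>K \<inter> fst c))"
      by metis
    show "\<Union>K \<subseteq> points A"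
      using K by blast
  qed
  then show ?thesis
    by (simp add: atlas_topology_def)
qed


section \<open>Tensors and affine connections\<close>

text \<open>
  Tensor fields and connections are given, as in classical tensor calculus, by their components
  with respect to each chart of the atlas, as functions of the coordinates, subject to the
  transformation law. Values at \<open>c \<notin> A\<close> and outside \<open>cimg c\<close> are irrelevant.
  For a connection, \<open>G c y $ k $ i $ j\<close> is the component \<open>\<Gamma>\<^sub>i\<^sub>j\<^sup>k\<close>, where
  \<open>(\<nabla>\<^sub>i X)\<^sup>k = \<partial>\<^sub>i X\<^sup>k + \<Gamma>\<^sub>i\<^sub>p\<^sup>k X\<^sup>p\<close>.
\<close>

type_synonym ('a, 'n) tensor2 = "('a, 'n) chart \<Rightarrow> real^'n \<Rightarrow> real^'n^'n"
type_synonym ('a, 'n) connection = "('a, 'n) chart \<Rightarrow> real^'n \<Rightarrow> real^'n^'n^'n"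

text \<open>A matrix \<open>G\<close> (used for symmetric ones) of signature with \<open>p\<close> positive and \<open>q\<close> negative
  directions, in particular nondegenerate.\<close>
definition has_signature :: "nat \<Rightarrow> nat \<Rightarrow> real^'n::finite^'n \<Rightarrow> bool" where
  "has_signature p q G \<longleftrightarrow> p + q = CARD('n) \<and>
     (\<exists>V W. subspace V \<and> dim V = p \<and> (\<forall>v\<in>V. v \<noteq> 0 \<longrightarrow> v \<bullet> (G *v v) > 0) \<and>
            subspace W \<and> dim W = q \<and> (\<forall>w\<in>W. w \<noteq> 0 \<longrightarrow> w \<bullet> (G *v w) < 0))"

definition pseudo_metric ::
  "nat \<Rightarrow> nat \<Rightarrow> ('a, 'n::finite) chart set \<Rightarrow> ('a, 'n) tensor2 \<Rightarrow> bool" where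
  "pseudo_metric p q A g \<longleftrightarrow>
     (\<forall>c\<in>A. smooth_on (cimg c) (g c) \<and>
        (\<forall>y\<in>cimg c. transpose (g c y) = g c y \<and> has_signature p q (g c y))) \<and>
     (\<forall>c\<in>A. \<forall>d\<in>A. \<forall>y\<in>overlap c d.
        g c y = transpose (jac c d y) ** g d (transition c d y) ** jac c d y)"

definition connection :: "('a, 'n::finite) chart set \<Rightarrow> ('a, 'n) connection \<Rightarrow> bool" where
  "connection A G \<longleftrightarrow>
     (\<forall>c\<in>A. smooth_on (cimg c) (G c)) \<and>
     (\<forall>c\<in>A. \<forall>d\<in>A. \<forall>y\<in>overlap c d. \<forall>i j m.
        (\<Sum>k\<in>UNIV. jac c d y $ m $ k * G c y $ k $ i $ j) =
        pd i (\<lambda>z. jac c d z $ m $ j) y +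
        (\<Sum>p\<in>UNIV. \<Sum>q\<in>UNIV.
           G d (transition c d y) $ m $ p $ q * jac c d y $ p $ i * jac c d y $ q $ j))"

definition torsion_free :: "('a, 'n::finite) chart set \<Rightarrow> ('a, 'n) connection \<Rightarrow> bool" where
  "torsion_free A G \<longleftrightarrow> (\<forall>c\<in>A. \<forall>y\<in>cimg c. \<forall>k i j. G c y $ k $ i $ j = G c y $ k $ j $ i)"

text \<open>
  The following are local formulas for a connection with components \<open>G\<close> in a fixed chart.
\<close>

definition cov_deriv ::
  "(real^'n::finite \<Rightarrow> real^'n^'n^'n) \<Rightarrow> (real^'n \<Rightarrow> real^'n) \<Rightarrow> (real^'n \<Rightarrow> real^'n) \<Rightarrow> real^'n \<Rightarrow> real^'n"
where
  "cov_deriv G X Y y = (\<chi> k. \<Sum>i\<in>UNIV. X y $ i *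
     (pd i (\<lambda>z. Y z $ k) y + (\<Sum>j\<in>UNIV. G y $ k $ i $ j * Y y $ j)))"

text \<open>\<open>curv G y i j p k\<close> is \<open>R\<^sub>i\<^sub>j\<^sub>p\<^sup>k\<close>, where
  \<open>\<nabla>\<^sub>i \<nabla>\<^sub>j X\<^sup>k - \<nabla>\<^sub>j \<nabla>\<^sub>i X\<^sup>k = R\<^sub>i\<^sub>j\<^sub>p\<^sup>k X\<^sup>p\<close> for torsion-free connections.\<close>
definition curv ::
  "(real^'n::finite \<Rightarrow> real^'n^'n^'n) \<Rightarrow> real^'n \<Rightarrow> 'n \<Rightarrow> 'n \<Rightarrow> 'n \<Rightarrow> 'n \<Rightarrow> real" where
  "curv G y i j p k =
     pd i (\<lambda>z. G z $ k $ j $ p) y - pd j (\<lambda>z. G z $ k $ i $ p) y +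
     (\<Sum>q\<in>UNIV. G y $ k $ i $ q * G y $ q $ j $ p - G y $ k $ j $ q * G y $ q $ i $ p)"

definition ricci :: "(real^'n::finite \<Rightarrow> real^'n^'n^'n) \<Rightarrow> real^'n \<Rightarrow> real^'n^'n" where
  "ricci G y = (\<chi> i j. \<Sum>p\<in>UNIV. curv G y p i j p)"

definition ricci_sym :: "(real^'n::finite \<Rightarrow> real^'n^'n^'n) \<Rightarrow> real^'n \<Rightarrow> real^'n^'n" where
  "ricci_sym G y = (\<chi> i j. (ricci G y $ i $ j + ricci G y $ j $ i) / 2)"

definition ricci_skew :: "(real^'n::finite \<Rightarrow> real^'n^'n^'n) \<Rightarrow> real^'n \<Rightarrow> real^'n^'n" where
  "ricci_skew G y = (\<chi> i j. (ricci G y $ i $ j - ricci G y $ j $ i) / 2)"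

definition flat :: "('a, 'n::finite) chart set \<Rightarrow> ('a, 'n) connection \<Rightarrow> bool" where
  "flat A G \<longleftrightarrow> (\<forall>c\<in>A. \<forall>y\<in>cimg c. \<forall>i j p k. curv (G c) y i j p k = 0)"

text \<open>The trace \<open>\<Gamma>\<^sub>i\<^sub>p\<^sup>p\<close>: the covariant derivative of a section of \<open>Det T\<^sup>*M\<close> or of
  \<open>|Det T\<^sup>*M|\<close> with component \<open>a\<close> has components \<open>\<partial>\<^sub>i a - \<Gamma>\<^sub>i\<^sub>p\<^sup>p a\<close>.\<close>
definition trace_conn :: "(real^'n::finite \<Rightarrow> real^'n^'n^'n) \<Rightarrow> real^'n \<Rightarrow> 'n \<Rightarrow> real" where
  "trace_conn G y i = (\<Sum>p\<in>UNIV. G y $ p $ i $ p)"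

definition cov_tensor2 ::
  "(real^'n::finite \<Rightarrow> real^'n^'n^'n) \<Rightarrow> (real^'n \<Rightarrow> real^'n^'n) \<Rightarrow> real^'n \<Rightarrow> 'n \<Rightarrow> 'n \<Rightarrow> 'n \<Rightarrow> real"
where
  "cov_tensor2 G T y i j k = pd i (\<lambda>z. T z $ j $ k) y -
     (\<Sum>p\<in>UNIV. G y $ p $ i $ j * T y $ p $ k + G y $ p $ i $ k * T y $ j $ p)"

definition hess :: "(real^'n::finite \<Rightarrow> real^'n^'n^'n) \<Rightarrow> (real^'n \<Rightarrow> real) \<Rightarrow> real^'n \<Rightarrow> real^'n^'n" where
  "hess G u y = (\<chi> i j. pd i (pd j u) y - (\<Sum>k\<in>UNIV. G y $ k $ i $ j * pd k u y))"

text \<open>The tensor \<open>\<nabla>du\<close> of a function \<open>u\<close> on the manifold.\<close>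
definition hessian :: "('a, 'n::finite) connection \<Rightarrow> ('a \<Rightarrow> real) \<Rightarrow> ('a, 'n) tensor2" where
  "hessian G u c y = hess (G c) (\<lambda>z. u (chart_inv c z)) y"

definition smooth_function :: "('a, 'n::finite) chart set \<Rightarrow> ('a \<Rightarrow> real) \<Rightarrow> bool" where
  "smooth_function A u \<longleftrightarrow> (\<forall>c\<in>A. smooth_on (cimg c) (\<lambda>z. u (chart_inv c z)))"


section \<open>Projective, conformal and AH structures\<close>

text \<open>Regular curves whose velocity is parallel up to scale, with arbitrary parametrization.\<close>
definition unparam_geodesic ::
  "('a, 'n::finite) chart set \<Rightarrow> ('a, 'n) connection \<Rightarrow> real set \<Rightarrow> (real \<Rightarrow> 'a) \<Rightarrow> bool" where
  "unparam_geodesic A G S \<gamma> \<longleftrightarrow>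
     open S \<and> is_interval S \<and> \<gamma> ` S \<subseteq> points A \<and>
     (\<forall>c\<in>A. let T = {t\<in>S. \<gamma> t \<in> fst c}; x = (\<lambda>t. snd c (\<gamma> t));
               x' = (\<lambda>t. vector_derivative x (at t)) in
        open T \<and> smooth_on T x \<and>
        (\<forall>t\<in>T. x' t \<noteq> 0 \<and>
           (\<exists>r. \<forall>k. vector_derivative x' (at t) $ k +
                 (\<Sum>i\<in>UNIV. \<Sum>j\<in>UNIV. G c (x t) $ k $ i $ j * x' t $ i * x' t $ j) = r * x' t $ k)))"

definition projective_structure ::
  "('a, 'n::finite) chart set \<Rightarrow> ('a, 'n) connection set \<Rightarrow> bool" where
  "projective_structure A P \<longleftrightarrow>
     (\<exists>G0. connection A G0 \<and> torsion_free A G0 \<and>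
        P = {G. connection A G \<and> torsion_free A G \<and>
               (\<forall>S \<gamma>. unparam_geodesic A G S \<gamma> \<longleftrightarrow> unparam_geodesic A G0 S \<gamma>)})"

text \<open>Conformal structures of Riemannian signature.\<close>
definition conformal_structure ::
  "('a, 'n::finite) chart set \<Rightarrow> ('a, 'n) tensor2 set \<Rightarrow> bool" where
  "conformal_structure A C \<longleftrightarrow>
     (\<exists>h0. pseudo_metric CARD('n) 0 A h0 \<and>
        C = {h. pseudo_metric CARD('n) 0 A h \<and>
               (\<exists>u. smooth_function A u \<and> (\<forall>x\<in>points A. u x > 0) \<and>
                  (\<forall>c\<in>A. \<forall>y\<in>cimg c. h c y = u (chart_inv c y) *\<^sub>R h0 c y))})"

definition AH_structure ::
  "('a, 2) chart set \<Rightarrow> ('a, 2) connection set \<Rightarrow> ('a, 2) tensor2 set \<Rightarrow> bool" where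
  "AH_structure A P C \<longleftrightarrow> projective_structure A P \<and> conformal_structure A C"

text \<open>The weighted metric \<open>H\<^sub>i\<^sub>j = |det h|\<^sup>-\<^sup>1\<^sup>/\<^sup>2 h\<^sub>i\<^sub>j\<close>; it is the same for all \<open>h\<close> in the
  conformal class \<open>C\<close>, see \<open>weighted_metric_eq\<close>.\<close>
definition normalized :: "real^2^2 \<Rightarrow> real^2^2" where
  "normalized h = (1 / sqrt \<bar>det h\<bar>) *\<^sub>R h"

definition weighted_metric :: "('a, 2) tensor2 set \<Rightarrow> ('a, 2) tensor2" where
  "weighted_metric C = (\<lambda>c y. normalized ((SOME h. h \<in> C) c y))"

lemma weighted_metric_eq:
  assumes "conformal_structure A C" "h \<in> C" "c \<in> A" "y \<in> cimg c"
  shows "weighted_metric C c y = normalized (h c y)"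
proof -
  obtain h0 where C: "C = {h. pseudo_metric CARD(2) 0 A h \<and>
      (\<exists>u. smooth_function A u \<and> (\<forall>x\<in>points A. u x > 0) \<and>
         (\<forall>c\<in>A. \<forall>y\<in>cimg c. h c y = u (chart_inv c y) *\<^sub>R h0 c y))}"
    using assms(1) unfolding conformal_structure_def by blast
  have x: "chart_inv c y \<in> points A"
    using assms(3,4) inv_into_into[of y "snd c" "fst c"]
    unfolding chart_inv_def points_def cimg_def by blast
  have *: "normalized (k c y) = normalized (h0 c y)" if "k \<in> C" for k
  proof -
    from that obtain u where u: "\<forall>x\<in>points A. u x > 0"
      "\<forall>c\<in>A. \<forall>y\<in>cimg c. k c y = u (chart_inv c y) *\<^sub>R h0 c y"
      unfolding C by blast
    define r where "r = u (chart_inv c y)"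
    have r: "r > 0" and k: "k c y = r *\<^sub>R h0 c y"
      using u x assms(3,4) by (auto simp: r_def)
    have "det (k c y) = r\<^sup>2 * det (h0 c y)"
      unfolding k by (simp add: det_2 power2_eq_square algebra_simps)
    then have "sqrt \<bar>det (k c y)\<bar> = r * sqrt \<bar>det (h0 c y)\<bar>"
      using r by (simp add: abs_mult real_sqrt_mult)
    then show ?thesis
      using r unfolding normalized_def k by simp
  qed
  have "(SOME h. h \<in> C) \<in> C"
    using assms(2) by (metis someI)
  then show ?thesis
    unfolding weighted_metric_def using * assms(2) by metis
qed

text \<open>The covariant derivative \<open>\<nabla>\<^sub>i H\<^sub>j\<^sub>k\<close>; the last term accounts for the weight
  \<open>|det h|\<^sup>-\<^sup>1\<^sup>/\<^sup>2\<close>.\<close>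
definition cov_weighted_metric ::
  "(real^2 \<Rightarrow> real^2^2^2) \<Rightarrow> (real^2 \<Rightarrow> real^2^2) \<Rightarrow> real^2 \<Rightarrow> 2 \<Rightarrow> 2 \<Rightarrow> 2 \<Rightarrow> real" where
  "cov_weighted_metric G H y i j k =
     cov_tensor2 G H y i j k + trace_conn G y i * H y $ j $ k"

definition aligned_representative ::
  "('a, 2) chart set \<Rightarrow> ('a, 2) connection set \<Rightarrow> ('a, 2) tensor2 set \<Rightarrow> ('a, 2) connection \<Rightarrow> bool"
where
  "aligned_representative A P C G \<longleftrightarrow> G \<in> P \<and>
     (\<forall>c\<in>A. \<forall>y\<in>cimg c. \<forall>i j k.
        cov_weighted_metric (G c) (weighted_metric C c) y i j k =
        cov_weighted_metric (G c) (weighted_metric C c) y j i k)"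

text \<open>The component in the chart \<open>c\<close> of the section \<open>R = H\<^sup>i\<^sup>j R\<^sub>i\<^sub>j\<close> of \<open>|Det T\<^sup>*M|\<close>.\<close>
definition weighted_scal ::
  "('a, 2) tensor2 set \<Rightarrow> ('a, 2) connection \<Rightarrow> ('a, 2) chart \<Rightarrow> real^2 \<Rightarrow> real" where
  "weighted_scal C G c y =
     (\<Sum>i\<in>UNIV. \<Sum>j\<in>UNIV. matrix_inv (weighted_metric C c y) $ i $ j * ricci (G c) y $ i $ j)"

definition faraday :: "(real^2 \<Rightarrow> real^2^2^2) \<Rightarrow> real^2 \<Rightarrow> real^2^2" where
  "faraday G y = - ricci_skew G y"

text \<open>In the following, \<open>G\<close> is the aligned representative.\<close>

definition Einstein_AH ::
  "('a, 2) chart set \<Rightarrow> ('a, 2) tensor2 set \<Rightarrow> ('a, 2) connection \<Rightarrow> bool" where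
  "Einstein_AH A C G \<longleftrightarrow> (\<forall>c\<in>A. \<forall>y\<in>cimg c.
     ricci_sym (G c) y = (weighted_scal C G c y / 2) *\<^sub>R weighted_metric C c y \<and>
     (\<forall>i. pd i (weighted_scal C G c) y - trace_conn (G c) y i * weighted_scal C G c y +
        2 * (\<Sum>p\<in>UNIV. \<Sum>q\<in>UNIV. matrix_inv (weighted_metric C c y) $ p $ q *
               cov_tensor2 (G c) (faraday (G c)) y q i p) = 0))"

definition exact_AH ::
  "('a, 2) chart set \<Rightarrow> ('a, 2) tensor2 set \<Rightarrow> ('a, 2) connection \<Rightarrow> bool" where
  "exact_AH A C G \<longleftrightarrow> (\<exists>h\<in>C. \<forall>c\<in>A. \<forall>y\<in>cimg c. \<forall>i.
     pd i (\<lambda>z. \<bar>det (h c z)\<bar>) y - 2 * trace_conn (G c) y i * \<bar>det (h c y)\<bar> = 0)"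


section \<open>The bundle \<open>\<rho>: M^ \<rightarrow> M\<close> and the Thomas connection\<close>

text \<open>
  An element of \<open>Det T\<^sup>*\<^sub>x M\<close> is given by its components with respect to the charts around \<open>x\<close>
  (and \<open>0\<close> at all other charts, so that elements are represented uniquely). An element of
  \<open>M^\<close> over \<open>x\<close> is a pair \<open>(x, \<theta>)\<close> such that the componentwise cube of \<open>\<theta>\<close> is a nonzero element
  of \<open>Det T\<^sup>*\<^sub>x M\<close>.
\<close>

definition det_cotangent :: "('a, 2) chart set \<Rightarrow> 'a \<Rightarrow> (('a, 2) chart \<Rightarrow> real) set" where
  "det_cotangent A x = {\<omega>.
     (\<forall>c. c \<notin> A \<or> x \<notin> fst c \<longrightarrow> \<omega> c = 0) \<and>
     (\<forall>c\<in>A. \<forall>d\<in>A. x \<in> fst c \<inter> fst d \<longrightarrow> \<omega> c = det (jac c d (snd c x)) * \<omega> d)}"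

type_synonym 'a hat = "'a \<times> (('a, 2) chart \<Rightarrow> real)"

definition Mhat :: "('a, 2) chart set \<Rightarrow> 'a hat set" where
  "Mhat A = {(x, \<theta>). x \<in> points A \<and> (\<lambda>c. (\<theta> c)^3) \<in> det_cotangent A x - {\<lambda>c. 0}}"

definition dilate :: "real \<Rightarrow> 'a hat \<Rightarrow> 'a hat" where
  "dilate r p = (fst p, \<lambda>c. r * snd p c)"

text \<open>The chart of \<open>M^\<close> over a chart \<open>c\<close> of \<open>M\<close>: its coordinates are those of the base point
  and the number \<open>s\<close> with \<open>\<theta>\<^sup>3 = s\<^sup>3 dx\<^sup>1 \<and> dx\<^sup>2\<close>.\<close>
definition hat_chart :: "('a, 2) chart set \<Rightarrow> ('a, 2) chart \<Rightarrow> ('a hat, 3) chart" where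
  "hat_chart A c =
     ({p \<in> Mhat A. fst p \<in> fst c},
      \<lambda>p. vector [snd c (fst p) $ 1, snd c (fst p) $ 2, snd p c])"

definition hat_atlas :: "('a, 2) chart set \<Rightarrow> ('a hat, 3) chart set" where
  "hat_atlas A = hat_chart A ` A"

definition base :: "real^3 \<Rightarrow> real^2" where
  "base z = vector [z $ 1, z $ 2]"

definition euler :: "('a hat, 3) chart \<Rightarrow> real^3 \<Rightarrow> real^3" where
  "euler c z = vector_derivative (\<lambda>t. snd c (dilate (exp t) (chart_inv c z))) (at 0)"

text \<open>The horizontal lift of a vector field \<open>X\<close>, in the charts \<open>c\<close> and \<open>hat_chart A c\<close>. Along a
  curve in \<open>M^\<close> with coordinates \<open>x(t), s(t)\<close>, the section \<open>\<theta>\<^sup>3\<close> of \<open>Det T\<^sup>*M\<close> with component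
  \<open>s\<^sup>3\<close> is parallel iff \<open>3 s\<^sup>2 ds/dt = \<Gamma>\<^sub>i\<^sub>p\<^sup>p (dx\<^sup>i/dt) s\<^sup>3\<close>. So the principal connection is
  \<open>\<beta> = ds/s - \<Gamma>\<^sub>i\<^sub>p\<^sup>p dx\<^sup>i / 3\<close>.\<close>
definition hlift :: "(real^2 \<Rightarrow> real^2^2^2) \<Rightarrow> (real^2 \<Rightarrow> real^2) \<Rightarrow> real^3 \<Rightarrow> real^3" where
  "hlift G X z = vector [X (base z) $ 1, X (base z) $ 2,
     z $ 3 * (\<Sum>i\<in>UNIV. trace_conn G (base z) i * X (base z) $ i) / 3]"

definition proj_P :: "(real^2 \<Rightarrow> real^2^2^2) \<Rightarrow> real^2 \<Rightarrow> real^2^2" where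
  "proj_P G y = - ricci_sym G y - (1/3) *\<^sub>R ricci_skew G y"

text \<open>\<open>D\<close> is the Thomas connection obtained from the representative \<open>G\<close> of the projective
  structure. The vector fields \<open>X\<close> and \<open>Y\<close> are those on chart domains.\<close>
definition Thomas_connection ::
  "('a, 2) chart set \<Rightarrow> ('a, 2) connection \<Rightarrow> ('a hat, 3) connection \<Rightarrow> bool" where
  "Thomas_connection A G D \<longleftrightarrow>
     connection (hat_atlas A) D \<and> torsion_free (hat_atlas A) D \<and>
     (\<forall>c\<in>A. let e = hat_chart A c in \<forall>z\<in>cimg e.
        (\<forall>I J. pd I (\<lambda>w. euler e w $ J) z + (\<Sum>K\<in>UNIV. D e z $ J $ I $ K * euler e z $ K) =
           (if I = J then 1 else 0)) \<and>
        (\<forall>X Y. smooth_on (cimg c) X \<and> smooth_on (cimg c) Y \<longrightarrow>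
           cov_deriv (D e) (hlift (G c) X) (hlift (G c) Y) z =
             hlift (G c) (cov_deriv (G c) X Y) z +
             (X (base z) \<bullet> (proj_P (G c) (base z) *v Y (base z))) *\<^sub>R euler e z))"

text \<open>The function on \<open>M^\<close> with \<open>R = Rt(\<theta>) |\<theta>\<^sup>3|\<close>.\<close>
definition R_tilde ::
  "('a, 2) chart set \<Rightarrow> ('a, 2) tensor2 set \<Rightarrow> ('a, 2) connection \<Rightarrow> ('a hat \<Rightarrow> real) \<Rightarrow> bool" where
  "R_tilde A C G Rt \<longleftrightarrow> (\<forall>p\<in>Mhat A. \<forall>c\<in>A. fst p \<in> fst c \<longrightarrow>
     weighted_scal C G c (snd c (fst p)) = Rt p * \<bar>(snd p c)^3\<bar>)"

definition v_tilde :: "('a hat \<Rightarrow> real) \<Rightarrow> 'a hat \<Rightarrow> real" where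
  "v_tilde Rt p = 2 powr (2/3) * \<bar>Rt p\<bar> powr (-2/3)"

definition F_pot :: "('a hat \<Rightarrow> real) \<Rightarrow> 'a hat \<Rightarrow> real" where
  "F_pot Rt p = - (3/2) * ln (v_tilde Rt p)"

definition g_tensor ::
  "('a hat, 3) connection \<Rightarrow> ('a hat \<Rightarrow> real) \<Rightarrow> ('a hat, 3) tensor2" where
  "g_tensor D Rt = (\<lambda>c z. (1/2) *\<^sub>R hessian D (v_tilde Rt) c z)"

definition f_tensor ::
  "('a hat, 3) connection \<Rightarrow> ('a hat \<Rightarrow> real) \<Rightarrow> ('a hat, 3) tensor2" where
  "f_tensor D Rt = hessian D (F_pot Rt)"


section \<open>Hessian metrics\<close>

definition Hessian_metric ::
  "nat \<Rightarrow> nat \<Rightarrow> ('a, 'n::finite) chart set \<Rightarrow> ('a, 'n) connection \<Rightarrow> ('a, 'n) tensor2 \<Rightarrow> bool" where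
  "Hessian_metric p q A D g \<longleftrightarrow>
     connection A D \<and> torsion_free A D \<and> flat A D \<and> pseudo_metric p q A g \<and>
     (\<exists>F. smooth_function A F \<and> (\<forall>c\<in>A. \<forall>y\<in>cimg c. g c y = hessian D F c y))"

text \<open>Components of local parallel volume forms near the point \<open>y\<close>; such forms are unique up to
  nonzero constant factors, so the tensor \<open>KA_ricci\<close> does not depend on the choice.\<close>
definition parallel_volume_near ::
  "(real^'n::finite) set \<Rightarrow> (real^'n \<Rightarrow> real^'n^'n^'n) \<Rightarrow> real^'n \<Rightarrow> (real^'n \<Rightarrow> real) \<Rightarrow> bool" where
  "parallel_volume_near S G y \<mu> \<longleftrightarrow>
     (\<exists>U. open U \<and> y \<in> U \<and> U \<subseteq> S \<and> smooth_on U \<mu> \<and>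
        (\<forall>z\<in>U. \<mu> z \<noteq> 0 \<and> (\<forall>i. pd i \<mu> z - trace_conn G z i * \<mu> z = 0)))"

definition KA_ricci ::
  "('a, 'n::finite) connection \<Rightarrow> ('a, 'n) tensor2 \<Rightarrow> ('a, 'n) tensor2" where
  "KA_ricci D g c y = (let \<mu> = (SOME \<mu>. parallel_volume_near (cimg c) (D c) y \<mu>) in
     - hess (D c) (\<lambda>z. ln \<bar>det (g c z) / (\<mu> z)\<^sup>2\<bar>) y)"

definition Hessian_Einstein ::
  "('a, 'n::finite) chart set \<Rightarrow> ('a, 'n) connection \<Rightarrow> ('a, 'n) tensor2 \<Rightarrow> bool" where
  "Hessian_Einstein A D g \<longleftrightarrow>
     (\<exists>r. \<forall>c\<in>A. \<forall>y\<in>cimg c. KA_ricci D g c y = r *\<^sub>R g c y)"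

definition Monge_Ampere ::
  "('a, 'n::finite) chart set \<Rightarrow> ('a, 'n) connection \<Rightarrow> ('a, 'n) tensor2 \<Rightarrow> bool" where
  "Monge_Ampere A D g \<longleftrightarrow> (\<forall>c\<in>A. \<forall>y\<in>cimg c. KA_ricci D g c y = 0)"


section \<open>Immersed submanifolds\<close>

definition local_src ::
  "('b \<Rightarrow> 'a) \<Rightarrow> ('b, 'm::finite) chart \<Rightarrow> ('a, 'n::finite) chart \<Rightarrow> (real^'m) set" where
  "local_src f b c = snd b ` {p \<in> fst b. f p \<in> fst c}"

definition local_rep ::
  "('b \<Rightarrow> 'a) \<Rightarrow> ('b, 'm::finite) chart \<Rightarrow> ('a, 'n::finite) chart \<Rightarrow> real^'m \<Rightarrow> real^'n" where
  "local_rep f b c = (\<lambda>y. snd c (f (chart_inv b y)))"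

definition immersion ::
  "('b, 'm::finite) chart set \<Rightarrow> ('a, 'n::finite) chart set \<Rightarrow> ('b \<Rightarrow> 'a) \<Rightarrow> bool" where
  "immersion B A f \<longleftrightarrow> f ` points B \<subseteq> points A \<and>
     (\<forall>b\<in>B. \<forall>c\<in>A. open (local_src f b c) \<and> smooth_on (local_src f b c) (local_rep f b c) \<and>
        (\<forall>y\<in>local_src f b c. inj (frechet_derivative (local_rep f b c) (at y))))"

text \<open>The atlas \<open>B\<close> makes the subset \<open>L\<close> a smoothly immersed submanifold.\<close>
definition immersed_submanifold ::
  "('a, 'm::finite) chart set \<Rightarrow> ('a, 'n::finite) chart set \<Rightarrow> 'a set \<Rightarrow> bool" where
  "immersed_submanifold B A L \<longleftrightarrow>
     smooth_atlas B \<and> points B = L \<and> immersion B A (\<lambda>p. p)"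

definition induced_form ::
  "('b \<Rightarrow> 'a) \<Rightarrow> ('a, 'n::finite) tensor2 \<Rightarrow> ('b, 'm::finite) chart \<Rightarrow> ('a, 'n) chart \<Rightarrow>
     real^'m \<Rightarrow> real^'m^'m" where
  "induced_form f g b c y = (let u = local_rep f b c in
     \<chi> i j. pd i u y \<bullet> (g c (u y) *v pd j u y))"

definition Levi_Civita :: "('a, 'n::finite) tensor2 \<Rightarrow> ('a, 'n) connection" where
  "Levi_Civita g c y = (\<chi> k i j. (\<Sum>l\<in>UNIV. matrix_inv (g c y) $ k $ l *
     (pd i (\<lambda>z. g c z $ j $ l) y + pd j (\<lambda>z. g c z $ i $ l) y - pd l (\<lambda>z. g c z $ i $ j) y)) / 2)"

definition normal_vector ::
  "('b \<Rightarrow> 'a) \<Rightarrow> ('a, 'n::finite) tensor2 \<Rightarrow> ('b, 'm::finite) chart \<Rightarrow> ('a, 'n) chart \<Rightarrow>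
     real^'m \<Rightarrow> real^'n \<Rightarrow> bool" where
  "normal_vector f g b c y \<nu> \<longleftrightarrow> (let u = local_rep f b c in
     \<forall>i. pd i u y \<bullet> (g c (u y) *v \<nu>) = 0)"

text \<open>The second fundamental form in the direction of the normal vector \<open>\<nu>\<close>: the \<open>g\<close>-inner
  product of \<open>\<nu>\<close> and the Levi-Civita derivative of \<open>\<partial>\<^sub>j u\<close> along \<open>\<partial>\<^sub>i u\<close>.\<close>
definition second_form ::
  "('b \<Rightarrow> 'a) \<Rightarrow> ('a, 'n::finite) tensor2 \<Rightarrow> ('b, 'm::finite) chart \<Rightarrow> ('a, 'n) chart \<Rightarrow>
     real^'m \<Rightarrow> real^'n \<Rightarrow> real^'m^'m" where
  "second_form f g b c y \<nu> = (let u = local_rep f b c in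
     \<chi> i j. \<nu> \<bullet> (g c (u y) *v (\<chi> k. pd i (pd j u) y $ k +
       (\<Sum>p\<in>UNIV. \<Sum>q\<in>UNIV. Levi_Civita g c (u y) $ k $ p $ q * pd i u y $ p * pd j u y $ q))))"

text \<open>The sign convention: negative definite.\<close>
definition spacelike ::
  "('b, 'm::finite) chart set \<Rightarrow> ('a, 'n::finite) chart set \<Rightarrow> ('b \<Rightarrow> 'a) \<Rightarrow> ('a, 'n) tensor2 \<Rightarrow> bool"
where
  "spacelike B A f g \<longleftrightarrow> (\<forall>b\<in>B. \<forall>c\<in>A. \<forall>y\<in>local_src f b c. \<forall>v.
     v \<noteq> 0 \<longrightarrow> v \<bullet> (induced_form f g b c y *v v) < 0)"

definition umbilic ::
  "('b, 'm::finite) chart set \<Rightarrow> ('a, 'n::finite) chart set \<Rightarrow> ('b \<Rightarrow> 'a) \<Rightarrow> ('a, 'n) tensor2 \<Rightarrow> bool"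
where
  "umbilic B A f g \<longleftrightarrow> (\<forall>b\<in>B. \<forall>c\<in>A. \<forall>y\<in>local_src f b c. \<forall>\<nu>.
     normal_vector f g b c y \<nu> \<longrightarrow>
       (\<exists>r. second_form f g b c y \<nu> = r *\<^sub>R induced_form f g b c y))"

definition totally_geodesic ::
  "('b, 'm::finite) chart set \<Rightarrow> ('a, 'n::finite) chart set \<Rightarrow> ('b \<Rightarrow> 'a) \<Rightarrow> ('a, 'n) tensor2 \<Rightarrow> bool"
where
  "totally_geodesic B A f g \<longleftrightarrow> (\<forall>b\<in>B. \<forall>c\<in>A. \<forall>y\<in>local_src f b c. \<forall>\<nu>.
     normal_vector f g b c y \<nu> \<longrightarrow> second_form f g b c y \<nu> = 0)"

text \<open>\<open>N c p\<close> are the components in the chart \<open>c\<close> of the ambient manifold of the normal vector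
  at the point \<open>p\<close> of the hypersurface.\<close>
definition unit_normal_field ::
  "('b, 'm::finite) chart set \<Rightarrow> ('a, 'n::finite) chart set \<Rightarrow> ('b \<Rightarrow> 'a) \<Rightarrow> ('a, 'n) tensor2 \<Rightarrow>
     (('a, 'n) chart \<Rightarrow> 'b \<Rightarrow> real^'n) \<Rightarrow> bool" where
  "unit_normal_field B A f g N \<longleftrightarrow>
     (\<forall>b\<in>B. \<forall>c\<in>A. smooth_on (local_src f b c) (\<lambda>y. N c (chart_inv b y)) \<and>
        (\<forall>y\<in>local_src f b c. let \<nu> = N c (chart_inv b y) in
           normal_vector f g b c y \<nu> \<and> \<bar>\<nu> \<bullet> (g c (local_rep f b c y) *v \<nu>)\<bar> = 1)) \<and>
     (\<forall>p\<in>points B. \<forall>c\<in>A. \<forall>d\<in>A. f p \<in> fst c \<inter> fst d \<longrightarrow>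
        N d p = jac c d (snd c (f p)) *v N c p)"

definition constant_mean_curvature ::
  "('b, 'm::finite) chart set \<Rightarrow> ('a, 'n::finite) chart set \<Rightarrow> ('b \<Rightarrow> 'a) \<Rightarrow> ('a, 'n) tensor2 \<Rightarrow> bool"
where
  "constant_mean_curvature B A f g \<longleftrightarrow>
     (\<exists>N r. unit_normal_field B A f g N \<and>
        (\<forall>b\<in>B. \<forall>c\<in>A. \<forall>y\<in>local_src f b c.
           trace (matrix_inv (induced_form f g b c y) **
                  second_form f g b c y (N c (chart_inv b y))) / CARD('m) = r))"

definition level_set :: "('a, 2) chart set \<Rightarrow> ('a hat \<Rightarrow> real) \<Rightarrow> real \<Rightarrow> 'a hat set" where
  "level_set A u k = {p \<in> Mhat A. u p = k}"

end

theory Submission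
  imports Defs
begin

text \<open>
  Write \<open>\<beta>\<close> for the principal connection on \<open>M^\<close> and \<open>P = - R H / 2\<close>, which is positive definite. Exactness
  makes the trace of \<open>\<nabla>\<close> closed, so \<open>F = 0\<close>, the Einstein equations become \<open>Ric = - P\<close>, \<open>\<nabla>R = 0\<close>, and the
  Codazzi equation for \<open>H\<close> says that the Cotton tensor of \<open>[\<nabla>]\<close> vanishes, so that the Thomas connection is
  flat. Its defining properties give \<open>\<nabla>^ \<beta> = - \<beta> \<beta> - P\<close>. Together with \<open>d log v = 2 \<beta>\<close> this yields
  \<open>g = v (\<beta> \<beta> - P)\<close> and \<open>f = 3 (\<beta> \<beta> + P)\<close>, from which the signatures are visible. Since
  \<open>det P = R\<^sup>2 / 4\<close>, in the coordinates \<open>(x, s)\<close> with \<open>\<theta>\<^sup>3 = s\<^sup>3 dx\<^sup>1 \<and> dx\<^sup>2\<close> one finds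
  \<open>det g = s\<^sup>4\<close>, the square of a parallel volume form, while \<open>log det f\<close> differs from
  \<open>2 log |R~| + log s\<^sup>4\<close> by a constant. The level surfaces of \<open>R~\<close> are the integral surfaces of
  \<open>ker \<beta>\<close>; along them every normal is vertical, and differentiating \<open>\<beta>(\<partial>\<^sub>j u) = 0\<close> computes the
  second fundamental form.
\<close>

section \<open>Calculus of smooth functions\<close>

text \<open>The hypotheses describe the Thomas connection by its action on horizontal lifts and on
  the dilation field; all local claims rest on turning this into explicit components in coordinates
  (x, s). They then become identities over a plane domain, collected in the locale
  \<open>AH_chart\<close>, where both metrics belong to one family
  \<open>m \<beta> \<beta> + n P\<close>. Flatness holds because a projective structure on a surface
  has no Weyl tensor, and because, R being parallel, the Cotton tensor is \<open>- R / 2\<close>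
  times the skew derivative of H, which alignment makes vanish. Two constants recur: 3 is the cube
  in the definition of the bundle, and the 2 in \<open>v~ = (|R~| / 2)^(-2/3)\<close> compensates
  the 4 in \<open>det P = R^2 / 4\<close>. Globally, \<open>\<beta>\<close> is recognised as a form
  on the bundle because v~ is a function with \<open>d v~ = 2 v~ \<beta>\<close>. Fibre coordinates
  take both signs and change by cube roots of determinants of either sign, so a level surface has
  two sheets over each chart, glued according to these signs; it is built over countably many base
  charts.\<close>

lemma frechet_derivative_eqI:
  assumes "(f has_derivative f') (at x)"
  shows "frechet_derivative f (at x) = f'"
  using frechet_derivative_at[OF assms] by simp

text \<open>\<open>frechet_derivative\<close> is a choice among the maps that are derivatives at the
  point, and which maps are derivatives depends only on the germ of the function.\<close>

lemma frechet_derivative_cong: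
  assumes "open S" "x \<in> S" "\<And>y. y \<in> S \<Longrightarrow> f y = g y"
  shows "frechet_derivative f (at x) = frechet_derivative g (at x)"
proof -
  have "(f has_derivative h) (at x) \<longleftrightarrow> (g has_derivative h) (at x)" for h
    using has_derivative_transform_within_open[of f h x UNIV S g]
      has_derivative_transform_within_open[of g h x UNIV S f] assms by auto
  then show ?thesis
    by (simp add: frechet_derivative_def)
qed

lemma pd_cong:
  assumes "open S" "x \<in> S" "\<And>y. y \<in> S \<Longrightarrow> f y = g y"
  shows "pd i f x = pd i g x"
  unfolding pd_def using frechet_derivative_cong[OF assms] by simp

lemma Ck_on_cong:
  assumes "open S" "Ck_on k S f" "\<And>x. x \<in> S \<Longrightarrow> f x = g x"
  shows "Ck_on k S g"
  using assms(2,3)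
proof (induction k arbitrary: f g)
  case 0
  then show ?case by (metis Ck_on.simps(1) continuous_on_eq)
next
  case (Suc k)
  have "g differentiable (at x)" if "x \<in> S" for x
  proof -
    have "f differentiable (at x)"
      using Suc.prems(1) that by simp
    then obtain D where "(f has_derivative D) (at x)"
      unfolding differentiable_def by (rule exE)
    then have "(g has_derivative D) (at x)"
      by (rule has_derivative_transform_within_open[OF _ assms(1) that Suc.prems(2)])
    then show ?thesis by (auto simp: differentiable_def)
  qed
  moreover have "Ck_on k S (\<lambda>x. frechet_derivative g (at x) v)" for v
  proof (rule Suc.IH[of "\<lambda>x. frechet_derivative f (at x) v"])
    show "Ck_on k S (\<lambda>x. frechet_derivative f (at x) v)"
      using Suc.prems(1) by simp
    show "frechet_derivative f (at x) v = frechet_derivative g (at x) v" if "x \<in> S" for x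
      using frechet_derivative_cong[OF assms(1) that Suc.prems(2)] by simp
  qed
  ultimately show ?case by simp
qed

text \<open>Replaces the chosen \<open>frechet_derivative\<close> by an explicit formula
  \<open>f'\<close>, so that each closure rule below is an induction on \<open>k\<close> through the
  usual derivative formula.\<close>

lemma Ck_on_SucI:
  assumes "open S" "\<And>x. x \<in> S \<Longrightarrow> (f has_derivative f' x) (at x)" "\<And>v. Ck_on k S (\<lambda>x. f' x v)"
  shows "Ck_on (Suc k) S f"
proof -
  have "frechet_derivative f (at x) v = f' x v" if "x \<in> S" for x v
    using frechet_derivative_eqI[OF assms(2)[OF that]] by simp
  then have "Ck_on k S (\<lambda>x. frechet_derivative f (at x) v)" for v
    using Ck_on_cong[OF assms(1) assms(3)] by simp
  then show ?thesis
    using assms(2) by (auto simp: differentiable_def)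
qed

lemma Ck_on_Suc_imp: "Ck_on (Suc k) S f \<Longrightarrow> Ck_on k S f"
proof (induction k arbitrary: f)
  case 0
  then show ?case
    by (auto intro!: differentiable_imp_continuous_on differentiable_at_imp_differentiable_on)
next
  case (Suc k)
  then show ?case by auto
qed

lemma Ck_on_has_derivative:
  assumes "Ck_on (Suc k) S f" "x \<in> S"
  shows "(f has_derivative frechet_derivative f (at x)) (at x)"
  using assms by (auto simp: frechet_derivative_works)

lemma Ck_on_const: "Ck_on k S (\<lambda>x. c)"
  by (induction k arbitrary: c) auto

lemma Ck_on_add:
  assumes "open S" "Ck_on k S f" "Ck_on k S g"
  shows "Ck_on k S (\<lambda>x. f x + g x)"
  using assms(2,3)
proof (induction k arbitrary: f g)
  case 0
  then show ?case by (auto intro: continuous_on_add)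
next
  case (Suc k)
  show ?case
  proof (rule Ck_on_SucI[OF assms(1)])
    show "((\<lambda>x. f x + g x) has_derivative
        (\<lambda>v. frechet_derivative f (at x) v + frechet_derivative g (at x) v)) (at x)" if "x \<in> S" for x
      by (intro has_derivative_add Ck_on_has_derivative[OF Suc.prems(1) that]
          Ck_on_has_derivative[OF Suc.prems(2) that])
    show "Ck_on k S (\<lambda>x. frechet_derivative f (at x) v + frechet_derivative g (at x) v)" for v
      using Suc by auto
  qed
qed

lemma Ck_on_sum:
  assumes "open S" "finite I" "\<And>i. i \<in> I \<Longrightarrow> Ck_on k S (f i)"
  shows "Ck_on k S (\<lambda>x. \<Sum>i\<in>I. f i x)"
  using assms(2,3) by (induction I) (auto intro!: Ck_on_const Ck_on_add[OF assms(1)])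

lemma Ck_on_bounded_linear:
  assumes "open S" "bounded_linear L" "Ck_on k S f"
  shows "Ck_on k S (\<lambda>x. L (f x))"
  using assms(3)
proof (induction k arbitrary: f)
  case 0
  then show ?case using assms(2) by (auto intro: bounded_linear.continuous_on)
next
  case (Suc k)
  show ?case
  proof (rule Ck_on_SucI[OF assms(1)])
    show "((\<lambda>x. L (f x)) has_derivative (\<lambda>v. L (frechet_derivative f (at x) v))) (at x)"
      if "x \<in> S" for x
      by (intro bounded_linear.has_derivative[OF assms(2)] Ck_on_has_derivative[OF Suc.prems that])
    show "Ck_on k S (\<lambda>x. L (frechet_derivative f (at x) v))" for v
      using Suc by auto
  qed
qed

text \<open>The derivative is again a sum of two values of \<open>b\<close>, one with
  \<open>f\<close> and one with \<open>g\<close> differentiated; hence the induction generalises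
  over both functions. Products and scalar multiples are instances.\<close>

lemma Ck_on_bounded_bilinear:
  assumes "open S" "bounded_bilinear b" "Ck_on k S f" "Ck_on k S g"
  shows "Ck_on k S (\<lambda>x. b (f x) (g x))"
  using assms(3,4)
proof (induction k arbitrary: f g)
  case 0
  then show ?case using assms(2) by (auto intro: bounded_bilinear.continuous_on)
next
  case (Suc k)
  show ?case
  proof (rule Ck_on_SucI[OF assms(1)])
    show "((\<lambda>x. b (f x) (g x)) has_derivative
      (\<lambda>v. b (f x) (frechet_derivative g (at x) v) + b (frechet_derivative f (at x) v) (g x))) (at x)"
      if "x \<in> S" for x
      by (intro bounded_bilinear.FDERIV[OF assms(2)] Ck_on_has_derivative[OF Suc.prems(1) that]
          Ck_on_has_derivative[OF Suc.prems(2) that])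
    show "Ck_on k S (\<lambda>x. b (f x) (frechet_derivative g (at x) v) +
        b (frechet_derivative f (at x) v) (g x))" for v
      using Suc Ck_on_Suc_imp[OF Suc.prems(1)] Ck_on_Suc_imp[OF Suc.prems(2)]
      by (intro Ck_on_add[OF assms(1)] Suc.IH) auto
  qed
qed

lemma Ck_on_id: "open S \<Longrightarrow> Ck_on k S (\<lambda>x. x)"
  by (induction k) (auto intro!: Ck_on_SucI[where f' = "\<lambda>x v. v"] derivative_eq_intros Ck_on_const)

text \<open>The derivative of \<open>g \<circ> f\<close> is a directional derivative of \<open>g\<close> in a direction that varies with
  the point, so it has to be expanded in a basis.\<close>
lemma Ck_on_compose:
  fixes f :: "'a::real_normed_vector \<Rightarrow> 'b::euclidean_space"
  assumes "open S" "open T" "\<And>x. x \<in> S \<Longrightarrow> f x \<in> T" "Ck_on k S f" "Ck_on k T g"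
  shows "Ck_on k S (\<lambda>x. g (f x))"
  using assms(4,5)
proof (induction k arbitrary: g)
  case 0
  then show ?case using assms(3) by (auto intro: continuous_on_compose2)
next
  case (Suc k)
  let ?D = "\<lambda>x v. frechet_derivative g (at (f x)) (frechet_derivative f (at x) v)"
  show ?case
  proof (rule Ck_on_SucI[OF assms(1)])
    show "((\<lambda>x. g (f x)) has_derivative ?D x) (at x)" if "x \<in> S" for x
      using has_derivative_compose[OF Ck_on_has_derivative[OF Suc.prems(1) that]
          Ck_on_has_derivative[OF Suc.prems(2) assms(3)[OF that]]] by simp
    show "Ck_on k S (\<lambda>x. ?D x v)" for v
    proof (rule Ck_on_cong[OF assms(1)])
      show "Ck_on k S (\<lambda>x. \<Sum>b\<in>Basis. (frechet_derivative f (at x) v \<bullet> b) *\<^sub>R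
          frechet_derivative g (at (f x)) b)"
        using Suc.prems Ck_on_Suc_imp[OF Suc.prems(1)]
        by (intro Ck_on_sum assms(1) Ck_on_bounded_bilinear[OF assms(1) bounded_bilinear_scaleR]
            Ck_on_bounded_linear[OF assms(1) bounded_linear_inner_left] Suc.IH) auto
    next
      fix x assume x: "x \<in> S"
      interpret linear "frechet_derivative g (at (f x))"
        using Ck_on_has_derivative[OF Suc.prems(2) assms(3)[OF x]] by (rule has_derivative_linear)
      show "(\<Sum>b\<in>Basis. (frechet_derivative f (at x) v \<bullet> b) *\<^sub>R
          frechet_derivative g (at (f x)) b) = ?D x v"
        by (subst (2) euclidean_representation[of "frechet_derivative f (at x) v", symmetric])
           (simp add: sum scale)
    qed
  qed
qed

lemma smooth_on_cong:
  "open S \<Longrightarrow> smooth_on S f \<Longrightarrow> (\<And>x. x \<in> S \<Longrightarrow> f x = g x) \<Longrightarrow> smooth_on S g"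
  unfolding smooth_on_def using Ck_on_cong by blast

lemma smooth_on_has_derivative:
  assumes "smooth_on S f" "x \<in> S"
  shows "(f has_derivative frechet_derivative f (at x)) (at x)"
  using assms Ck_on_has_derivative unfolding smooth_on_def by blast

lemma smooth_on_differentiable: "smooth_on S f \<Longrightarrow> x \<in> S \<Longrightarrow> f differentiable (at x)"
  using smooth_on_has_derivative by (auto simp: differentiable_def)

lemma smooth_on_continuous_on: "smooth_on S f \<Longrightarrow> continuous_on S f"
  unfolding smooth_on_def using Ck_on.simps(1) by blast

lemma smooth_on_frechet_derivative:
  "smooth_on S f \<Longrightarrow> smooth_on S (\<lambda>x. frechet_derivative f (at x) v)"
  unfolding smooth_on_def using Ck_on.simps(2) by blast

lemma smooth_on_pd: "smooth_on S f \<Longrightarrow> smooth_on S (pd i f)"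
  unfolding pd_def[abs_def] by (rule smooth_on_frechet_derivative)

lemma smooth_on_subset:
  assumes "smooth_on S f" "T \<subseteq> S"
  shows "smooth_on T f"
proof -
  have "Ck_on k S f \<Longrightarrow> Ck_on k T f" for k
    using assms(2) by (induction k arbitrary: f) (auto intro: continuous_on_subset)
  then show ?thesis
    using assms(1) by (simp add: smooth_on_def)
qed

lemma smooth_on_const: "smooth_on S (\<lambda>x. c)"
  by (simp add: smooth_on_def Ck_on_const)

lemma smooth_on_id: "open S \<Longrightarrow> smooth_on S (\<lambda>x. x)"
  by (simp add: smooth_on_def Ck_on_id)

lemma smooth_on_add: "open S \<Longrightarrow> smooth_on S f \<Longrightarrow> smooth_on S g \<Longrightarrow> smooth_on S (\<lambda>x. f x + g x)"
  by (simp add: smooth_on_def Ck_on_add)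

lemma smooth_on_sum:
  "open S \<Longrightarrow> finite I \<Longrightarrow> (\<And>i. i \<in> I \<Longrightarrow> smooth_on S (f i)) \<Longrightarrow> smooth_on S (\<lambda>x. \<Sum>i\<in>I. f i x)"
  by (simp add: smooth_on_def Ck_on_sum)

lemma smooth_on_bounded_linear:
  "open S \<Longrightarrow> bounded_linear L \<Longrightarrow> smooth_on S f \<Longrightarrow> smooth_on S (\<lambda>x. L (f x))"
  by (simp add: smooth_on_def Ck_on_bounded_linear)

lemma smooth_on_bounded_bilinear:
  "open S \<Longrightarrow> bounded_bilinear b \<Longrightarrow> smooth_on S f \<Longrightarrow> smooth_on S g \<Longrightarrow>
    smooth_on S (\<lambda>x. b (f x) (g x))"
  by (simp add: smooth_on_def Ck_on_bounded_bilinear)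

lemma smooth_on_mult:
  fixes f g :: "_ \<Rightarrow> real"
  shows "open S \<Longrightarrow> smooth_on S f \<Longrightarrow> smooth_on S g \<Longrightarrow> smooth_on S (\<lambda>x. f x * g x)"
  by (rule smooth_on_bounded_bilinear[OF _ bounded_bilinear_mult])

lemma smooth_on_minus: "open S \<Longrightarrow> smooth_on S f \<Longrightarrow> smooth_on S (\<lambda>x. - f x)"
  by (rule smooth_on_bounded_linear) (auto intro: bounded_linear_minus bounded_linear_ident)

lemma smooth_on_diff: "open S \<Longrightarrow> smooth_on S f \<Longrightarrow> smooth_on S g \<Longrightarrow> smooth_on S (\<lambda>x. f x - g x)"
  using smooth_on_add[of S f "\<lambda>x. - g x"] smooth_on_minus[of S g] by simp

lemma smooth_on_power:
  fixes f :: "_ \<Rightarrow> real"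
  shows "open S \<Longrightarrow> smooth_on S f \<Longrightarrow> smooth_on S (\<lambda>x. f x ^ n)"
  by (induction n) (auto intro: smooth_on_mult smooth_on_const)

lemma smooth_on_nth: "open S \<Longrightarrow> smooth_on S f \<Longrightarrow> smooth_on S (\<lambda>x. f x $ i)"
  by (rule smooth_on_bounded_linear[OF _ bounded_linear_vec_nth])

lemma smooth_on_compose:
  fixes f :: "'a::real_normed_vector \<Rightarrow> 'b::euclidean_space"
  assumes "open S" "open T" "\<And>x. x \<in> S \<Longrightarrow> f x \<in> T" "smooth_on S f" "smooth_on T g"
  shows "smooth_on S (\<lambda>x. g (f x))"
  using assms by (auto simp: smooth_on_def intro: Ck_on_compose)

lemma bounded_linear_axis:
  "bounded_linear (\<lambda>x. axis i x :: 'a::euclidean_space^'n::finite)"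
  by (subst linear_conv_bounded_linear[symmetric])
     (auto intro!: linearI simp: vec_eq_iff axis_def)

lemma smooth_on_vec_lambda:
  fixes f :: "'a::real_normed_vector \<Rightarrow> 'b::euclidean_space^'n::finite"
  assumes "open S" "\<And>i. smooth_on S (\<lambda>x. f x $ i)"
  shows "smooth_on S f"
proof -
  have "smooth_on S (\<lambda>x. \<Sum>i\<in>UNIV. axis i (f x $ i))"
    using assms by (intro smooth_on_sum smooth_on_bounded_linear[OF _ bounded_linear_axis]) auto
  moreover have "(\<Sum>i\<in>UNIV. axis i (f x $ i)) = f x" for x
    by (simp add: vec_eq_iff axis_def if_distrib sum.delta cong: if_cong)
  ultimately show ?thesis by simp
qed

text \<open>The family \<open>c * x powr a\<close> is closed under differentiation, which changes
  both \<open>c\<close> and \<open>a\<close>; the direction \<open>v\<close> is absorbed in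
  \<open>c\<close> as well.\<close>

lemma Ck_on_powr: "Ck_on k {0<..} (\<lambda>x::real. c * x powr a)"
proof (induction k arbitrary: c a)
  case 0
  then show ?case by (auto intro!: continuous_intros)
next
  case (Suc k)
  have "((\<lambda>x. c * x powr a) has_derivative (\<lambda>v. (v * c * a) * x powr (a - 1))) (at x)"
    if "x \<in> {0<..}" for x :: real
    using that by (auto intro!: derivative_eq_intros simp: powr_diff field_simps)
  from Ck_on_SucI[OF _ this Suc] show ?case by simp
qed

lemma smooth_on_powr:
  fixes f :: "'a::real_normed_vector \<Rightarrow> real"
  assumes "open S" "smooth_on S f" "\<And>x. x \<in> S \<Longrightarrow> f x > 0"
  shows "smooth_on S (\<lambda>x. f x powr a)"
proof -
  have "smooth_on {0<..} (\<lambda>x::real. x powr a)"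
    using Ck_on_powr[where c = 1 and a = a] by (auto simp: smooth_on_def)
  from smooth_on_compose[OF assms(1) _ _ assms(2) this] show ?thesis
    using assms(3) by auto
qed

lemma smooth_on_inverse:
  fixes f :: "'a::real_normed_vector \<Rightarrow> real"
  assumes "open S" "smooth_on S f" "\<And>x. x \<in> S \<Longrightarrow> f x \<noteq> 0"
  shows "smooth_on S (\<lambda>x. inverse (f x))"
proof -
  \<comment> \<open>Squaring makes the base of the power positive whichever sign \<open>f\<close>
    has.\<close>
  have "smooth_on S (\<lambda>x. f x * ((f x)\<^sup>2) powr (-1))"
    using assms by (intro smooth_on_mult smooth_on_powr smooth_on_power) auto
  then show ?thesis
    by (rule smooth_on_cong[OF assms(1)])
       (use assms(3) in \<open>auto simp: powr_minus power2_eq_square field_simps\<close>)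
qed

lemma smooth_on_divide:
  fixes f :: "'a::real_normed_vector \<Rightarrow> real"
  assumes "open S" "smooth_on S f" "smooth_on S g" "\<And>x. x \<in> S \<Longrightarrow> g x \<noteq> 0"
  shows "smooth_on S (\<lambda>x. f x / g x)"
  unfolding divide_inverse using assms by (intro smooth_on_mult smooth_on_inverse) auto

text \<open>The first derivative of \<open>ln\<close> is the power \<open>x powr (-1)\<close>, so
  smoothness of powers finishes the argument in one step.\<close>

lemma smooth_on_ln:
  fixes f :: "'a::real_normed_vector \<Rightarrow> real"
  assumes "open S" "smooth_on S f" "\<And>x. x \<in> S \<Longrightarrow> f x > 0"
  shows "smooth_on S (\<lambda>x. ln (f x))"
proof -
  have "Ck_on k {0<..} (\<lambda>x::real. ln x)" for k
  proof (cases k)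
    case (Suc j)
    have "(ln has_derivative (\<lambda>v. v * x powr (-1))) (at x)" if "x \<in> {0<..}" for x :: real
      using that by (auto intro!: derivative_eq_intros simp: powr_minus field_simps)
    from Ck_on_SucI[OF _ this Ck_on_powr] show ?thesis
      unfolding Suc by simp
  qed (auto intro!: continuous_intros)
  then have "smooth_on {0<..} (\<lambda>x::real. ln x)"
    by (simp add: smooth_on_def)
  from smooth_on_compose[OF assms(1) _ _ assms(2) this] show ?thesis
    using assms(3) by auto
qed

text \<open>Expresses the cube root of a number of either sign by a power with positive base. Fibre
  coordinates of the bundle change by cube roots of Jacobian determinants, which may be
  negative.\<close>

lemma root_3_eq_powr:
  fixes t :: real
  assumes "t \<noteq> 0"
  shows "root 3 t = t * (t\<^sup>2) powr (-1/3)"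
proof -
  have "(t * (t\<^sup>2) powr (-1/3)) ^ 3 = t"
  proof -
    have "((t\<^sup>2) powr (-1/3)) ^ 3 = (t\<^sup>2) powr (-1)"
      using assms by (simp add: powr_realpow[symmetric] powr_powr)
    then show ?thesis
      using assms by (simp add: power_mult_distrib powr_minus field_simps power2_eq_square power3_eq_cube)
  qed
  then show ?thesis
    by (metis odd_real_root_power_cancel odd_numeral)
qed

lemma smooth_on_root_3:
  fixes f :: "'a::real_normed_vector \<Rightarrow> real"
  assumes "open S" "smooth_on S f" "\<And>x. x \<in> S \<Longrightarrow> f x \<noteq> 0"
  shows "smooth_on S (\<lambda>x. root 3 (f x))"
proof -
  have "smooth_on S (\<lambda>x. f x * ((f x)\<^sup>2) powr (-1/3))"
    using assms by (intro smooth_on_mult smooth_on_powr smooth_on_power) auto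
  then show ?thesis
    by (rule smooth_on_cong[OF assms(1)]) (use assms(3) in \<open>auto simp: root_3_eq_powr\<close>)
qed

lemma smooth_on_det_2:
  fixes f :: "'a::real_normed_vector \<Rightarrow> real^2^2"
  assumes "open S" "smooth_on S f"
  shows "smooth_on S (\<lambda>x. det (f x))"
  unfolding det_2 using assms by (intro smooth_on_diff smooth_on_mult smooth_on_nth)

section \<open>Partial derivatives\<close>

lemmas differentiable_has_derivative = frechet_derivative_works[THEN iffD1]

lemma pd_eqI: "(f has_derivative f') (at x) \<Longrightarrow> pd i f x = f' (axis i 1)"
  by (simp add: pd_def frechet_derivative_eqI)

lemma frechet_derivative_eq_sum_pd:
  fixes f :: "real^'n::finite \<Rightarrow> 'b::real_normed_vector"
  assumes "f differentiable (at x)"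
  shows "frechet_derivative f (at x) v = (\<Sum>i\<in>UNIV. v $ i *\<^sub>R pd i f x)"
proof -
  interpret linear "frechet_derivative f (at x)"
    using assms frechet_derivative_works has_derivative_linear by blast
  have "v = (\<Sum>i\<in>UNIV. v $ i *\<^sub>R axis i 1)"
    using basis_expansion[of v] by (simp add: scalar_mult_eq_scaleR)
  then have "frechet_derivative f (at x) v = frechet_derivative f (at x) (\<Sum>i\<in>UNIV. v $ i *\<^sub>R axis i 1)"
    by simp
  then show ?thesis
    by (simp add: sum scale pd_def)
qed

lemma pd_const [simp]: "pd i (\<lambda>z. c) x = 0"
  by (rule pd_eqI[where f' = "\<lambda>v. 0", simplified]) simp

lemma pd_chain:
  fixes f :: "real^'n::finite \<Rightarrow> 'b::real_normed_vector" and u :: "real^'m::finite \<Rightarrow> real^'n"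
  assumes "u differentiable (at y)" "f differentiable (at (u y))"
  shows "pd i (\<lambda>y. f (u y)) y = (\<Sum>K\<in>UNIV. pd i u y $ K *\<^sub>R pd K f (u y))"
proof -
  have "((\<lambda>y. f (u y)) has_derivative
      (\<lambda>v. frechet_derivative f (at (u y)) (frechet_derivative u (at y) v))) (at y)"
    by (rule has_derivative_compose[OF differentiable_has_derivative[OF assms(1)]
        differentiable_has_derivative[OF assms(2)]])
  from pd_eqI[OF this] show ?thesis
    unfolding frechet_derivative_eq_sum_pd[OF assms(2)] by (simp add: pd_def[of _ u])
qed

lemma pd_nth:
  assumes "f differentiable (at x)"
  shows "pd i (\<lambda>z. f z $ k) x = pd i f x $ k"
  unfolding pd_eqI[OF bounded_linear.has_derivative[OF bounded_linear_vec_nth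
      differentiable_has_derivative[OF assms]]] by (simp add: pd_def)

lemma pd_add:
  assumes "f differentiable (at x)" "g differentiable (at x)"
  shows "pd i (\<lambda>z. f z + g z) x = pd i f x + pd i g x"
  unfolding pd_eqI[OF has_derivative_add[OF assms[THEN differentiable_has_derivative]]]
  by (simp add: pd_def)

lemma pd_diff:
  assumes "f differentiable (at x)" "g differentiable (at x)"
  shows "pd i (\<lambda>z. f z - g z) x = pd i f x - pd i g x"
  unfolding pd_eqI[OF has_derivative_diff[OF assms[THEN differentiable_has_derivative]]]
  by (simp add: pd_def)

lemma pd_minus:
  assumes "f differentiable (at x)"
  shows "pd i (\<lambda>z. - f z) x = - pd i f x"
  using pd_diff[of "\<lambda>z. 0" x f i] assms by simp

lemma pd_mult:
  fixes f g :: "real^'n::finite \<Rightarrow> real"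
  assumes "f differentiable (at x)" "g differentiable (at x)"
  shows "pd i (\<lambda>z. f z * g z) x = f x * pd i g x + pd i f x * g x"
  unfolding pd_eqI[OF has_derivative_mult[OF assms[THEN differentiable_has_derivative]]]
  by (simp add: pd_def)

lemma pd_cmult:
  fixes f :: "real^'n::finite \<Rightarrow> real"
  assumes "f differentiable (at x)"
  shows "pd i (\<lambda>z. c * f z) x = c * pd i f x"
  using pd_mult[of "\<lambda>z. c" x f i] assms by simp

lemma pd_sum:
  assumes "\<And>k. k \<in> I \<Longrightarrow> f k differentiable (at x)"
  shows "pd i (\<lambda>z. \<Sum>k\<in>I. f k z) x = (\<Sum>k\<in>I. pd i (f k) x)"
proof -
  have "((\<lambda>z. \<Sum>k\<in>I. f k z) has_derivative (\<lambda>v. \<Sum>k\<in>I. frechet_derivative (f k) (at x) v)) (at x)"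
    by (rule has_derivative_sum) (use assms differentiable_has_derivative in blast)
  from pd_eqI[OF this] show ?thesis by (simp add: pd_def)
qed

lemma pd_coord: "pd i (\<lambda>z. z $ k) x = (if i = k then 1 else 0)"
proof -
  have "((\<lambda>z. z $ k) has_derivative (\<lambda>v. v $ k)) (at x)"
    using bounded_linear.has_derivative[OF bounded_linear_vec_nth has_derivative_ident] .
  from pd_eqI[OF this] show ?thesis by (auto simp: axis_def)
qed

lemma pd_real_chain:
  fixes f :: "real^'n::finite \<Rightarrow> real"
  assumes "f differentiable (at x)" "(\<phi> has_real_derivative \<phi>') (at (f x))"
  shows "pd i (\<lambda>z. \<phi> (f z)) x = \<phi>' * pd i f x"
proof -
  have "((\<lambda>z. \<phi> (f z)) has_derivative (\<lambda>v. \<phi>' * frechet_derivative f (at x) v)) (at x)"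
    using has_derivative_compose[OF differentiable_has_derivative[OF assms(1)]
        assms(2)[unfolded has_field_derivative_def]] .
  from pd_eqI[OF this] show ?thesis by (simp add: pd_def)
qed

text \<open>The mean value theorem is applied twice: to the difference in direction \<open>j\<close>
  as a function of the displacement along \<open>i\<close>, and then to \<open>pd i f\<close> along
  \<open>j\<close>. The left-hand side does not change when \<open>i\<close> and \<open>j\<close>
  are exchanged, which is the point of the formula.\<close>

lemma second_difference_mean_value:
  fixes f :: "real^'n::finite \<Rightarrow> real"
  assumes S: "open S" "ball x e \<subseteq> S" "smooth_on S f" and d: "0 < d" "2 * d < e"
  shows "\<exists>p. dist x p < 2 * d \<and>
    f (x + d *\<^sub>R axis i 1 + d *\<^sub>R axis j 1) - f (x + d *\<^sub>R axis i 1) - f (x + d *\<^sub>R axis j 1) + f x =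
    d\<^sup>2 * pd j (pd i f) p"
proof -
  define a b :: "real^'n" where "a = axis i 1" and "b = axis j 1"
  have nab: "norm a = 1" "norm b = 1" by (simp_all add: a_def b_def norm_axis_1)
  have close: "dist x (x + s *\<^sub>R a + t *\<^sub>R b) \<le> s + t" if "0 \<le> s" "0 \<le> t" for s t
  proof -
    have "dist x (x + s *\<^sub>R a + t *\<^sub>R b) = norm (s *\<^sub>R a + t *\<^sub>R b)"
      by (metis add.assoc add_diff_cancel_left' dist_commute dist_norm)
    then show ?thesis
      using norm_triangle_ineq[of "s *\<^sub>R a" "t *\<^sub>R b"] that nab by simp
  qed
  have mem: "x + s *\<^sub>R a + t *\<^sub>R b \<in> S" if "0 \<le> s" "s \<le> d" "0 \<le> t" "t \<le> d" for s t
    using close[of s t] that d S(2) by (auto simp: subset_iff)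
  have line: "((\<lambda>t. h (y + t *\<^sub>R axis l 1)) has_real_derivative pd l h (y + t *\<^sub>R axis l 1)) (at t)"
    if "smooth_on S h" "y + t *\<^sub>R axis l 1 \<in> S" for h :: "real^'n \<Rightarrow> real" and y l t
  proof -
    have "((\<lambda>t. y + t *\<^sub>R axis l 1) has_derivative (\<lambda>r. r *\<^sub>R axis l 1)) (at t)"
      by (auto intro!: derivative_eq_intros)
    from has_derivative_compose[OF this smooth_on_has_derivative[OF that]]
    have "((\<lambda>t. h (y + t *\<^sub>R axis l 1)) has_derivative
        (\<lambda>r. frechet_derivative h (at (y + t *\<^sub>R axis l 1)) (r *\<^sub>R axis l 1))) (at t)" .
    moreover have "frechet_derivative h (at (y + t *\<^sub>R axis l 1)) (r *\<^sub>R axis l 1) =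
        r * pd l h (y + t *\<^sub>R axis l 1)" for r
      using linear.scaleR[OF has_derivative_linear[OF smooth_on_has_derivative[OF that]]]
      by (simp add: pd_def)
    ultimately show ?thesis
      by (simp add: has_field_derivative_def mult.commute[of _ "pd l h _"])
  qed
  define \<phi> where "\<phi> s = f (x + s *\<^sub>R a + d *\<^sub>R b) - f (x + s *\<^sub>R a)" for s
  have "DERIV \<phi> s :> pd i f (x + s *\<^sub>R a + d *\<^sub>R b) - pd i f (x + s *\<^sub>R a)"
    if "0 \<le> s" "s \<le> d" for s
    unfolding \<phi>_def
    using line[OF S(3), of "x + d *\<^sub>R b" s i] line[OF S(3), of x s i] mem[of s d] mem[of s 0] that d(1)
    by (intro DERIV_diff) (auto simp: a_def add_ac)
  from MVT2[OF d(1) this] obtain s where s: "0 < s" "s < d"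
    "\<phi> d - \<phi> 0 = d * (pd i f (x + s *\<^sub>R a + d *\<^sub>R b) - pd i f (x + s *\<^sub>R a))"
    by auto
  have "DERIV (\<lambda>t. pd i f (x + s *\<^sub>R a + t *\<^sub>R b)) t :> pd j (pd i f) (x + s *\<^sub>R a + t *\<^sub>R b)"
    if "0 \<le> t" "t \<le> d" for t
    using line[OF smooth_on_pd[OF S(3)], of "x + s *\<^sub>R a" t j] mem[of s t] that s by (auto simp: b_def)
  from MVT2[OF d(1) this] obtain t where t: "0 < t" "t < d"
    "pd i f (x + s *\<^sub>R a + d *\<^sub>R b) - pd i f (x + s *\<^sub>R a + 0 *\<^sub>R b) =
      d * pd j (pd i f) (x + s *\<^sub>R a + t *\<^sub>R b)"
    by auto
  have "\<phi> d - \<phi> 0 = d\<^sup>2 * pd j (pd i f) (x + s *\<^sub>R a + t *\<^sub>R b)"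
    using s t by (simp add: power2_eq_square)
  moreover have "dist x (x + s *\<^sub>R a + t *\<^sub>R b) < 2 * d"
    using close[of s t] s t by linarith
  ultimately show ?thesis
    unfolding \<phi>_def a_def b_def
    by (intro exI[of _ "x + s *\<^sub>R axis i 1 + t *\<^sub>R axis j 1"]) (simp add: algebra_simps)
qed

text \<open>Both mixed derivatives occur as the same second difference divided by
  \<open>d\<^sup>2\<close>, at two points that tend to \<open>x\<close> with \<open>d\<close>;
  continuity then identifies their values at \<open>x\<close>.\<close>

lemma pd_commute:
  fixes f :: "real^'n::finite \<Rightarrow> real"
  assumes S: "open S" "x \<in> S" "smooth_on S f"
  shows "pd i (pd j f) x = pd j (pd i f) x"
proof (rule ccontr)
  assume neq: "\<not> ?thesis"
  \<comment> \<open>Half the supposed gap: two errors below \<open>\<epsilon>\<close> cannot bridge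
    it.\<close>
  define \<epsilon> where "\<epsilon> = \<bar>pd i (pd j f) x - pd j (pd i f) x\<bar> / 2"
  have \<epsilon>: "\<epsilon> > 0" using neq by (simp add: \<epsilon>_def)
  have cont: "\<exists>\<delta>>0. \<forall>p. dist x p < \<delta> \<longrightarrow> \<bar>pd l (pd m f) p - pd l (pd m f) x\<bar> < \<epsilon>" for l m
  proof -
    have "continuous (at x) (pd l (pd m f))"
      using smooth_on_continuous_on[OF smooth_on_pd[OF smooth_on_pd[OF S(3)]]] S
      by (simp add: continuous_on_eq_continuous_at)
    then show ?thesis
      using \<epsilon> unfolding continuous_at_eps_delta by (metis dist_commute dist_real_def)
  qed
  obtain \<delta>1 \<delta>2 where \<delta>: "\<delta>1 > 0" "\<delta>2 > 0"
    "\<And>p. dist x p < \<delta>1 \<Longrightarrow> \<bar>pd i (pd j f) p - pd i (pd j f) x\<bar> < \<epsilon>"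
    "\<And>p. dist x p < \<delta>2 \<Longrightarrow> \<bar>pd j (pd i f) p - pd j (pd i f) x\<bar> < \<epsilon>"
    using cont[of i j] cont[of j i] by metis
  obtain e where e: "e > 0" "ball x e \<subseteq> S"
    using S open_contains_ball by blast
  define d where "d = min e (min \<delta>1 \<delta>2) / 3"
  have d: "0 < d" "2 * d < e" "2 * d < \<delta>1" "2 * d < \<delta>2"
    using e \<delta> by (auto simp: d_def min_def)
  obtain p where p: "dist x p < 2 * d"
    "f (x + d *\<^sub>R axis i 1 + d *\<^sub>R axis j 1) - f (x + d *\<^sub>R axis i 1) - f (x + d *\<^sub>R axis j 1) + f x =
      d\<^sup>2 * pd j (pd i f) p"
    using second_difference_mean_value[OF S(1) e(2) S(3) d(1,2)] by blast
  obtain q where q: "dist x q < 2 * d"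
    "f (x + d *\<^sub>R axis j 1 + d *\<^sub>R axis i 1) - f (x + d *\<^sub>R axis j 1) - f (x + d *\<^sub>R axis i 1) + f x =
      d\<^sup>2 * pd i (pd j f) q"
    using second_difference_mean_value[OF S(1) e(2) S(3) d(1,2)] by blast
  have "d\<^sup>2 * pd j (pd i f) p = d\<^sup>2 * pd i (pd j f) q"
    using p(2) q(2) by (simp add: algebra_simps)
  then have "pd j (pd i f) p = pd i (pd j f) q"
    using d(1) by simp
  moreover have "\<bar>pd i (pd j f) q - pd i (pd j f) x\<bar> < \<epsilon>" "\<bar>pd j (pd i f) p - pd j (pd i f) x\<bar> < \<epsilon>"
    using \<delta>(3)[of q] \<delta>(4)[of p] p(1) q(1) d by auto
  ultimately show False
    unfolding \<epsilon>_def by (auto simp: abs_if split: if_splits)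
qed

text \<open>A logarithmic differential is closed. Writing it as
  \<open>pd i f = \<theta> i * f\<close> avoids the logarithm, so that the negative function
  \<open>R\<close> is covered as well as a positive volume density.\<close>

lemma pd_log_derivative_commute:
  fixes f :: "real^'n::finite \<Rightarrow> real" and \<theta> :: "'n \<Rightarrow> real^'n \<Rightarrow> real"
  assumes S: "open S" "y \<in> S" and f: "smooth_on S f" "f y \<noteq> 0"
    and \<theta>: "\<And>i. \<theta> i differentiable (at y)" "\<And>i y. y \<in> S \<Longrightarrow> pd i f y = \<theta> i y * f y"
  shows "pd i (\<theta> j) y = pd j (\<theta> i) y"
proof -
  have "pd i (pd j f) y = (pd i (\<theta> j) y + \<theta> i y * \<theta> j y) * f y" for i j
  proof -
    have "pd i (pd j f) y = pd i (\<lambda>y. \<theta> j y * f y) y"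
      by (rule pd_cong[OF S \<theta>(2)])
    then show ?thesis
      using smooth_on_differentiable[OF f(1) S(2)]
      by (simp add: pd_mult \<theta>(1) \<theta>(2)[OF S(2)] algebra_simps)
  qed
  then have "(pd i (\<theta> j) y + \<theta> i y * \<theta> j y) * f y = (pd j (\<theta> i) y + \<theta> j y * \<theta> i y) * f y"
    using pd_commute[OF S f(1), of i j] by simp
  then show ?thesis
    using f(2) by (simp add: mult.commute)
qed

section \<open>The projection from bundle coordinates (x, s) to base coordinates x\<close>

lemma bounded_linear_base: "bounded_linear base"
  by (subst linear_conv_bounded_linear[symmetric])
     (auto intro!: linearI simp: vec_eq_iff base_def forall_2)

lemma base_nth [simp]: "base z $ 1 = z $ 1" "base z $ 2 = z $ 2"
  by (simp_all add: base_def)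

lemma base_simps:
  "base (a + b) = base a + base b" "base (r *\<^sub>R a) = r *\<^sub>R base a" "base 0 = 0"
  by (simp_all add: base_def vec_eq_iff forall_2)

lemma base_axis [simp]:
  "base (axis 1 r) = axis 1 r" "base (axis 2 r) = axis 2 r" "base (axis 3 r) = 0"
  by (simp_all add: vec_eq_iff forall_2 axis_def)

lemma pd_base:
  assumes "f differentiable (at (base z))"
  shows "pd 1 (\<lambda>z. f (base z)) z = pd 1 f (base z)"
    "pd 2 (\<lambda>z. f (base z)) z = pd 2 f (base z)"
    "pd 3 (\<lambda>z. f (base z)) z = 0"
proof -
  have "(base has_derivative base) (at z)"
    by (rule bounded_linear_imp_has_derivative[OF bounded_linear_base])
  from has_derivative_compose[OF this] assms[unfolded frechet_derivative_works]
  have *: "((\<lambda>z. f (base z)) has_derivative (\<lambda>v. frechet_derivative f (at (base z)) (base v))) (at z)"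
    by blast
  interpret linear "frechet_derivative f (at (base z))"
    using assms frechet_derivative_works has_derivative_linear by blast
  show "pd 1 (\<lambda>z. f (base z)) z = pd 1 f (base z)"
    "pd 2 (\<lambda>z. f (base z)) z = pd 2 f (base z)"
    "pd 3 (\<lambda>z. f (base z)) z = 0"
    by (simp_all only: pd_eqI[OF *] base_axis) (simp_all add: pd_def zero)
qed

lemma differentiable_base:
  "f differentiable (at (base z)) \<Longrightarrow> (\<lambda>z. f (base z)) differentiable (at z)"
  using differentiable_compose bounded_linear_imp_differentiable[OF bounded_linear_base] by blast

lemma smooth_on_base:
  fixes f :: "real^2 \<Rightarrow> 'b::real_normed_vector"
  assumes "open S" "open U" "smooth_on U f" "\<And>z. z \<in> S \<Longrightarrow> base z \<in> U"
  shows "smooth_on S (\<lambda>z. f (base z))"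
  by (rule smooth_on_compose[OF assms(1,2,4) smooth_on_bounded_linear[OF assms(1) bounded_linear_base
      smooth_on_id[OF assms(1)]] assms(3)])

section \<open>The Thomas connection in a chart\<close>

text \<open>A connection on a line bundle over the plane, in coordinates \<open>z = (x, s)\<close>, for which
  \<open>s \<partial>\<^sub>s\<close> is an Euler field; \<open>a k i j\<close> are the Thomas symbols \<open>\<Pi>\<^sub>i\<^sub>j\<^sup>k\<close>.\<close>
definition cone_conn ::
  "(2 \<Rightarrow> 2 \<Rightarrow> 2 \<Rightarrow> real^2 \<Rightarrow> real) \<Rightarrow> (2 \<Rightarrow> 2 \<Rightarrow> real^2 \<Rightarrow> real) \<Rightarrow> real^3 \<Rightarrow> real^3^3^3" where
  "cone_conn a q z = vector [
     vector [vector [a 1 1 1 (base z), a 1 1 2 (base z), 1 / z $ 3],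
             vector [a 1 2 1 (base z), a 1 2 2 (base z), 0],
             vector [1 / z $ 3, 0, 0]],
     vector [vector [a 2 1 1 (base z), a 2 1 2 (base z), 0],
             vector [a 2 2 1 (base z), a 2 2 2 (base z), 1 / z $ 3],
             vector [0, 1 / z $ 3, 0]],
     vector [vector [z $ 3 * q 1 1 (base z), z $ 3 * q 1 2 (base z), 0],
             vector [z $ 3 * q 2 1 (base z), z $ 3 * q 2 2 (base z), 0],
             vector [0, 0, 0]]]"

lemma curv_swap: "curv G y i j p k = - curv G y j i p k"
  by (simp add: curv_def sum_subtractf)

lemma differentiable_nth_3: "(\<lambda>z. z $ k) differentiable (at z)"
  using bounded_linear_imp_differentiable[OF bounded_linear_vec_nth] .

lemma pd_inverse_coord:
  assumes "z $ 3 \<noteq> 0"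
  shows "pd i (\<lambda>z. 1 / z $ 3) (z :: real^3) = (if i = 3 then - 1 / (z $ 3)\<^sup>2 else 0)"
proof -
  have "((\<lambda>s. 1 / s) has_real_derivative (- 1 / (z $ 3)\<^sup>2)) (at (z $ 3))"
    using assms by (auto intro!: derivative_eq_intros simp: power2_eq_square)
  from pd_real_chain[OF differentiable_nth_3 this] show ?thesis
    by (simp add: pd_coord)
qed

lemma pd_coord_mult_base:
  assumes "f differentiable (at (base z))"
  shows "pd 1 (\<lambda>z. z $ 3 * f (base z)) z = z $ 3 * pd 1 f (base z)"
    "pd 2 (\<lambda>z. z $ 3 * f (base z)) z = z $ 3 * pd 2 f (base z)"
    "pd 3 (\<lambda>z. z $ 3 * f (base z)) z = f (base z)"
  by (simp_all add: pd_mult differentiable_nth_3 differentiable_base assms pd_base pd_coord)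

text \<open>Components with \<open>i\<close> or \<open>j\<close> equal to 3 vanish because the
  powers of s are those forced by an Euler field, and the remaining ones with \<open>p = 3\<close>
  by the symmetry of \<open>a\<close> and \<open>q\<close>. For the index pair 1, 2 the condition
  \<open>curv\<close> says that the connection with symbols \<open>a\<close> has Ricci tensor
  \<open>- q\<close>, and \<open>cotton\<close> that the skew derivative of \<open>q\<close>
  vanishes.\<close>

lemma curv_cone_conn_eq_0:
  fixes z :: "real^3"
  defines "y \<equiv> base z"
  assumes z: "z $ 3 \<noteq> 0"
    and diff: "\<And>k i j. a k i j differentiable (at y)" "\<And>i j. q i j differentiable (at y)"
    and sym: "\<And>k i j. a k i j y = a k j i y" "\<And>i j. q i j y = q j i y"
    and curv: "\<And>p k. pd 1 (a k 2 p) y - pd 2 (a k 1 p) y +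
      (\<Sum>l\<in>UNIV. a k 1 l y * a l 2 p y - a k 2 l y * a l 1 p y) +
      (if k = 1 then q 2 p y else 0) - (if k = 2 then q 1 p y else 0) = 0"
    and cotton: "\<And>p. pd 1 (q 2 p) y - pd 2 (q 1 p) y +
      (\<Sum>l\<in>UNIV. q 1 l y * a l 2 p y - q 2 l y * a l 1 p y) = 0"
  shows "curv (cone_conn a q) z i j p k = 0"
proof -
  note pds = pd_inverse_coord[OF z] pd_base[OF diff(1)[unfolded y_def]]
    pd_coord_mult_base[OF diff(2)[unfolded y_def]]
  have cot: "pd 1 (q 2 p) y = pd 2 (q 1 p) y - (\<Sum>l\<in>UNIV. q 1 l y * a l 2 p y - q 2 l y * a l 1 p y)" for p
    using cotton[of p] by linarith
  note c = curv[of 1 1] curv[of 1 2] curv[of 2 1] curv[of 2 2]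
  note s = sym(1)[of 1 2 1] sym(1)[of 2 2 1] sym(2)[of 2 1]
  have "curv (cone_conn a q) z 1 2 p k = 0 \<and> curv (cone_conn a q) z 1 3 p k = 0 \<and>
      curv (cone_conn a q) z 2 3 p k = 0"
    using z exhaust_3[of p] exhaust_3[of k] c s
    by (elim disjE; simp add: curv_def sum_3 sum_2 cone_conn_def pds y_def[symmetric] cot;
        simp add: power2_eq_square field_simps)
  moreover have "curv (cone_conn a q) z l l p k = 0" for l
    using curv_swap[of "cone_conn a q" z l l p k] by simp
  ultimately show ?thesis
    using exhaust_3[of i] exhaust_3[of j] by (elim disjE; simp; subst curv_swap; simp)
qed

text \<open>In the application, \<open>P = - R H / 2\<close>.\<close>
locale AH_chart =
  fixes U :: "(real^2) set" and G :: "real^2 \<Rightarrow> real^2^2^2" and P :: "real^2 \<Rightarrow> real^2^2"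
    and R :: "real^2 \<Rightarrow> real"
  assumes open_U: "open U"
    and smooth_G: "smooth_on U G"
    and smooth_P: "smooth_on U P"
    and smooth_R: "smooth_on U R"
    and sym_G: "y \<in> U \<Longrightarrow> G y $ k $ i $ j = G y $ k $ j $ i"
    and R_neg: "y \<in> U \<Longrightarrow> R y < 0"
    and pd_R: "y \<in> U \<Longrightarrow> pd i R y = trace_conn G y i * R y"
    and sym_P: "y \<in> U \<Longrightarrow> P y $ i $ j = P y $ j $ i"
    and pos_P: "y \<in> U \<Longrightarrow> v \<noteq> 0 \<Longrightarrow> v \<bullet> (P y *v v) > 0"
    and det_P: "y \<in> U \<Longrightarrow> det (P y) = (R y)\<^sup>2 / 4"
    and ricci_G: "y \<in> U \<Longrightarrow> ricci G y = - P y"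
    and codazzi_P: "y \<in> U \<Longrightarrow> cov_tensor2 G P y i j k = cov_tensor2 G P y j i k"
begin

text \<open>The coefficients in \<open>\<beta> = ds/s - gam_i dx^i\<close>; the 3 comes from the
  cube in the definition of the fibre coordinate s.\<close>

definition gam :: "2 \<Rightarrow> real^2 \<Rightarrow> real" where
  "gam i y = trace_conn G y i / 3"

text \<open>The trace-free part of the Christoffel symbols, unchanged under projective changes of
  the connection. Its traces vanish because the correction has trace \<open>3 gam\<close>.\<close>

definition thomas_a :: "2 \<Rightarrow> 2 \<Rightarrow> 2 \<Rightarrow> real^2 \<Rightarrow> real" where
  "thomas_a k i j y = G y $ k $ i $ j - (if k = j then gam i y else 0) - (if k = i then gam j y else 0)"

text \<open>The tensor P of the projectively equivalent local connection with symbols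
  \<open>thomas_a\<close>: it has the form \<open>P - \<nabla>gam - gam gam\<close>, the usual
  behaviour of P under a projective change by the one-form \<open>- gam\<close>. Up to the factor s
  it is the vertical component of the Thomas connection in coordinates.\<close>

definition thomas_q :: "2 \<Rightarrow> 2 \<Rightarrow> real^2 \<Rightarrow> real" where
  "thomas_q i j y = P y $ i $ j + (\<Sum>k\<in>UNIV. gam k y * G y $ k $ i $ j) -
     pd i (gam j) y - gam i y * gam j y"

lemma smooth_Gc: "smooth_on U (\<lambda>y. G y $ k $ i $ j)"
  using smooth_G by (intro smooth_on_nth open_U)

lemma smooth_Pc: "smooth_on U (\<lambda>y. P y $ i $ j)"
  using smooth_P by (intro smooth_on_nth open_U)

lemma smooth_gam: "smooth_on U (gam i)"
  unfolding gam_def[abs_def] trace_conn_def divide_inverse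
  by (intro smooth_on_mult smooth_on_sum smooth_on_const smooth_Gc open_U) auto

lemma smooth_gam_if: "smooth_on U (\<lambda>y. if b then gam i y else 0)"
  by (cases b) (auto intro: smooth_gam smooth_on_const)

lemma smooth_thomas_a: "smooth_on U (thomas_a k i j)"
  unfolding thomas_a_def[abs_def] by (intro smooth_on_diff smooth_Gc smooth_gam_if open_U)

lemma smooth_thomas_q: "smooth_on U (thomas_q i j)"
  unfolding thomas_q_def[abs_def]
  by (intro smooth_on_diff smooth_on_add smooth_on_sum smooth_on_mult smooth_Gc smooth_gam smooth_Pc
      smooth_on_pd open_U) auto

text \<open>\<open>R\<close> is parallel, so \<open>3 gam\<close> is its logarithmic differential.
  Equivalently, \<open>\<beta>\<close> is closed.\<close>

lemma pd_gam_commute: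
  assumes y: "y \<in> U"
  shows "pd i (gam j) y = pd j (gam i) y"
proof -
  have d: "gam i differentiable (at y)" for i
    by (rule smooth_on_differentiable[OF smooth_gam y])
  have R: "pd i R y = 3 * gam i y * R y" if "y \<in> U" for i y
    by (simp add: pd_R[OF that] gam_def)
  have "pd i (\<lambda>y. 3 * gam j y) y = pd j (\<lambda>y. 3 * gam i y) y"
    by (rule pd_log_derivative_commute[OF open_U y smooth_R, where \<theta> = "\<lambda>i y. 3 * gam i y"])
       (use R_neg[OF y] in \<open>auto simp: d R intro!: differentiable_mult\<close>)
  then show ?thesis
    by (simp add: pd_cmult d)
qed

text \<open>On a surface only the index pair 1, 2 carries curvature, so each component of the Ricci
  tensor is, up to sign, a single component \<open>R_12p^k\<close>.\<close>

lemma curv_G: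
  assumes y: "y \<in> U"
  shows "curv G y 1 2 p 1 = - P y $ 2 $ p" "curv G y 1 2 p 2 = P y $ 1 $ p"
proof -
  have 0: "curv G y i i p i = 0" for i
    using curv_swap[of G y i i p i] by simp
  have "ricci G y $ i $ p = - P y $ i $ p" for i
    using ricci_G[OF y] by simp
  from this[of 1] this[of 2] show "curv G y 1 2 p 1 = - P y $ 2 $ p" "curv G y 1 2 p 2 = P y $ 1 $ p"
    using curv_swap[of G y 2 1 p 2] 0[of 1] 0[of 2] by (simp_all add: ricci_def sum_2)
qed

lemma pd_thomas_a:
  assumes y: "y \<in> U"
  shows "pd l (thomas_a k i j) y = pd l (\<lambda>y. G y $ k $ i $ j) y -
    (if k = j then pd l (gam i) y else 0) - (if k = i then pd l (gam j) y else 0)"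
proof -
  note d = smooth_on_differentiable[OF smooth_Gc y] smooth_on_differentiable[OF smooth_gam_if y]
  have "pd l (\<lambda>y. if b then gam m y else 0) y = (if b then pd l (gam m) y else 0)" for b m
    by simp
  then show ?thesis
    unfolding thomas_a_def[abs_def] by (simp only: pd_diff d differentiable_diff)
qed

lemma pd_thomas_q:
  assumes y: "y \<in> U"
  shows "pd l (thomas_q i j) y = pd l (\<lambda>y. P y $ i $ j) y +
    (\<Sum>k\<in>UNIV. gam k y * pd l (\<lambda>y. G y $ k $ i $ j) y + pd l (gam k) y * G y $ k $ i $ j) -
    pd l (pd i (gam j)) y - (gam i y * pd l (gam j) y + pd l (gam i) y * gam j y)"
proof -
  note d = smooth_on_differentiable[OF smooth_Gc y] smooth_on_differentiable[OF smooth_gam y]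
    smooth_on_differentiable[OF smooth_Pc y] smooth_on_differentiable[OF smooth_on_pd[OF smooth_gam] y]
  show ?thesis
    unfolding thomas_q_def[abs_def]
    by (simp add: pd_diff pd_add pd_sum pd_mult d differentiable_diff differentiable_add
        differentiable_mult sum_2)
qed

text \<open>In dimension 2 the first condition amounts to the definition of \<open>thomas_q\<close>
  together with \<open>ricci_G\<close>; there is no Weyl tensor to obstruct it. The second is
  \<open>codazzi_P\<close>, rewritten for the projectively equivalent connection.\<close>

lemma curv_thomas:
  assumes z: "base z \<in> U" "z $ 3 \<noteq> 0"
  shows "curv (cone_conn thomas_a thomas_q) z i j p k = 0"
proof (rule curv_cone_conn_eq_0[OF z(2)])
  define y where "y = base z"
  have y: "y \<in> U" using z by (simp add: y_def)
  show "thomas_a k i j differentiable (at (base z))" for k i j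
    using smooth_on_differentiable[OF smooth_thomas_a z(1)] .
  show "thomas_q i j differentiable (at (base z))" for i j
    using smooth_on_differentiable[OF smooth_thomas_q z(1)] .
  show "thomas_a k i j (base z) = thomas_a k j i (base z)" for k i j
    using sym_G[OF z(1)] by (simp add: thomas_a_def)
  show "thomas_q i j (base z) = thomas_q j i (base z)" for i j
    using sym_G[OF z(1)] sym_P[OF z(1)] pd_gam_commute[OF z(1)]
    by (simp add: thomas_q_def sum_2 mult.commute)
  note s = sym_G[OF y, of _ 2 1] sym_P[OF y, of 2 1] pd_gam_commute[OF y, of 2 1]
  show "pd 1 (thomas_a k 2 p) (base z) - pd 2 (thomas_a k 1 p) (base z) +
      (\<Sum>l\<in>UNIV. thomas_a k 1 l (base z) * thomas_a l 2 p (base z) -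
        thomas_a k 2 l (base z) * thomas_a l 1 p (base z)) +
      (if k = 1 then thomas_q 2 p (base z) else 0) - (if k = 2 then thomas_q 1 p (base z) else 0) = 0"
    for p k
    unfolding y_def[symmetric]
    using curv_G[OF y, of p] exhaust_2[of p] exhaust_2[of k]
    by (elim disjE; simp add: pd_thomas_a[OF y] curv_def sum_2; simp add: thomas_a_def thomas_q_def
        sum_2 s; simp add: algebra_simps)
  show "pd 1 (thomas_q 2 p) (base z) - pd 2 (thomas_q 1 p) (base z) +
      (\<Sum>l\<in>UNIV. thomas_q 1 l (base z) * thomas_a l 2 p (base z) -
        thomas_q 2 l (base z) * thomas_a l 1 p (base z)) = 0" for p
  proof -
    \<comment> \<open>Differentiating \<open>thomas_q\<close> produces second derivatives of
      \<open>gam\<close>, which cancel by symmetry, and first derivatives of \<open>G\<close>, which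
      \<open>c\<close> combines into curvature and hence into \<open>P\<close>.\<close>
    have g: "pd 2 (pd 1 (gam p)) y = pd 1 (pd 2 (gam p)) y"
      by (rule pd_commute[OF open_U y smooth_gam])
    have c: "pd 1 (\<lambda>z. G z $ 1 $ 2 $ p) y = pd 2 (\<lambda>z. G z $ 1 $ 1 $ p) y -
        (\<Sum>l\<in>UNIV. G y $ 1 $ 1 $ l * G y $ l $ 2 $ p - G y $ 1 $ 2 $ l * G y $ l $ 1 $ p) - P y $ 2 $ p"
      "pd 1 (\<lambda>z. G z $ 2 $ 2 $ p) y = pd 2 (\<lambda>z. G z $ 2 $ 1 $ p) y -
        (\<Sum>l\<in>UNIV. G y $ 2 $ 1 $ l * G y $ l $ 2 $ p - G y $ 2 $ 2 $ l * G y $ l $ 1 $ p) + P y $ 1 $ p"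
      using curv_G[OF y, of p] unfolding curv_def by linarith+
    show ?thesis
      unfolding y_def[symmetric]
      using codazzi_P[OF y, of 1 2 p] c exhaust_2[of p] g
      by (elim disjE; simp add: pd_thomas_q[OF y] sum_2 cov_tensor2_def;
          simp add: thomas_a_def thomas_q_def sum_2 s; simp add: algebra_simps)
  qed
qed

end

section \<open>The metrics in a chart\<close>

lemma open_base_preimage:
  assumes "open U"
  shows "open {z :: real^3. base z \<in> U \<and> z $ 3 \<noteq> 0}"
proof -
  have "continuous_on UNIV base"
    using bounded_linear_base by (simp add: linear_continuous_on)
  then have "open (base -` U)"
    by (rule open_vimage[OF assms])
  moreover have "open {z :: real^3. z $ 3 \<noteq> 0}"
    by (intro open_Collect_neq continuous_intros)
  ultimately have "open (base -` U \<inter> {z. z $ 3 \<noteq> 0})"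
    by (rule open_Int)
  moreover have "base -` U \<inter> {z. z $ 3 \<noteq> 0} = {z. base z \<in> U \<and> z $ 3 \<noteq> 0}"
    by auto
  ultimately show ?thesis by simp
qed

text \<open>Lets identities between metrics be checked on pairs of vectors, where
  \<open>kform_form\<close> applies.\<close>

lemma matrix_eqI:
  fixes M N :: "real^'n::finite^'n"
  assumes "\<And>a b. a \<bullet> (M *v b) = a \<bullet> (N *v b)"
  shows "M = N"
proof -
  have "M *v b = N *v b" for b
    using assms vector_eq_ldot by blast
  then show ?thesis by (simp add: matrix_eq)
qed

text \<open>A vector in the kernel would be isotropic. The condition is \<open>\<noteq>\<close>
  rather than \<open>>\<close> because the induced form to which the lemma is applied is negative
  definite.\<close>

lemma pos_def_invertible:
  fixes M :: "real^'n::finite^'n"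
  assumes "\<And>v. v \<noteq> 0 \<Longrightarrow> v \<bullet> (M *v v) \<noteq> 0"
  shows "invertible M"
proof -
  have "x = 0" if "M *v x = 0" for x
    using assms[of x] that by auto
  then show ?thesis
    by (metis invertible_left_inverse matrix_left_invertible_ker)
qed

lemma matrix_inv_mult:
  assumes "invertible M"
  shows "matrix_inv M ** M = mat 1" "M ** matrix_inv M = mat 1"
proof -
  have "M ** matrix_inv M = mat 1 \<and> matrix_inv M ** M = mat 1"
    using assms unfolding invertible_def matrix_inv_def by (rule someI_ex)
  then show "matrix_inv M ** M = mat 1" "M ** matrix_inv M = mat 1"
    by auto
qed

lemma trace_matrix_inv_scaleR:
  fixes M :: "real^'n::finite^'n"
  assumes "invertible M"
  shows "trace (matrix_inv M ** (r *\<^sub>R M)) = r * CARD('n)"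
proof -
  have "matrix_inv M ** (r *\<^sub>R M) = r *\<^sub>R mat 1"
    using matrix_inv_mult(1)[OF assms] by (simp add: matrix_scalar_ac flip: scalar_matrix_assoc)
  then show ?thesis
    by (simp add: trace_def mat_def)
qed

context AH_chart
begin

definition Uhat :: "(real^3) set" where
  "Uhat = {z. base z \<in> U \<and> z $ 3 \<noteq> 0}"

lemma Uhat_D: "z \<in> Uhat \<Longrightarrow> base z \<in> U" "z \<in> Uhat \<Longrightarrow> z $ 3 \<noteq> 0"
  by (auto simp: Uhat_def)

lemma open_Uhat: "open Uhat"
  unfolding Uhat_def by (rule open_base_preimage[OF open_U])

abbreviation cone :: "real^3 \<Rightarrow> real^3^3^3" where
  "cone \<equiv> cone_conn thomas_a thomas_q"

definition beta :: "real^3 \<Rightarrow> real^3" where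
  "beta z = vector [- gam 1 (base z), - gam 2 (base z), 1 / z $ 3]"

lemma beta_nth:
  "beta z $ 1 = - gam 1 (base z)" "beta z $ 2 = - gam 2 (base z)" "beta z $ 3 = 1 / z $ 3"
  by (simp_all add: beta_def)

definition hatP :: "real^3 \<Rightarrow> real^3^3" where
  "hatP z = vector [vector [P (base z) $ 1 $ 1, P (base z) $ 1 $ 2, 0],
     vector [P (base z) $ 2 $ 1, P (base z) $ 2 $ 2, 0], vector [0, 0, 0]]"

text \<open>The common shape of both metrics, with \<open>m = v\<close>, \<open>n = - v\<close> for
  g and \<open>m = n = 3\<close> for f. Smoothness, determinant, signature and second fundamental
  form are worked out for this shape.\<close>

definition kform :: "(real^3 \<Rightarrow> real) \<Rightarrow> (real^3 \<Rightarrow> real) \<Rightarrow> real^3 \<Rightarrow> real^3^3" where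
  "kform m n z = (\<chi> i j. m z * (beta z $ i * beta z $ j) + n z * hatP z $ i $ j)"

lemma kform_form:
  "a \<bullet> (kform m n z *v b) =
    m z * (beta z \<bullet> a) * (beta z \<bullet> b) + n z * (base a \<bullet> (P (base z) *v base b))"
  by (simp add: kform_def inner_vec_def sum_3 sum_2 matrix_vector_mult_def hatP_def algebra_simps)

lemma smooth_base_gam: "smooth_on Uhat (\<lambda>z. gam i (base z))"
  by (rule smooth_on_base[OF open_Uhat open_U smooth_gam Uhat_D(1)])

lemma smooth_inverse_coord: "smooth_on Uhat (\<lambda>z. 1 / z $ 3)"
  using Uhat_D open_Uhat
  by (intro smooth_on_divide smooth_on_const smooth_on_nth smooth_on_id) auto

lemma smooth_beta: "smooth_on Uhat (\<lambda>z. beta z $ i)"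
  using exhaust_3[of i] open_Uhat
  by (elim disjE; simp add: beta_nth smooth_on_minus smooth_base_gam smooth_inverse_coord)

lemma smooth_hatP: "smooth_on Uhat (\<lambda>z. hatP z $ i $ j)"
  using exhaust_3[of i] exhaust_3[of j]
  by (elim disjE; simp add: hatP_def smooth_on_const
      smooth_on_base[OF open_Uhat open_U smooth_Pc Uhat_D(1)])

lemma smooth_kform:
  assumes "smooth_on Uhat m" "smooth_on Uhat n"
  shows "smooth_on Uhat (kform m n)"
  unfolding kform_def[abs_def]
  by (intro smooth_on_vec_lambda open_Uhat; simp)
     (intro smooth_on_add smooth_on_mult smooth_beta smooth_hatP assms open_Uhat)

lemma sym_hatP: "z \<in> Uhat \<Longrightarrow> hatP z $ i $ j = hatP z $ j $ i"
  using exhaust_3[of i] exhaust_3[of j] sym_P[OF Uhat_D(1)]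
  by (elim disjE; simp add: hatP_def)

lemma transpose_kform: "z \<in> Uhat \<Longrightarrow> transpose (kform m n z) = kform m n z"
  by (simp add: transpose_def kform_def vec_eq_iff mult.commute sym_hatP)

text \<open>In the coframe \<open>dx^1, dx^2, \<beta>\<close> the form is block diagonal with blocks
  \<open>n P\<close> and \<open>m\<close>; replacing \<open>ds\<close> by \<open>\<beta>\<close>
  costs the factor \<open>1 / s\<close>, which enters squared.\<close>

lemma det_kform:
  assumes "z \<in> Uhat"
  shows "det (kform m n z) = m z * (n z)\<^sup>2 * (R (base z))\<^sup>2 / (4 * (z $ 3)\<^sup>2)"
proof -
  have "det (kform m n z) = m z * (n z)\<^sup>2 * (beta z $ 3)\<^sup>2 * det (P (base z))"
    by (simp add: det_3 det_2 kform_def hatP_def power2_eq_square algebra_simps)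
  then show ?thesis
    using det_P[OF Uhat_D(1)[OF assms]] by (simp add: beta_nth power_divide)
qed

lemma beta_neq_0: "z \<in> Uhat \<Longrightarrow> beta z \<noteq> 0"
  using Uhat_D(2) by (auto simp: vec_eq_iff forall_3 beta_nth)

lemma base_eq_0_D: "base a = 0 \<Longrightarrow> beta z \<bullet> a = a $ 3 / z $ 3"
  by (auto simp: vec_eq_iff forall_2 inner_vec_def sum_3 beta_nth)

lemma eq_0_if_base_beta:
  assumes "z \<in> Uhat" "base a = 0" "beta z \<bullet> a = 0"
  shows "a = 0"
proof -
  have "a $ 3 = 0"
    using base_eq_0_D[OF assms(2), of z] assms(3) Uhat_D(2)[OF assms(1)] by simp
  then show ?thesis
    using assms(2) by (auto simp: vec_eq_iff forall_2 forall_3)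
qed

text \<open>Both summands are nonnegative, and a vector on which both vanish is killed by the
  projection and by \<open>\<beta>\<close>, hence is 0.\<close>

lemma has_signature_kform_3_0:
  assumes z: "z \<in> Uhat" and mn: "m z > 0" "n z > 0"
  shows "has_signature 3 0 (kform m n z)"
proof -
  have "a \<bullet> (kform m n z *v a) > 0" if "a \<noteq> 0" for a
  proof (cases "base a = 0")
    case True
    then have "beta z \<bullet> a \<noteq> 0"
      using eq_0_if_base_beta[OF z] that by blast
    then have "m z * ((beta z \<bullet> a) * (beta z \<bullet> a)) > 0"
      using mn(1) by (metis mult_pos_pos not_real_square_gt_zero)
    then show ?thesis
      using True by (simp add: kform_form mult.assoc)
  next
    case False
    then have "n z * (base a \<bullet> (P (base z) *v base a)) > 0"
      using pos_P[OF Uhat_D(1)[OF z]] mn by simp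
    moreover have "m z * ((beta z \<bullet> a) * (beta z \<bullet> a)) \<ge> 0"
      using mn by simp
    ultimately show ?thesis
      by (simp add: kform_form mult.assoc)
  qed
  then show ?thesis
    unfolding has_signature_def
    by (intro conjI exI[of _ UNIV] exI[of _ "{0}"]) (auto simp: dim_UNIV)
qed

text \<open>The fibre direction and \<open>ker \<beta>\<close> split the space orthogonally: on the
  former only \<open>m \<beta> \<beta>\<close> survives, on the latter only
  \<open>n P\<close>.\<close>

lemma has_signature_kform_1_2:
  assumes z: "z \<in> Uhat" and mn: "m z > 0" "n z < 0"
  shows "has_signature 1 2 (kform m n z)"
proof -
  have "a \<bullet> (kform m n z *v a) > 0" if a: "a \<in> span {axis 3 1}" "a \<noteq> 0" for a
  proof -
    have "base a = 0"
      using a(1) by (auto simp: span_singleton base_simps)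
    then have "beta z \<bullet> a \<noteq> 0"
      using eq_0_if_base_beta[OF z] a by blast
    then have "m z * ((beta z \<bullet> a) * (beta z \<bullet> a)) > 0"
      using mn(1) by (metis mult_pos_pos not_real_square_gt_zero)
    then show ?thesis
      using \<open>base a = 0\<close> by (simp add: kform_form mult.assoc)
  qed
  moreover have "a \<bullet> (kform m n z *v a) < 0" if a: "beta z \<bullet> a = 0" "a \<noteq> 0" for a
  proof -
    have "base a \<noteq> 0"
      using eq_0_if_base_beta[OF z] a by blast
    then have "n z * (base a \<bullet> (P (base z) *v base a)) < 0"
      using pos_P[OF Uhat_D(1)[OF z]] mn by (simp add: mult_neg_pos)
    then show ?thesis
      using a by (simp add: kform_form)
  qed
  moreover have "dim (span {axis 3 1 :: real^3}) = 1"
    by (simp add: dim_span dim_singleton axis_eq_0_iff)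
  moreover have "dim {a. beta z \<bullet> a = 0} = 2"
    using dim_hyperplane[OF beta_neq_0[OF z]] by simp
  ultimately show ?thesis
    unfolding has_signature_def
    by (intro conjI exI[of _ "span {axis 3 1}"] exI[of _ "{a. beta z \<bullet> a = 0}"])
       (auto simp: subspace_hyperplane)
qed

definition dbeta :: "real^3 \<Rightarrow> 3 \<Rightarrow> 3 \<Rightarrow> real" where
  "dbeta z i j = pd i (\<lambda>z. beta z $ j) z"

lemma dbeta_eq:
  assumes z: "z \<in> Uhat"
  shows "dbeta z 1 1 = - pd 1 (gam 1) (base z)" "dbeta z 1 2 = - pd 1 (gam 2) (base z)"
    "dbeta z 2 1 = - pd 1 (gam 2) (base z)" "dbeta z 2 2 = - pd 2 (gam 2) (base z)"
    "dbeta z 1 3 = 0" "dbeta z 2 3 = 0" "dbeta z 3 1 = 0" "dbeta z 3 2 = 0"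
    "dbeta z 3 3 = - 1 / (z $ 3)\<^sup>2"
  using smooth_on_differentiable[OF smooth_gam Uhat_D(1)[OF z]]
    smooth_on_differentiable[OF smooth_base_gam z] pd_gam_commute[OF Uhat_D(1)[OF z], of 1 2]
  by (simp_all add: dbeta_def beta_nth pd_minus pd_base pd_inverse_coord[OF Uhat_D(2)[OF z]])

text \<open>In coordinates this is \<open>\<nabla>^ \<beta> = - \<beta> \<beta> - P\<close>. For two
  base indices it unwinds \<open>thomas_q\<close>; when an index is 3 it is a consequence of
  \<open>\<beta>(E) = 1\<close> and of the identity being the derivative of the dilation field
  E.\<close>

lemma cone_deriv_beta:
  assumes z: "z \<in> Uhat"
  shows "dbeta z i j - (\<Sum>k\<in>UNIV. cone z $ k $ i $ j * beta z $ k) =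
    - beta z $ i * beta z $ j - hatP z $ i $ j"
proof -
  note y = Uhat_D(1)[OF z]
  show ?thesis
    using exhaust_3[of i] exhaust_3[of j] Uhat_D(2)[OF z] sym_P[OF y, of 2 1]
      sym_G[OF y, of _ 2 1] pd_gam_commute[OF y, of 2 1]
    by (elim disjE; simp add: dbeta_eq[OF z] sum_3 beta_nth hatP_def cone_conn_def;
        simp add: thomas_a_def thomas_q_def sum_2 field_simps power2_eq_square)
qed

text \<open>In coordinates, \<open>logR\<close> is \<open>log |R~|\<close> and \<open>vfun\<close> is \<open>v~\<close>.\<close>
definition logR :: "real^3 \<Rightarrow> real" where
  "logR z = ln (- R (base z)) - 3/2 * ln ((z $ 3)\<^sup>2)"

definition vfun :: "real^3 \<Rightarrow> real" where
  "vfun z = exp (- (2/3) * (logR z - ln 2))"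

lemma vfun_pos: "vfun z > 0"
  by (simp add: vfun_def)

lemma smooth_base_R: "smooth_on Uhat (\<lambda>z. R (base z))"
  by (rule smooth_on_base[OF open_Uhat open_U smooth_R Uhat_D(1)])

lemma smooth_coord: "smooth_on Uhat (\<lambda>z. z $ 3)"
  by (intro smooth_on_nth smooth_on_id open_Uhat)

lemma smooth_logR: "smooth_on Uhat logR"
  unfolding logR_def[abs_def]
  using R_neg[OF Uhat_D(1)] Uhat_D(2)
  by (intro smooth_on_diff smooth_on_mult smooth_on_const smooth_on_ln smooth_on_minus smooth_base_R
      smooth_on_power smooth_coord open_Uhat) auto

section \<open>Differentials of log |R~| and v~\<close>

lemma pd_ln_base_R:
  assumes z: "z \<in> Uhat"
  shows "pd 1 (\<lambda>z. ln (- R (base z))) z = 3 * gam 1 (base z)"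
    "pd 2 (\<lambda>z. ln (- R (base z))) z = 3 * gam 2 (base z)"
    "pd 3 (\<lambda>z. ln (- R (base z))) z = 0"
proof -
  note y = Uhat_D(1)[OF z]
  have d: "(\<lambda>z. - R (base z)) differentiable (at z)"
    by (rule smooth_on_differentiable[OF smooth_on_minus[OF open_Uhat smooth_base_R] z])
  have "(ln has_real_derivative 1 / (- R (base z))) (at (- R (base z)))"
    using R_neg[OF y] by (auto intro!: derivative_eq_intros)
  from pd_real_chain[OF d this]
  have "pd i (\<lambda>z. ln (- R (base z))) z = 1 / R (base z) * pd i (\<lambda>z. R (base z)) z" for i
    using pd_minus[OF smooth_on_differentiable[OF smooth_base_R z]] by simp
  then show "pd 1 (\<lambda>z. ln (- R (base z))) z = 3 * gam 1 (base z)"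
    "pd 2 (\<lambda>z. ln (- R (base z))) z = 3 * gam 2 (base z)"
    "pd 3 (\<lambda>z. ln (- R (base z))) z = 0"
    using R_neg[OF y] pd_base[OF smooth_on_differentiable[OF smooth_R y]] pd_R[OF y]
    by (simp_all add: gam_def)
qed

lemma pd_ln_square:
  fixes f :: "real^'n::finite \<Rightarrow> real"
  assumes "f differentiable (at z)" "f z \<noteq> 0"
  shows "pd i (\<lambda>z. ln ((f z)\<^sup>2)) z = 2 / f z * pd i f z"
proof -
  have "((\<lambda>t. ln (t\<^sup>2)) has_real_derivative 2 / f z) (at (f z))"
    using assms(2) by (auto intro!: derivative_eq_intros) (simp add: power2_eq_square)
  from pd_real_chain[OF assms(1) this] show ?thesis .
qed

lemma smooth_ln_square:
  assumes "open S" "smooth_on S f" "\<And>x. x \<in> S \<Longrightarrow> f x \<noteq> (0::real)"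
  shows "smooth_on S (\<lambda>z. ln ((f z)\<^sup>2))"
  using assms by (intro smooth_on_ln smooth_on_power) auto

text \<open>\<open>R\<close> being parallel contributes \<open>3 gam\<close>, and the cube of the
  fibre coordinate contributes \<open>- 3 ds / s\<close>; together they form
  \<open>- 3 \<beta>\<close>.\<close>

lemma pd_logR:
  assumes z: "z \<in> Uhat"
  shows "pd i logR z = - 3 * beta z $ i"
proof -
  have d: "(\<lambda>z. ln (- R (base z))) differentiable (at z)"
    using smooth_on_ln[OF open_Uhat smooth_on_minus[OF open_Uhat smooth_base_R]] R_neg[OF Uhat_D(1)]
    by (intro smooth_on_differentiable[OF _ z]) auto
  have e: "(\<lambda>z. ln ((z $ 3)\<^sup>2)) differentiable (at z)"
    by (rule smooth_on_differentiable[OF smooth_ln_square[OF open_Uhat smooth_coord Uhat_D(2)] z])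
  have "pd i logR z = pd i (\<lambda>z. ln (- R (base z))) z - 3/2 * (2 / z $ 3 * pd i (\<lambda>z. z $ 3) z)"
    unfolding logR_def[abs_def] pd_diff[OF d differentiable_mult[OF differentiable_const e]]
      pd_cmult[OF e] pd_ln_square[OF differentiable_nth_3 Uhat_D(2)[OF z]] ..
  then show ?thesis
    using exhaust_3[of i] by (elim disjE; simp add: pd_ln_base_R[OF z] beta_nth pd_coord)
qed

lemma pd_vfun:
  assumes z: "z \<in> Uhat"
  shows "pd i vfun z = 2 * vfun z * beta z $ i"
proof -
  have "((\<lambda>t. exp (- (2/3) * (t - ln 2))) has_real_derivative - (2/3) * vfun z) (at (logR z))"
    by (auto intro!: derivative_eq_intros simp: vfun_def)
  from pd_real_chain[OF smooth_on_differentiable[OF smooth_logR z] this, of i]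
  show ?thesis
    by (simp add: vfun_def[abs_def] pd_logR[OF z])
qed

lemma vfun_eq:
  assumes z: "z \<in> Uhat"
  shows "vfun z = 2 powr (2/3) * \<bar>R (base z) / \<bar>z $ 3\<bar> ^ 3\<bar> powr (-2/3)"
proof -
  \<comment> \<open>The real \<open>ln\<close> is an even function, so absolute values may be
    dropped under it also for the negative \<open>R\<close>.\<close>
  have ln_abs: "ln \<bar>x\<bar> = ln x" for x :: real
    by (simp add: abs_if ln_minus)
  have "ln \<bar>R (base z) / \<bar>z $ 3\<bar> ^ 3\<bar> = logR z"
    using R_neg[OF Uhat_D(1)[OF z]] Uhat_D(2)[OF z]
    by (simp add: logR_def ln_abs ln_div ln_realpow ln_minus)
  then have "\<bar>R (base z) / \<bar>z $ 3\<bar> ^ 3\<bar> powr (-2/3) = exp (- (2/3) * logR z)"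
    using R_neg[OF Uhat_D(1)[OF z]] Uhat_D(2)[OF z] by (simp add: powr_def)
  moreover have "vfun z = exp (2/3 * ln 2) * exp (- (2/3) * logR z)"
    unfolding vfun_def by (simp add: algebra_simps flip: exp_add)
  moreover have "2 powr (2/3) = exp (2/3 * ln (2::real))"
    by (simp add: powr_def)
  ultimately show ?thesis
    by simp
qed

lemma smooth_vfun: "smooth_on Uhat vfun"
proof -
  \<comment> \<open>The same function with the logarithms removed; the square of s shows its
    homogeneity of degree 2.\<close>
  have 1: "smooth_on Uhat (\<lambda>z. (- R (base z)) powr (-2/3) * ((z $ 3)\<^sup>2 * 2 powr (2/3)))"
    using R_neg[OF Uhat_D(1)] Uhat_D(2)
    by (intro smooth_on_mult smooth_on_powr smooth_on_power smooth_on_minus smooth_base_R smooth_coord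
        smooth_on_const open_Uhat) auto
  show ?thesis
  proof (rule smooth_on_cong[OF open_Uhat 1])
    fix z assume z: "z \<in> Uhat"
    have "(- R (base z)) powr (-2/3) * ((z $ 3)\<^sup>2 * 2 powr (2/3)) =
        exp (- (2/3) * ln (- R (base z))) * (exp (ln ((z $ 3)\<^sup>2)) * exp (2/3 * ln 2))"
      using R_neg[OF Uhat_D(1)[OF z]] Uhat_D(2)[OF z] by (simp add: powr_def)
    also have "\<dots> = exp (- (2/3) * ln (- R (base z)) + (ln ((z $ 3)\<^sup>2) + 2/3 * ln 2))"
      by (simp only: exp_add)
    also have "- (2/3) * ln (- R (base z)) + (ln ((z $ 3)\<^sup>2) + 2/3 * ln 2) = - (2/3) * (logR z - ln 2)"
      by (simp add: logR_def field_simps)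
    finally show "(- R (base z)) powr (-2/3) * ((z $ 3)\<^sup>2 * 2 powr (2/3)) = vfun z"
      by (simp only: vfun_def)
  qed
qed

text \<open>The identity behind \<open>det g = s^4\<close>: it is \<open>v~^3 R~^2 = 4\<close>
  written in coordinates. The factor 2 in the definition of \<open>v~\<close> is there to produce
  this 4, which cancels the one in \<open>det P\<close>.\<close>

lemma vfun_cubed:
  assumes z: "z \<in> Uhat"
  shows "vfun z ^ 3 * (R (base z))\<^sup>2 = 4 * (z $ 3) ^ 6"
proof -
  have "vfun z ^ 3 = exp (2 * ln 2 - 2 * logR z)"
    by (simp add: vfun_def power3_eq_cube algebra_simps flip: exp_add)
  also have "\<dots> = exp (ln 4 - ln ((R (base z))\<^sup>2) + ln ((z $ 3) ^ 6))"
  proof -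
    have "ln ((R (base z))\<^sup>2) = 2 * ln (- R (base z))"
      using R_neg[OF Uhat_D(1)[OF z]] ln_realpow[of "- R (base z)" 2] by simp
    moreover have "ln ((z $ 3) ^ 6) = 3 * ln ((z $ 3)\<^sup>2)"
      using Uhat_D(2)[OF z] ln_realpow[of "(z $ 3)\<^sup>2" 3] by simp
    moreover have "ln (4::real) = 2 * ln 2"
      using ln_realpow[of 2 2] by simp
    ultimately show ?thesis by (simp add: logR_def)
  qed
  also have "\<dots> = 4 / (R (base z))\<^sup>2 * (z $ 3) ^ 6"
    using R_neg[OF Uhat_D(1)[OF z]] Uhat_D(2)[OF z] by (simp add: exp_add exp_diff)
  finally show ?thesis
    using R_neg[OF Uhat_D(1)[OF z]] by simp
qed

text \<open>If \<open>du = c \<beta>\<close>, the Hessian of \<open>u\<close> is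
  \<open>dc \<beta> + c \<nabla>^ \<beta>\<close>. The potentials of both metrics have differentials
  of this kind.\<close>

lemma hess_of_beta:
  assumes z: "z \<in> Uhat" and D: "D z = cone z"
    and c: "c differentiable (at z)" "\<And>w i. w \<in> Uhat \<Longrightarrow> pd i u w = c w * beta w $ i"
  shows "hess D u z = (\<chi> i j. pd i c z * beta z $ j - c z * (beta z $ i * beta z $ j + hatP z $ i $ j))"
proof -
  have "hess D u z $ i $ j =
      pd i c z * beta z $ j - c z * (beta z $ i * beta z $ j + hatP z $ i $ j)" for i j
  proof -
    have "pd i (pd j u) z = pd i (\<lambda>w. c w * beta w $ j) z"
      by (rule pd_cong[OF open_Uhat z c(2)])
    also have "\<dots> = c z * dbeta z i j + pd i c z * beta z $ j"
      by (simp add: pd_mult c(1) smooth_on_differentiable[OF smooth_beta z] dbeta_def)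
    finally have "hess D u z $ i $ j = pd i c z * beta z $ j +
        c z * (dbeta z i j - (\<Sum>k\<in>UNIV. cone z $ k $ i $ j * beta z $ k))"
      by (simp add: hess_def D c(2)[OF z] sum_distrib_left algebra_simps)
    then show ?thesis
      unfolding cone_deriv_beta[OF z] by (simp add: algebra_simps)
  qed
  then show ?thesis by (simp add: vec_eq_iff)
qed

text \<open>Here \<open>c = 2 v\<close> and \<open>dc = 4 v \<beta>\<close>, so the Hessian is
  \<open>2 v (\<beta> \<beta> - P)\<close>; the factor 1/2 in the definition of g removes the
  2.\<close>

lemma hess_vfun:
  assumes z: "z \<in> Uhat" and D: "D z = cone z"
  shows "(1/2) *\<^sub>R hess D vfun z = kform vfun (\<lambda>z. - vfun z) z"
proof -
  have v: "vfun differentiable (at z)" by (rule smooth_on_differentiable[OF smooth_vfun z])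
  have "pd i (\<lambda>z. 2 * vfun z) z = 4 * vfun z * beta z $ i" for i
    by (simp add: pd_cmult[OF v] pd_vfun[OF z])
  then show ?thesis
    by (subst hess_of_beta[where c = "\<lambda>z. 2 * vfun z" and D = D, OF z D])
       (use v in \<open>auto simp: pd_vfun kform_def vec_eq_iff algebra_simps\<close>)
qed

text \<open>Here \<open>c\<close> is the constant \<open>- 3\<close>, so only
  \<open>\<nabla>^ \<beta>\<close> contributes.\<close>

lemma hess_logR:
  assumes z: "z \<in> Uhat" and D: "D z = cone z"
  shows "hess D logR z = kform (\<lambda>z. 3) (\<lambda>z. 3) z"
  by (subst hess_of_beta[where c = "\<lambda>z. -3" and D = D, OF z D])
     (auto simp: pd_logR kform_def vec_eq_iff algebra_simps)

text \<open>The Thomas symbols are trace-free, so base directions contribute nothing; the parallel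
  volume forms are locally the constant multiples of \<open>s^2 dx^1 dx^2 ds\<close>.\<close>

lemma trace_cone:
  assumes z: "z \<in> Uhat"
  shows "trace_conn cone z i = (if i = 3 then 2 / z $ 3 else 0)"
  using exhaust_3[of i] sym_G[OF Uhat_D(1)[OF z], of _ 2 1]
  by (elim disjE; simp add: trace_conn_def sum_3 cone_conn_def;
      simp add: thomas_a_def gam_def trace_conn_def sum_2 field_simps)

text \<open>The volume form \<open>\<mu>\<close> is an unspecified choice, so only its parallel
  equation near \<open>z\<close> can be used: it gives \<open>d log \<mu>^2 = 4 ds / s\<close>. With
  \<open>k = log |det g|\<close>, the hypothesis on \<open>k\<close> says that the function under
  the Hessian has differential \<open>r \<beta>\<close>, and its Hessian is therefore
  \<open>r \<nabla>^ \<beta>\<close>.\<close>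

lemma KA_ricci_aux:
  assumes z: "z \<in> Uhat" and D: "\<And>w. w \<in> Uhat \<Longrightarrow> D w = cone w"
    and \<mu>: "\<mu> = (SOME \<mu>. parallel_volume_near Uhat D z \<mu>)"
    and g: "\<And>w. w \<in> Uhat \<Longrightarrow> ln \<bar>det (g w)\<bar> = k w" "\<And>w. w \<in> Uhat \<Longrightarrow> det (g w) \<noteq> 0"
    and k: "smooth_on Uhat k" "\<And>i w. w \<in> Uhat \<Longrightarrow>
      pd i k w - (if i = 3 then 4 / w $ 3 else 0) = r * beta w $ i"
  shows "hess D (\<lambda>w. ln \<bar>det (g w) / (\<mu> w)\<^sup>2\<bar>) z =
    (\<chi> i j. - r * (beta z $ i * beta z $ j + hatP z $ i $ j))"
proof -
  have tr: "trace_conn D w i = (if i = 3 then 2 / w $ 3 else 0)" if "w \<in> Uhat" for w i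
    using trace_cone[OF that, of i] D[OF that] by (simp add: trace_conn_def)
  \<comment> \<open>Exhibited to show that parallel volume forms exist, so that the chosen
    \<open>\<mu>\<close> is one.\<close>
  have "parallel_volume_near Uhat D z (\<lambda>w. (w $ 3)\<^sup>2)"
    unfolding parallel_volume_near_def
  proof (intro exI conjI ballI allI)
    show "smooth_on Uhat (\<lambda>w. (w $ 3)\<^sup>2)"
      by (rule smooth_on_power[OF open_Uhat smooth_coord])
    show "pd i (\<lambda>w. (w $ 3)\<^sup>2) w - trace_conn D w i * (w $ 3)\<^sup>2 = 0" if "w \<in> Uhat" for w i
      using Uhat_D(2)[OF that] unfolding power2_eq_square tr[OF that]
      by (simp add: pd_mult differentiable_nth_3 pd_coord)
  qed (use open_Uhat z Uhat_D in auto)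
  then have "parallel_volume_near Uhat D z \<mu>"
    unfolding \<mu> by (rule someI[of "parallel_volume_near Uhat D z"])
  then obtain V where V: "open V" "z \<in> V" "V \<subseteq> Uhat" "smooth_on V \<mu>"
    and \<mu>V: "\<And>w. w \<in> V \<Longrightarrow> \<mu> w \<noteq> 0"
      "\<And>w i. w \<in> V \<Longrightarrow> pd i \<mu> w = trace_conn D w i * \<mu> w"
    unfolding parallel_volume_near_def by auto
  have pd: "pd i (\<lambda>w. ln \<bar>det (g w) / (\<mu> w)\<^sup>2\<bar>) w = r * beta w $ i" if w: "w \<in> V" for i w
  proof -
    have wU: "w \<in> Uhat" using w V by blast
    have d: "k differentiable (at w)" "(\<lambda>w. ln ((\<mu> w)\<^sup>2)) differentiable (at w)"
      using smooth_on_differentiable[OF k(1) wU]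
        smooth_on_differentiable[OF smooth_ln_square[OF V(1,4) \<mu>V(1)] w] by auto
    have "pd i (\<lambda>w. ln \<bar>det (g w) / (\<mu> w)\<^sup>2\<bar>) w = pd i (\<lambda>w. k w - ln ((\<mu> w)\<^sup>2)) w"
    proof (rule pd_cong[OF V(1) w])
      fix x assume x: "x \<in> V"
      then have "x \<in> Uhat" using V by blast
      then show "ln \<bar>det (g x) / (\<mu> x)\<^sup>2\<bar> = k x - ln ((\<mu> x)\<^sup>2)"
        using g \<mu>V(1)[OF x] by (simp add: abs_divide ln_div)
    qed
    also have "\<dots> = pd i k w - 2 * trace_conn D w i"
      using \<mu>V(1)[OF w] \<mu>V(2)[OF w]
      by (simp add: pd_diff d pd_ln_square[OF smooth_on_differentiable[OF V(4) w]])
    also have "\<dots> = r * beta w $ i"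
      using k(2)[OF wU, of i] by (simp add: tr[OF wU] split: if_splits)
    finally show ?thesis .
  qed
  have pdpd: "pd i (pd j (\<lambda>w. ln \<bar>det (g w) / (\<mu> w)\<^sup>2\<bar>)) z = r * dbeta z i j" for i j
  proof -
    have "pd i (pd j (\<lambda>w. ln \<bar>det (g w) / (\<mu> w)\<^sup>2\<bar>)) z = pd i (\<lambda>w. r * beta w $ j) z"
      by (rule pd_cong[OF V(1,2) pd])
    then show ?thesis
      by (simp add: pd_cmult smooth_on_differentiable[OF smooth_beta z] dbeta_def)
  qed
  then have "hess D (\<lambda>w. ln \<bar>det (g w) / (\<mu> w)\<^sup>2\<bar>) z $ i $ j =
      r * (dbeta z i j - (\<Sum>k\<in>UNIV. cone z $ k $ i $ j * beta z $ k))" for i j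
    unfolding hess_def vec_lambda_beta pdpd pd[OF V(2)] D[OF z]
    by (simp add: sum_distrib_left algebra_simps)
  then show ?thesis
    unfolding cone_deriv_beta[OF z] vec_eq_iff by (simp only: vec_lambda_beta) (simp add: right_diff_distrib distrib_left)
qed

lemma KA_ricci_g:
  assumes z: "z \<in> Uhat" and D: "\<And>w. w \<in> Uhat \<Longrightarrow> D w = cone w"
    and \<mu>: "\<mu> = (SOME \<mu>. parallel_volume_near Uhat D z \<mu>)"
    and g: "\<And>w. w \<in> Uhat \<Longrightarrow> g w = kform vfun (\<lambda>z. - vfun z) w"
  shows "hess D (\<lambda>w. ln \<bar>det (g w) / (\<mu> w)\<^sup>2\<bar>) z = 0"
proof -
  \<comment> \<open>Here \<open>m n^2 = v^3\<close>, which \<open>vfun_cubed\<close> trades for a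
    power of s.\<close>
  have det: "det (g w) = ((w $ 3)\<^sup>2)\<^sup>2" if w: "w \<in> Uhat" for w
  proof -
    have "det (g w) = (vfun w ^ 3 * (R (base w))\<^sup>2) / (4 * (w $ 3)\<^sup>2)"
      using det_kform[OF w] g[OF w] by (simp add: power2_eq_square power3_eq_cube)
    also have "\<dots> = 4 * (w $ 3) ^ 6 / (4 * (w $ 3)\<^sup>2)"
      by (simp only: vfun_cubed[OF w])
    also have "\<dots> = (w $ 3) ^ 4"
      using Uhat_D(2)[OF w] by (simp add: eval_nat_numeral)
    also have "\<dots> = ((w $ 3)\<^sup>2)\<^sup>2"
      by (simp add: eval_nat_numeral)
    finally show ?thesis .
  qed
  have "hess D (\<lambda>w. ln \<bar>det (g w) / (\<mu> w)\<^sup>2\<bar>) z =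
      (\<chi> i j. - 0 * (beta z $ i * beta z $ j + hatP z $ i $ j))"
  proof (rule KA_ricci_aux[OF z D \<mu>, where k = "\<lambda>w. 2 * ln ((w $ 3)\<^sup>2)"])
    show "ln \<bar>det (g w)\<bar> = 2 * ln ((w $ 3)\<^sup>2)" if "w \<in> Uhat" for w
      using Uhat_D(2)[OF that] by (simp add: det[OF that] ln_realpow)
    show "smooth_on Uhat (\<lambda>w. 2 * ln ((w $ 3)\<^sup>2))"
      by (intro smooth_on_mult smooth_on_const smooth_ln_square smooth_coord open_Uhat Uhat_D(2))
    show "pd i (\<lambda>w. 2 * ln ((w $ 3)\<^sup>2)) w - (if i = 3 then 4 / w $ 3 else 0) = 0 * beta w $ i"
      if "w \<in> Uhat" for i w
      using pd_ln_square[OF differentiable_nth_3 Uhat_D(2)[OF that], of i]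
        smooth_on_differentiable[OF smooth_ln_square[OF open_Uhat smooth_coord Uhat_D(2)] that]
      by (simp add: pd_cmult pd_coord)
  qed (use det Uhat_D(2) in auto)
  then show ?thesis by (simp add: vec_eq_iff)
qed

text \<open>With \<open>m = n = 3\<close> the determinant is
  \<open>27/4 R^2 / s^2 = 27/4 R~^2 s^4\<close>, and \<open>2 log |R~|\<close> has differential
  \<open>- 6 \<beta>\<close>. Thus \<open>r = - 6\<close>, and
  \<open>6 (\<beta> \<beta> + P)\<close> is twice the metric.\<close>

lemma KA_ricci_f:
  assumes z: "z \<in> Uhat" and D: "\<And>w. w \<in> Uhat \<Longrightarrow> D w = cone w"
    and \<mu>: "\<mu> = (SOME \<mu>. parallel_volume_near Uhat D z \<mu>)"
    and g: "\<And>w. w \<in> Uhat \<Longrightarrow> g w = kform (\<lambda>z. 3) (\<lambda>z. 3) w"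
  shows "hess D (\<lambda>w. ln \<bar>det (g w) / (\<mu> w)\<^sup>2\<bar>) z = 2 *\<^sub>R kform (\<lambda>z. 3) (\<lambda>z. 3) z"
proof -
  have det: "det (g w) = 27 / 4 * (R (base w))\<^sup>2 / (w $ 3)\<^sup>2" if w: "w \<in> Uhat" for w
    using det_kform[OF w] g[OF w] by simp
  let ?k = "\<lambda>w. ln (27/4) + 2 * ln (- R (base w)) - ln ((w $ 3)\<^sup>2)"
  have "hess D (\<lambda>w. ln \<bar>det (g w) / (\<mu> w)\<^sup>2\<bar>) z =
      (\<chi> i j. - (- 6) * (beta z $ i * beta z $ j + hatP z $ i $ j))"
  proof (rule KA_ricci_aux[OF z D \<mu>, where k = ?k])
    show "ln \<bar>det (g w)\<bar> = ?k w" if w: "w \<in> Uhat" for w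
    proof -
      have "ln ((R (base w))\<^sup>2) = 2 * ln (- R (base w))"
        using R_neg[OF Uhat_D(1)[OF w]] ln_realpow[of "- R (base w)" 2] by simp
      then show ?thesis
        using Uhat_D(2)[OF w] R_neg[OF Uhat_D(1)[OF w]]
        by (simp add: det[OF w] abs_mult abs_divide ln_div ln_mult)
    qed
    have s: "smooth_on Uhat (\<lambda>w. ln (- R (base w)))"
      using R_neg[OF Uhat_D(1)] by (intro smooth_on_ln smooth_on_minus smooth_base_R open_Uhat) auto
    have s3: "smooth_on Uhat (\<lambda>w. ln ((w $ 3)\<^sup>2))"
      by (intro smooth_ln_square smooth_coord open_Uhat Uhat_D(2))
    show "smooth_on Uhat ?k"
      by (intro smooth_on_mult smooth_on_const smooth_on_add smooth_on_diff s s3 open_Uhat)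
    show "pd i ?k w - (if i = 3 then 4 / w $ 3 else 0) = - 6 * beta w $ i"
      if w: "w \<in> Uhat" for i w
    proof -
      note d = smooth_on_differentiable[OF s w] smooth_on_differentiable[OF s3 w]
      have "pd i ?k w = 2 * pd i (\<lambda>w. ln (- R (base w))) w - 2 / w $ 3 * pd i (\<lambda>w. w $ 3) w"
        by (simp add: pd_diff pd_add pd_cmult d
            pd_ln_square[OF differentiable_nth_3 Uhat_D(2)[OF w]])
      then show ?thesis
        using exhaust_3[of i] Uhat_D(2)[OF w]
        by (elim disjE; simp add: pd_ln_base_R[OF w] pd_coord beta_nth)
    qed
    show "det (g w) \<noteq> 0" if w: "w \<in> Uhat" for w
      using Uhat_D(2)[OF w] R_neg[OF Uhat_D(1)[OF w]] by (simp add: det[OF w])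
  qed (use det Uhat_D(2) in auto)
  then show ?thesis by (simp add: vec_eq_iff kform_def algebra_simps)
qed

end

section \<open>The second fundamental form in a chart\<close>

text \<open>Lowering the index of the Levi-Civita connection removes the inverse metric.\<close>
lemma inner_Levi_Civita:
  fixes T :: "('a, 'n::finite) tensor2" and c :: "('a, 'n) chart" and X a b \<nu> z :: "real^'n"
  defines "K \<equiv> \<lambda>p q l. pd p (\<lambda>w. T c w $ q $ l) z + pd q (\<lambda>w. T c w $ p $ l) z -
    pd l (\<lambda>w. T c w $ p $ q) z"
  assumes "invertible (T c z)"
  shows "\<nu> \<bullet> (T c z *v (\<chi> k. X $ k + (\<Sum>p\<in>UNIV. \<Sum>q\<in>UNIV. Levi_Civita T c z $ k $ p $ q * a $ p * b $ q))) =
    \<nu> \<bullet> (T c z *v X) + (\<Sum>p\<in>UNIV. \<Sum>q\<in>UNIV. (\<nu> \<bullet> (\<chi> l. K p q l)) * a $ p * b $ q) / 2"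
proof -
  have "(\<chi> k. X $ k + (\<Sum>p\<in>UNIV. \<Sum>q\<in>UNIV. Levi_Civita T c z $ k $ p $ q * a $ p * b $ q)) =
      X + (\<Sum>p\<in>UNIV. \<Sum>q\<in>UNIV. (a $ p * b $ q / 2) *\<^sub>R (matrix_inv (T c z) *v (\<chi> l. K p q l)))"
    by (simp add: vec_eq_iff Levi_Civita_def K_def matrix_vector_mult_def algebra_simps)
  then have "\<nu> \<bullet> (T c z *v (\<chi> k. X $ k + (\<Sum>p\<in>UNIV. \<Sum>q\<in>UNIV. Levi_Civita T c z $ k $ p $ q * a $ p * b $ q))) =
      \<nu> \<bullet> (T c z *v X) + (\<Sum>p\<in>UNIV. \<Sum>q\<in>UNIV. (a $ p * b $ q / 2) *
        (\<nu> \<bullet> (T c z *v (matrix_inv (T c z) *v (\<chi> l. K p q l)))))"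
    by (simp add: matrix_vector_right_distrib inner_add_right inner_sum_right
        linear_sum[OF matrix_vector_mul_linear] matrix_vector_mult_scaleR del: matrix_vector_mul_assoc)
  then show ?thesis
    by (simp add: matrix_vector_mul_assoc matrix_inv_mult[OF assms(2)] sum_divide_distrib mult_ac)
qed

context AH_chart
begin

section \<open>Vertical Christoffel symbols, and surfaces along which R~ is constant\<close>

lemma pd_kform:
  assumes z: "z \<in> Uhat" and mn: "smooth_on Uhat m" "smooth_on Uhat n"
  shows "pd p (\<lambda>w. kform m n w $ q $ r) z = pd p m z * (beta z $ q * beta z $ r) +
    m z * (dbeta z p q * beta z $ r + beta z $ q * dbeta z p r) +
    pd p n z * hatP z $ q $ r + n z * pd p (\<lambda>w. hatP w $ q $ r) z"
proof -
  note d = smooth_on_differentiable[OF _ z]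
  show ?thesis
    unfolding kform_def vec_lambda_beta
    by (simp add: pd_add pd_mult d[OF mn(1)] d[OF mn(2)] d[OF smooth_beta] d[OF smooth_hatP]
        differentiable_mult dbeta_def algebra_simps)
qed

lemma pd_3_hatP:
  assumes z: "z \<in> Uhat"
  shows "pd 3 (\<lambda>w. hatP w $ q $ r) z = 0"
  using exhaust_3[of q] exhaust_3[of r]
  by (elim disjE; simp add: hatP_def
      pd_base(3)[OF smooth_on_differentiable[OF smooth_Pc Uhat_D(1)[OF z]]])

lemma hatP_3: "hatP z $ q $ 3 = 0" "hatP z $ 3 $ q = 0"
  using exhaust_3[of q] by (auto simp: hatP_def)

lemma dbeta_sym: "z \<in> Uhat \<Longrightarrow> dbeta z p q = dbeta z q p"
  using exhaust_3[of p] exhaust_3[of q] by (elim disjE; simp add: dbeta_eq)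

text \<open>Twice the Christoffel symbols of the first kind with the lowered index vertical.
  Derivatives of P drop out because \<open>hatP\<close> has no s-components and does not depend on
  s; those of \<open>\<beta>\<close> combine since \<open>\<beta>\<close> is closed, and
  \<open>\<mu>\<close> records how the metric scales along the fibres.\<close>

lemma christoffel_vertical:
  assumes z: "z \<in> Uhat" and mn: "smooth_on Uhat m" "smooth_on Uhat n"
    and pd: "\<And>i. pd i m z = 2 * \<mu> * m z * beta z $ i" "\<And>i. pd i n z = 2 * \<mu> * n z * beta z $ i"
  shows "pd p (\<lambda>w. kform m n w $ q $ 3) z + pd q (\<lambda>w. kform m n w $ p $ 3) z -
      pd 3 (\<lambda>w. kform m n w $ p $ q) z =
    2 * beta z $ 3 * (\<mu> * m z * beta z $ p * beta z $ q + m z * dbeta z p q - \<mu> * n z * hatP z $ p $ q)"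
  using dbeta_sym[OF z, of p 3] dbeta_sym[OF z, of q 3] dbeta_sym[OF z, of q p]
  by (simp add: pd_kform[OF z mn] hatP_3 pd_3_hatP[OF z] pd algebra_simps)

text \<open>The differential of \<open>logR\<close> is \<open>- 3 \<beta>\<close>, so
  \<open>\<beta>\<close> kills the tangent vectors \<open>pd i u\<close>. Differentiating once more
  expresses \<open>\<beta>\<close> of the second derivative of \<open>u\<close>, a vector that is in
  general not tangent, through \<open>dbeta\<close> on tangent vectors.\<close>

lemma
  fixes f :: "'x \<Rightarrow> 'y" and u :: "real^2 \<Rightarrow> real^3"
  assumes S: "open S" "y \<in> S" and u: "smooth_on S u" "\<And>y. y \<in> S \<Longrightarrow> u y \<in> Uhat"
    and level: "\<And>y. y \<in> S \<Longrightarrow> logR (u y) = c"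
  shows beta_tangent: "beta (u y) \<bullet> pd i u y = 0"
    and beta_second_derivative: "beta (u y) \<bullet> pd i (pd j u) y +
      (\<Sum>p\<in>UNIV. \<Sum>q\<in>UNIV. dbeta (u y) p q * pd i u y $ p * pd j u y $ q) = 0"
proof -
  have tangent: "beta (u y) \<bullet> pd i u y = 0" if y: "y \<in> S" for y i
  proof -
    have "pd i (\<lambda>y. logR (u y)) y = pd i (\<lambda>y. c) y"
      by (rule pd_cong[OF S(1) y]) (simp add: level)
    then have "(\<Sum>k\<in>UNIV. pd i u y $ k * pd k logR (u y)) = 0"
      by (simp add: pd_chain[OF smooth_on_differentiable[OF u(1) y]
            smooth_on_differentiable[OF smooth_logR u(2)[OF y]]])
    moreover have "(\<Sum>k\<in>UNIV. pd i u y $ k * pd k logR (u y)) = - 3 * (beta (u y) \<bullet> pd i u y)"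
      by (simp add: pd_logR[OF u(2)[OF y]] inner_vec_def sum_3 algebra_simps)
    ultimately show ?thesis by simp
  qed
  then show "beta (u y) \<bullet> pd i u y = 0"
    using S by blast
  note d = smooth_on_differentiable[OF u(1) S(2)]
    smooth_on_differentiable[OF smooth_on_pd[OF u(1)] S(2)]
    smooth_on_differentiable[OF smooth_beta u(2)[OF S(2)]]
  have dn: "(\<lambda>y. pd j u y $ k) differentiable (at y)" for k
    using smooth_on_differentiable[OF smooth_on_nth[OF S(1) smooth_on_pd[OF u(1)]] S(2)] .
  have db: "(\<lambda>y. beta (u y) $ k) differentiable (at y)" for k
    using differentiable_compose[OF d(3) d(1)] .
  have "0 = pd i (\<lambda>y. \<Sum>k\<in>UNIV. beta (u y) $ k * pd j u y $ k) y"
    using pd_cong[OF S, of "\<lambda>y. \<Sum>k\<in>UNIV. beta (u y) $ k * pd j u y $ k" "\<lambda>y. 0" i] tangent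
    by (simp add: inner_vec_def)
  also have "\<dots> = (\<Sum>k\<in>UNIV. beta (u y) $ k * pd i (pd j u) y $ k +
      (\<Sum>p\<in>UNIV. pd i u y $ p * dbeta (u y) p k) * pd j u y $ k)"
    by (simp add: pd_sum pd_mult db dn differentiable_mult pd_nth[OF d(2)] pd_chain[OF d(1) d(3)]
        dbeta_def)
  finally show "beta (u y) \<bullet> pd i (pd j u) y +
      (\<Sum>p\<in>UNIV. \<Sum>q\<in>UNIV. dbeta (u y) p q * pd i u y $ p * pd j u y $ q) = 0"
    by (simp add: inner_vec_def sum_3 algebra_simps)
qed

text \<open>The projection to the base is injective on the tangent plane, since a vector killed by
  it and by \<open>\<beta>\<close> is 0; by dimension it is onto. So some tangent vector has the
  same projection as \<open>\<nu>\<close>, and orthogonality to it makes \<open>base \<nu>\<close>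
  isotropic for P.\<close>

lemma normal_vertical:
  fixes u :: "real^2 \<Rightarrow> real^3"
  assumes S: "open S" "y \<in> S" and u: "smooth_on S u" "\<And>y. y \<in> S \<Longrightarrow> u y \<in> Uhat"
    and level: "\<And>y. y \<in> S \<Longrightarrow> logR (u y) = c"
    and inj: "inj (frechet_derivative u (at y))"
    and n: "n (u y) \<noteq> 0"
    and normal: "\<And>i. pd i u y \<bullet> (kform m n (u y) *v \<nu>) = 0"
  shows "base \<nu> = 0"
proof -
  let ?B = "\<lambda>w. base (frechet_derivative u (at y) w)"
  note d = smooth_on_differentiable[OF u(1) S(2)]
  have D: "frechet_derivative u (at y) w = (\<Sum>i\<in>UNIV. w $ i *\<^sub>R pd i u y)" for w
    by (rule frechet_derivative_eq_sum_pd[OF d])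
  have lin: "linear (frechet_derivative u (at y))"
    using has_derivative_linear[OF differentiable_has_derivative[OF d]] .
  have tangent: "beta (u y) \<bullet> frechet_derivative u (at y) w = 0" for w
    by (simp add: D inner_sum_right beta_tangent[OF S u level])
  have "linear ?B"
    using linear_compose[OF lin bounded_linear.linear[OF bounded_linear_base]] by (simp add: o_def)
  moreover have "w = 0" if "?B w = 0" for w
    using eq_0_if_base_beta[OF u(2)[OF S(2)] that tangent] inj lin
    by (metis linear_injective_0)
  ultimately have "surj ?B"
    using linear_injective_imp_surjective linear_injective_0 by blast
  then obtain w where w: "?B w = base \<nu>" by (metis surjD)
  have "frechet_derivative u (at y) w \<bullet> (kform m n (u y) *v \<nu>) = 0"
    by (simp add: D inner_sum_left normal)
  then have "base \<nu> \<bullet> (P (base (u y)) *v base \<nu>) = 0"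
    using n by (simp add: kform_form tangent w)
  then show ?thesis
    using pos_P[OF Uhat_D(1)[OF u(2)[OF S(2)]]] by force
qed

text \<open>The parameter \<open>\<mu>\<close> is the homogeneity \<open>\<nabla>k = 2\<mu> \<beta> k\<close> of the metric \<open>k = m \<beta>\<beta> + n P\<close>:
  \<open>1\<close> for \<open>g\<close> and \<open>0\<close> for \<open>f\<close>.\<close>
lemma second_form_level:
  fixes f :: "'x \<Rightarrow> 'y" and T :: "('y, 3) tensor2" and b :: "('x, 2) chart" and e :: "('y, 3) chart"
  defines "u \<equiv> local_rep f b e"
  assumes S: "open S" "y \<in> S" and u: "smooth_on S u" "\<And>y. y \<in> S \<Longrightarrow> u y \<in> Uhat"
    and level: "\<And>y. y \<in> S \<Longrightarrow> logR (u y) = c"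
    and inj: "inj (frechet_derivative u (at y))"
    and T: "\<And>w. w \<in> Uhat \<Longrightarrow> T e w = kform m n w"
    and mn: "smooth_on Uhat m" "smooth_on Uhat n" "m (u y) \<noteq> 0" "n (u y) \<noteq> 0"
    and pd: "\<And>i. pd i m (u y) = 2 * \<mu> * m (u y) * beta (u y) $ i"
      "\<And>i. pd i n (u y) = 2 * \<mu> * n (u y) * beta (u y) $ i"
    and normal: "normal_vector f T b e y \<nu>"
  shows "base \<nu> = 0"
    and "second_form f T b e y \<nu> = (- \<mu> * \<nu> $ 3 / u y $ 3) *\<^sub>R induced_form f T b e y"
proof -
  define z where "z = u y"
  have z: "z \<in> Uhat" using u(2) S by (simp add: z_def)
  have Tz: "T e z = kform m n z" by (rule T[OF z])
  have \<nu>: "base \<nu> = 0"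
    using normal Tz unfolding normal_vector_def Let_def u_def[symmetric] z_def
    by (intro normal_vertical[where n = n and m = m, OF S u level inj mn(4)]) auto
  then show "base \<nu> = 0" .
  have \<nu>12: "\<nu> $ 1 = 0" "\<nu> $ 2 = 0"
    using \<nu> by (auto simp: vec_eq_iff forall_2)
  have "det (T e z) \<noteq> 0"
    using mn(3,4) det_kform[OF z, of m n] R_neg[OF Uhat_D(1)[OF z]] Uhat_D(2)[OF z]
    by (simp add: Tz[unfolded z_def] z_def)
  then have inv: "invertible (T e z)" by (simp add: invertible_det_nz)
  have pdT: "pd p (\<lambda>w. T e w $ q $ r) z = pd p (\<lambda>w. kform m n w $ q $ r) z" for p q r
    by (rule pd_cong[OF open_Uhat z]) (simp add: T)
  have bn: "beta z \<bullet> \<nu> = beta z $ 3 * \<nu> $ 3"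
    by (simp add: inner_vec_def sum_3 \<nu>12)
  have "second_form f T b e y \<nu> $ i $ j = (- \<mu> * \<nu> $ 3 / u y $ 3) * induced_form f T b e y $ i $ j"
    for i j
  proof -
    define a a' X where "a = pd i u y" and "a' = pd j u y" and "X = pd i (pd j u) y"
    have ta: "beta z \<bullet> a = 0" "beta z \<bullet> a' = 0"
      by (simp_all add: a_def a'_def z_def beta_tangent[OF S u level])
    have tX: "beta z \<bullet> X = - (\<Sum>p\<in>UNIV. \<Sum>q\<in>UNIV. dbeta z p q * a $ p * a' $ q)"
      using beta_second_derivative[OF S u level, of i j] by (simp add: a_def a'_def X_def z_def)
    have "second_form f T b e y \<nu> $ i $ j = \<nu> \<bullet> (T e z *v (\<chi> k. X $ k +
        (\<Sum>p\<in>UNIV. \<Sum>q\<in>UNIV. Levi_Civita T e z $ k $ p $ q * a $ p * a' $ q)))"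
      by (simp add: second_form_def Let_def u_def[symmetric] a_def a'_def X_def z_def)
    also have "\<dots> = \<nu> \<bullet> (T e z *v X) + (\<Sum>p\<in>UNIV. \<Sum>q\<in>UNIV.
        (\<nu> $ 3 * (2 * beta z $ 3 * (\<mu> * m z * beta z $ p * beta z $ q + m z * dbeta z p q -
          \<mu> * n z * hatP z $ p $ q))) * a $ p * a' $ q) / 2"
      unfolding inner_Levi_Civita[where T = T, OF inv] pdT
      using christoffel_vertical[OF z mn(1,2) pd[folded z_def]]
      by (simp add: inner_vec_def[of \<nu>] sum_3[of "\<lambda>l. \<nu> $ l * _ l"] \<nu>12)
    also have "\<nu> \<bullet> (T e z *v X) = m z * beta z $ 3 * \<nu> $ 3 * (beta z \<bullet> X)"
      by (simp add: Tz kform_form bn \<nu> )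
    also have "(\<Sum>p\<in>UNIV. \<Sum>q\<in>UNIV.
        (\<nu> $ 3 * (2 * beta z $ 3 * (\<mu> * m z * beta z $ p * beta z $ q + m z * dbeta z p q -
          \<mu> * n z * hatP z $ p $ q))) * a $ p * a' $ q) / 2 =
        \<nu> $ 3 * beta z $ 3 * (\<Sum>p\<in>UNIV. \<Sum>q\<in>UNIV. (\<mu> * m z * beta z $ p * beta z $ q +
          m z * dbeta z p q - \<mu> * n z * hatP z $ p $ q) * a $ p * a' $ q)"
      by (simp add: sum_distrib_left sum_divide_distrib mult_ac)
    also have "(\<Sum>p\<in>UNIV. \<Sum>q\<in>UNIV. (\<mu> * m z * beta z $ p * beta z $ q +
          m z * dbeta z p q - \<mu> * n z * hatP z $ p $ q) * a $ p * a' $ q) =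
        (\<mu> * m z * ((beta z \<bullet> a) * (beta z \<bullet> a')) +
          m z * (\<Sum>p\<in>UNIV. \<Sum>q\<in>UNIV. dbeta z p q * a $ p * a' $ q) -
          \<mu> * n z * (base a \<bullet> (P (base z) *v base a')))"
      by (simp add: sum_3 inner_vec_def sum_2 matrix_vector_mult_def hatP_def algebra_simps)
    \<comment> \<open>The \<open>dbeta\<close> terms from the second derivative of \<open>u\<close>
      and from the Christoffel symbols cancel, and the \<open>\<beta> \<beta>\<close> term vanishes
      on tangent vectors. What is left is proportional to \<open>n P\<close>, which on tangent
      vectors is the induced form.\<close>
    finally have "second_form f T b e y \<nu> $ i $ j =
        - \<mu> * \<nu> $ 3 * beta z $ 3 * (n z * (base a \<bullet> (P (base z) *v base a')))"
      by (simp add: ta tX algebra_simps)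
    moreover have "induced_form f T b e y $ i $ j = n z * (base a \<bullet> (P (base z) *v base a'))"
      unfolding induced_form_def Let_def u_def[symmetric] a_def[symmetric] a'_def[symmetric]
      by (simp add: Tz[unfolded z_def] kform_form ta[unfolded z_def] a_def[symmetric] a'_def[symmetric] z_def)
    ultimately show ?thesis
      by (simp add: beta_nth z_def)
  qed
  then show "second_form f T b e y \<nu> = (- \<mu> * \<nu> $ 3 / u y $ 3) *\<^sub>R induced_form f T b e y"
    by (simp add: vec_eq_iff)
qed

text \<open>On the tangent plane \<open>\<beta>\<close> vanishes, so the induced form is
  \<open>n P\<close> of the projections, and these are nonzero for nonzero tangent vectors.\<close>

lemma induced_form_level:
  fixes f :: "'x \<Rightarrow> 'y" and T :: "('y, 3) tensor2" and b :: "('x, 2) chart" and e :: "('y, 3) chart"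
  defines "u \<equiv> local_rep f b e"
  assumes S: "open S" "y \<in> S" and u: "smooth_on S u" "\<And>y. y \<in> S \<Longrightarrow> u y \<in> Uhat"
    and level: "\<And>y. y \<in> S \<Longrightarrow> logR (u y) = c"
    and inj: "inj (frechet_derivative u (at y))"
    and T: "\<And>w. w \<in> Uhat \<Longrightarrow> T e w = kform m n w" and n: "n (u y) < 0" and v: "v \<noteq> 0"
  shows "v \<bullet> (induced_form f T b e y *v v) < 0"
proof -
  define w where "w = frechet_derivative u (at y) v"
  note d = smooth_on_differentiable[OF u(1) S(2)]
  have lin: "linear (frechet_derivative u (at y))"
    using has_derivative_linear[OF differentiable_has_derivative[OF d]] .
  have D: "w = (\<Sum>i\<in>UNIV. v $ i *\<^sub>R pd i u y)"
    unfolding w_def by (rule frechet_derivative_eq_sum_pd[OF d])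
  have z: "u y \<in> Uhat" using u(2) S by simp
  have "v \<bullet> (induced_form f T b e y *v v) = w \<bullet> (T e (u y) *v w)"
    unfolding D induced_form_def Let_def u_def[symmetric]
    by (simp add: inner_vec_def[of v] matrix_vector_mult_def[of "\<chi> i j. _ i j" v] sum_2
        matrix_vector_right_distrib matrix_vector_mult_scaleR inner_add_left inner_add_right algebra_simps)
  also have "\<dots> = n (u y) * (base w \<bullet> (P (base (u y)) *v base w))"
  proof -
    have "beta (u y) \<bullet> w = 0"
      by (simp add: D inner_sum_right beta_tangent[OF S u level])
    then show ?thesis by (simp add: T[OF z] kform_form)
  qed
  also have "\<dots> < 0"
  proof -
    have "w \<noteq> 0"
      using inj v lin unfolding w_def by (metis linear_injective_0)
    moreover have "beta (u y) \<bullet> w = 0"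
      by (simp add: D inner_sum_right beta_tangent[OF S u level])
    ultimately have "base w \<noteq> 0"
      using eq_0_if_base_beta[OF z] by blast
    then show ?thesis
      using pos_P[OF Uhat_D(1)[OF z]] n by (simp add: mult_neg_pos)
  qed
  finally show ?thesis .
qed

end

section \<open>AH structures in a chart\<close>

lemma has_signature_pos_def:
  fixes M :: "real^'n::finite^'n"
  assumes "has_signature CARD('n) 0 M" "v \<noteq> 0"
  shows "v \<bullet> (M *v v) > 0"
proof -
  obtain V where V: "subspace V" "dim V = CARD('n)" "\<forall>v\<in>V. v \<noteq> 0 \<longrightarrow> v \<bullet> (M *v v) > 0"
    using assms(1) unfolding has_signature_def by blast
  then have "V = UNIV"
    by (metis DIM_cart DIM_real dim_eq_full mult.right_neutral span_eq_iff)
  then show ?thesis using V(3) assms(2) by blast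
qed

lemma pos_def_2:
  fixes M :: "real^2^2"
  assumes "M $ 1 $ 2 = M $ 2 $ 1" "\<And>v. v \<noteq> 0 \<Longrightarrow> v \<bullet> (M *v v) > 0"
  shows "M $ 1 $ 1 > 0" "det M > 0"
proof -
  have form: "v \<bullet> (M *v v) = v $ 1 * (M $ 1 $ 1 * v $ 1 + M $ 1 $ 2 * v $ 2) +
      v $ 2 * (M $ 2 $ 1 * v $ 1 + M $ 2 $ 2 * v $ 2)" for v :: "real^2"
    by (simp add: inner_vec_def matrix_vector_mult_def sum_2)
  have "axis 1 1 \<noteq> (0 :: real^2)"
    by (simp add: axis_eq_0_iff)
  from assms(2)[OF this] show 11: "M $ 1 $ 1 > 0"
    unfolding form by (simp add: axis_def)
  \<comment> \<open>On this vector the form takes the value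
    \<open>M $ 1 $ 1 * det M\<close>.\<close>
  let ?v = "vector [- M $ 1 $ 2, M $ 1 $ 1] :: real^2"
  have "?v \<noteq> 0"
    using 11 by (auto simp: vec_eq_iff forall_2)
  from assms(2)[OF this] have "M $ 1 $ 1 * det M > 0"
    unfolding form using assms(1) by (simp add: det_2 algebra_simps)
  then show "det M > 0"
    using 11 by (simp add: zero_less_mult_iff)
qed

lemma powr_neg_half: "x > 0 \<Longrightarrow> x powr - (1 / 2) = 1 / sqrt x"
  using powr_minus_divide[of x "1/2"] by (simp add: powr_half_sqrt)

text \<open>Up to a factor the skew part of the Ricci tensor is the trace \<open>R_12p^p\<close> of
  the curvature. The quadratic terms cancel in this trace, which leaves the exterior derivative of
  \<open>trace_conn\<close>.\<close>

lemma ricci_commute: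
  fixes G :: "real^2 \<Rightarrow> real^2^2^2"
  assumes "\<And>k i j. (\<lambda>y. G y $ k $ i $ j) differentiable (at y)"
    and "pd 1 (\<lambda>y. trace_conn G y 2) y = pd 2 (\<lambda>y. trace_conn G y 1) y"
  shows "ricci G y $ i $ j = ricci G y $ j $ i"
proof -
  have 0: "curv G y i i p k = 0" for i p k
    using curv_swap[of G y i i p k] by simp
  have "curv G y 1 2 1 1 + curv G y 1 2 2 2 = 0"
    using assms(2)
    by (simp add: curv_def sum_2 trace_conn_def pd_add assms(1) algebra_simps)
  then have "ricci G y $ 1 $ 2 = ricci G y $ 2 $ 1"
    using curv_swap[of G y 2 1 2 2] by (simp add: ricci_def sum_2 0)
  then show ?thesis
    using exhaust_2[of i] exhaust_2[of j] by auto
qed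

locale AH_data =
  fixes A :: "('a, 2) chart set" and P :: "('a, 2) connection set" and C :: "('a, 2) tensor2 set"
    and Nab :: "('a, 2) connection" and D :: "('a hat, 3) connection" and Rt :: "'a hat \<Rightarrow> real"
  assumes atlas: "smooth_atlas A"
    and AH: "AH_structure A P C"
    and aligned: "aligned_representative A P C Nab"
    and Einstein: "Einstein_AH A C Nab"
    and exact: "exact_AH A C Nab"
    and scal_neg: "\<And>c y. c \<in> A \<Longrightarrow> y \<in> cimg c \<Longrightarrow> weighted_scal C Nab c y < 0"
    and Thomas: "Thomas_connection A Nab D"
    and R_tilde: "R_tilde A C Nab Rt"
begin

abbreviation R :: "('a, 2) chart \<Rightarrow> real^2 \<Rightarrow> real" where
  "R c y \<equiv> weighted_scal C Nab c y"

abbreviation H :: "('a, 2) tensor2" where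
  "H \<equiv> weighted_metric C"

text \<open>The tensor P, defined through \<open>R\<close> and \<open>H\<close>; its identification
  with minus the symmetric Ricci tensor is the Einstein equation.\<close>

definition Sch :: "('a, 2) tensor2" where
  "Sch c y = - (R c y / 2) *\<^sub>R H c y"

text \<open>One metric of the conformal class whose volume is parallel. It also serves as the
  representative from which the weighted metric \<open>H\<close> is computed.\<close>

definition metric :: "('a, 2) tensor2" where
  "metric = (SOME h. h \<in> C \<and> (\<forall>c\<in>A. \<forall>y\<in>cimg c. \<forall>i.
     pd i (\<lambda>z. \<bar>det (h c z)\<bar>) y - 2 * trace_conn (Nab c) y i * \<bar>det (h c y)\<bar> = 0))"

lemma metric: "metric \<in> C" "c \<in> A \<Longrightarrow> y \<in> cimg c \<Longrightarrow>
  pd i (\<lambda>z. \<bar>det (metric c z)\<bar>) y = 2 * trace_conn (Nab c) y i * \<bar>det (metric c y)\<bar>"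
proof -
  have "\<exists>h. h \<in> C \<and> (\<forall>c\<in>A. \<forall>y\<in>cimg c. \<forall>i.
     pd i (\<lambda>z. \<bar>det (h c z)\<bar>) y - 2 * trace_conn (Nab c) y i * \<bar>det (h c y)\<bar> = 0)"
    using exact unfolding exact_AH_def by blast
  from someI_ex[OF this] show "metric \<in> C" "c \<in> A \<Longrightarrow> y \<in> cimg c \<Longrightarrow>
      pd i (\<lambda>z. \<bar>det (metric c z)\<bar>) y = 2 * trace_conn (Nab c) y i * \<bar>det (metric c y)\<bar>"
    unfolding metric_def by auto
qed

lemma conformal: "conformal_structure A C"
  using AH by (simp add: AH_structure_def)

lemma pseudo_metric_metric: "pseudo_metric 2 0 A metric"
  using metric(1) conformal unfolding conformal_structure_def by auto

lemma Nab_connection: "connection A Nab" "torsion_free A Nab"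
proof -
  have "projective_structure A P" "Nab \<in> P"
    using AH aligned by (auto simp: AH_structure_def aligned_representative_def)
  then show "connection A Nab" "torsion_free A Nab"
    unfolding projective_structure_def by auto
qed

lemma open_cimg: "c \<in> A \<Longrightarrow> open (cimg c)"
  using atlas by (simp add: smooth_atlas_def)

context
  fixes c assumes c: "c \<in> A"
begin

lemma smooth_metric: "smooth_on (cimg c) (metric c)"
  using pseudo_metric_metric c by (simp add: pseudo_metric_def)

lemma metric_pos:
  assumes y: "y \<in> cimg c"
  shows "metric c y $ i $ j = metric c y $ j $ i" "v \<noteq> 0 \<Longrightarrow> v \<bullet> (metric c y *v v) > 0"
    "metric c y $ 1 $ 1 > 0" "det (metric c y) > 0"
proof -
  have "transpose (metric c y) = metric c y" and sig: "has_signature CARD(2) 0 (metric c y)"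
    using pseudo_metric_metric c y by (auto simp: pseudo_metric_def)
  then have "transpose (metric c y) $ j $ i = metric c y $ j $ i" for i j
    by simp
  then show sym: "metric c y $ i $ j = metric c y $ j $ i" for i j
    by (simp add: transpose_def)
  show pos: "v \<bullet> (metric c y *v v) > 0" if "v \<noteq> 0" for v
    by (rule has_signature_pos_def[OF sig that])
  show "metric c y $ 1 $ 1 > 0" "det (metric c y) > 0"
    using pos_def_2[OF sym pos] by auto
qed

lemma H_eq: "y \<in> cimg c \<Longrightarrow> H c y = (det (metric c y) powr (-1/2)) *\<^sub>R metric c y"
  using weighted_metric_eq[OF conformal metric(1) c, of y] metric_pos(4)[of y]
  by (simp add: normalized_def powr_neg_half)

lemma smooth_H: "smooth_on (cimg c) (H c)"
proof (rule smooth_on_cong[OF open_cimg[OF c]])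
  show "smooth_on (cimg c) (\<lambda>y. (det (metric c y) powr (-1/2)) *\<^sub>R metric c y)"
    using metric_pos(4)
    by (intro smooth_on_bounded_bilinear[OF _ bounded_bilinear_scaleR] smooth_on_powr smooth_on_det_2
        smooth_metric open_cimg c)
qed (simp add: H_eq)

lemma H_pos:
  assumes y: "y \<in> cimg c"
  shows "H c y $ i $ j = H c y $ j $ i" "v \<noteq> 0 \<Longrightarrow> v \<bullet> (H c y *v v) > 0"
    "H c y $ 1 $ 1 > 0" "det (H c y) = 1"
proof -
  note m = metric_pos[OF y]
  show "H c y $ i $ j = H c y $ j $ i"
    by (simp add: H_eq[OF y] m(1)[of i j])
  show "v \<noteq> 0 \<Longrightarrow> v \<bullet> (H c y *v v) > 0"
    using m(2)[of v] m(4) by (simp add: H_eq[OF y] scaleR_matrix_vector_assoc[symmetric])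
  show "H c y $ 1 $ 1 > 0"
    using m(3,4) by (simp add: H_eq[OF y])
  have "det (H c y) = (det (metric c y) powr (-1/2))\<^sup>2 * det (metric c y)"
    by (simp add: H_eq[OF y] det_2 power2_eq_square algebra_simps)
  also have "(det (metric c y) powr (-1/2))\<^sup>2 = 1 / det (metric c y)"
    using m(4) by (simp add: powr_neg_half power_divide)
  finally show "det (H c y) = 1"
    using m(4) by simp
qed

lemma smooth_Nab: "smooth_on (cimg c) (\<lambda>y. Nab c y $ k $ i $ j)"
  using Nab_connection(1) c unfolding connection_def by (intro smooth_on_nth open_cimg) auto

lemma smooth_trace_Nab: "smooth_on (cimg c) (\<lambda>y. trace_conn (Nab c) y i)"
  unfolding trace_conn_def by (intro smooth_on_sum smooth_Nab open_cimg c) auto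

lemma ricci_sym:
  assumes y: "y \<in> cimg c"
  shows "ricci (Nab c) y $ i $ j = ricci (Nab c) y $ j $ i"
proof (rule ricci_commute)
  show "(\<lambda>y. Nab c y $ k $ i $ j) differentiable (at y)" for k i j
    by (rule smooth_on_differentiable[OF smooth_Nab y])
  have "pd 1 (\<lambda>y. 2 * trace_conn (Nab c) y 2) y = pd 2 (\<lambda>y. 2 * trace_conn (Nab c) y 1) y"
  proof (rule pd_log_derivative_commute[OF open_cimg[OF c] y,
        where \<theta> = "\<lambda>i y. 2 * trace_conn (Nab c) y i"])
    show "smooth_on (cimg c) (\<lambda>y. \<bar>det (metric c y)\<bar>)"
      by (rule smooth_on_cong[OF open_cimg[OF c] smooth_on_det_2[OF open_cimg[OF c] smooth_metric]])
         (use metric_pos(4) in force)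
    show "\<bar>det (metric c y)\<bar> \<noteq> 0"
      using metric_pos(4)[OF y] by simp
    show "(\<lambda>y. 2 * trace_conn (Nab c) y i) differentiable (at y)" for i
      using smooth_on_differentiable[OF smooth_trace_Nab y] by (intro differentiable_mult) auto
    show "pd i (\<lambda>y. \<bar>det (metric c y)\<bar>) y = 2 * trace_conn (Nab c) y i * \<bar>det (metric c y)\<bar>"
      if "y \<in> cimg c" for i y
      by (rule metric(2)[OF c that])
  qed
  then show "pd 1 (\<lambda>y. trace_conn (Nab c) y 2) y = pd 2 (\<lambda>y. trace_conn (Nab c) y 1) y"
    using smooth_on_differentiable[OF smooth_trace_Nab y] by (simp add: pd_cmult)
qed

lemma ricci_eq:
  assumes y: "y \<in> cimg c"
  shows "ricci (Nab c) y = - Sch c y" "Defs.ricci_sym (Nab c) y = - Sch c y"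
    "ricci_skew (Nab c) y = 0"
proof -
  show 1: "Defs.ricci_sym (Nab c) y = - Sch c y"
    using Einstein c y by (simp add: Einstein_AH_def Sch_def)
  have "ricci (Nab c) y = Defs.ricci_sym (Nab c) y"
    using ricci_sym[OF y] by (simp add: ricci_sym_def vec_eq_iff)
  with 1 show "ricci (Nab c) y = - Sch c y" by simp
  show "ricci_skew (Nab c) y = 0"
    using ricci_sym[OF y] by (simp add: ricci_skew_def vec_eq_iff)
qed

lemma pd_R:
  assumes y: "y \<in> cimg c"
  shows "pd i (R c) y = trace_conn (Nab c) y i * R c y"
proof -
  have "faraday (Nab c) w = 0" if "w \<in> cimg c" for w
    using ricci_eq(3)[OF that] by (simp add: faraday_def)
  then have "cov_tensor2 (Nab c) (faraday (Nab c)) y q i p = 0" for q i p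
    using pd_cong[OF open_cimg[OF c] y, of "\<lambda>z. faraday (Nab c) z $ i $ p" "\<lambda>z. 0" q] y
    by (simp add: cov_tensor2_def)
  then show ?thesis
    using Einstein c y unfolding Einstein_AH_def by fastforce
qed

text \<open>\<open>R\<close> is defined through a matrix inverse; the 11 component of
  \<open>Ric = R H / 2\<close> exhibits it as a quotient of smooth functions with positive
  denominator.\<close>

lemma smooth_R: "smooth_on (cimg c) (R c)"
proof (rule smooth_on_cong[OF open_cimg[OF c]])
  show "smooth_on (cimg c) (\<lambda>y. 2 * ricci (Nab c) y $ 1 $ 1 / H c y $ 1 $ 1)"
    using H_pos(3) unfolding ricci_def vec_lambda_beta curv_def
    by (intro smooth_on_divide smooth_on_mult smooth_on_const smooth_on_sum smooth_on_add smooth_on_diff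
        smooth_on_pd[OF smooth_Nab] smooth_Nab smooth_on_nth smooth_H open_cimg c) (auto simp: less_le)
  show "2 * ricci (Nab c) y $ 1 $ 1 / H c y $ 1 $ 1 = R c y" if y: "y \<in> cimg c" for y
    using H_pos(3)[OF y] ricci_eq(1)[OF y] by (simp add: Sch_def)
qed

text \<open>Since \<open>R\<close> is parallel, its derivative supplies exactly the weight term of
  \<open>cov_weighted_metric\<close>. Hence \<open>\<nabla>P = - R/2 \<nabla>H\<close>, and the
  alignment condition gives the symmetry.\<close>

lemma codazzi:
  assumes y: "y \<in> cimg c"
  shows "cov_tensor2 (Nab c) (Sch c) y i j k = cov_tensor2 (Nab c) (Sch c) y j i k"
proof -
  have d: "R c differentiable (at y)" "(\<lambda>z. H c z $ i $ j) differentiable (at y)" for i j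
    using smooth_on_differentiable[OF smooth_R y]
      smooth_on_differentiable[OF smooth_on_nth[OF open_cimg[OF c] smooth_on_nth[OF open_cimg[OF c] smooth_H]] y]
    by auto
  have "cov_tensor2 (Nab c) (Sch c) y i j k = - (R c y / 2) * cov_weighted_metric (Nab c) (H c) y i j k"
    for i j k
  proof -
    have "pd i (\<lambda>z. Sch c z $ j $ k) y = pd i (\<lambda>z. (- 1/2) * (R c z * H c z $ j $ k)) y"
      by (simp add: Sch_def)
    also have "\<dots> = (- 1/2) * (R c y * pd i (\<lambda>z. H c z $ j $ k) y +
        trace_conn (Nab c) y i * R c y * H c y $ j $ k)"
      unfolding pd_R[OF y, symmetric]
      by (subst pd_cmult) (simp_all add: pd_mult d differentiable_mult)
    finally show ?thesis
      by (simp add: cov_tensor2_def cov_weighted_metric_def Sch_def sum_2 algebra_simps)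
  qed
  then show ?thesis
    using aligned c y by (simp add: aligned_representative_def)
qed

lemma AH_chart: "AH_chart (cimg c) (Nab c) (Sch c) (R c)"
proof
  show "open (cimg c)" by (rule open_cimg[OF c])
  show "smooth_on (cimg c) (Nab c)"
    using Nab_connection(1) c by (simp add: connection_def)
  show "smooth_on (cimg c) (R c)" by (rule smooth_R)
  have "smooth_on (cimg c) (\<lambda>y. (- 1 / 2 * R c y) *\<^sub>R H c y)"
    by (intro smooth_on_bounded_bilinear[OF _ bounded_bilinear_scaleR] smooth_on_mult smooth_on_const
        smooth_R smooth_H open_cimg c)
  then show "smooth_on (cimg c) (Sch c)"
    by (simp add: Sch_def[abs_def])
  fix y assume y: "y \<in> cimg c"
  show "Nab c y $ k $ i $ j = Nab c y $ k $ j $ i" for k i j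
    using Nab_connection(2) c y by (simp add: torsion_free_def)
  show R: "R c y < 0" by (rule scal_neg[OF c y])
  show "pd i (R c) y = trace_conn (Nab c) y i * R c y" for i by (rule pd_R[OF y])
  show "Sch c y $ i $ j = Sch c y $ j $ i" for i j
    by (simp add: Sch_def H_pos(1)[OF y, of i j])
  show "v \<bullet> (Sch c y *v v) > 0" if "v \<noteq> 0" for v
  proof -
    have "v \<bullet> (Sch c y *v v) = - (R c y / 2) * (v \<bullet> (H c y *v v))"
      unfolding Sch_def scaleR_matrix_vector_assoc[symmetric] by simp
    then show ?thesis
      using H_pos(2)[OF y that] R by (simp add: mult_neg_pos)
  qed
  have "det (Sch c y) = (R c y / 2)\<^sup>2 * det (H c y)"
    by (simp add: Sch_def det_2 power2_eq_square algebra_simps)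
  then show "det (Sch c y) = (R c y)\<^sup>2 / 4"
    by (simp add: H_pos(4)[OF y] power_divide)
  show "ricci (Nab c) y = - Sch c y" by (rule ricci_eq(1)[OF y])
  show "cov_tensor2 (Nab c) (Sch c) y i j k = cov_tensor2 (Nab c) (Sch c) y j i k" for i j k
    by (rule codazzi[OF y])
qed

end

end

text \<open>The conditions determine every component: the Euler field fixes those with last index 3,
  torsion-freeness those with middle index 3, and the horizontal lifts of the two coordinate fields
  the remaining ones.\<close>

lemma (in AH_chart) thomas_components:
  fixes D :: "real^3 \<Rightarrow> real^3^3^3" and E :: "real^3 \<Rightarrow> real^3"
  assumes z: "z \<in> Uhat"
    and E: "\<And>w. w \<in> Uhat \<Longrightarrow> E w = vector [0, 0, w $ 3]"
    and torsion: "\<And>k i j. D z $ k $ i $ j = D z $ k $ j $ i"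
    and euler: "\<And>i j. pd i (\<lambda>w. E w $ j) z + (\<Sum>k\<in>UNIV. D z $ j $ i $ k * E z $ k) =
      (if i = j then 1 else 0)"
    and horizontal: "\<And>X Y. smooth_on U X \<Longrightarrow> smooth_on U Y \<Longrightarrow>
      cov_deriv D (hlift G X) (hlift G Y) z =
        hlift G (cov_deriv G X Y) z + (X (base z) \<bullet> (P (base z) *v Y (base z))) *\<^sub>R E z"
  shows "D z = cone z"
proof -
  note y = Uhat_D(1)[OF z] and s = Uhat_D(2)[OF z]
  have "pd i (\<lambda>w. E w $ j) z = pd i (\<lambda>w. vector [0, 0, w $ 3] $ j) z" for i j
    by (rule pd_cong[OF open_Uhat z]) (simp add: E)
  then have "pd i (\<lambda>w. E w $ j) z = (if i = 3 \<and> j = 3 then 1 else 0)" for i j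
    using exhaust_3[of j] by (elim disjE; simp add: pd_coord)
  then have "D z $ j $ i $ 3 * z $ 3 = (if i = j then 1 else 0) - (if i = 3 \<and> j = 3 then 1 else 0)" for i j
    using euler[of i j] by (simp add: E[OF z] sum_3)
  then have "D z $ j $ i $ 3 = ((if i = j then 1 else 0) - (if i = 3 \<and> j = 3 then 1 else 0)) / z $ 3" for i j
    unfolding nonzero_eq_divide_eq[OF s] .
  then have D3: "D z $ j $ i $ 3 = (if i = j \<and> j \<noteq> 3 then 1 / z $ 3 else 0)" for i j
    by auto
  have D3': "D z $ j $ 3 $ i = (if i = j \<and> j \<noteq> 3 then 1 / z $ 3 else 0)" for i j
    using D3 torsion by metis
  \<comment> \<open>Constant fields suffice: their covariant derivatives are the Christoffel
    symbols, and their lifts are \<open>\<partial>_i + s gam_i \<partial>_s\<close>.\<close>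
  define X :: "2 \<Rightarrow> real^2 \<Rightarrow> real^2" where "X i y = axis i 1" for i y
  have X: "smooth_on U (X i)" for i
    unfolding X_def[abs_def] by (rule smooth_on_const)
  have lift: "hlift G (X i) w = vector [if i = 1 then 1 else 0, if i = 2 then 1 else 0, w $ 3 * gam i (base w)]"
    for i w
    using exhaust_2[of i] by (elim disjE; simp add: hlift_def X_def sum_2 axis_def gam_def)
  have covX: "cov_deriv G (X i) (X j) y = (\<chi> k. G y $ k $ i $ j)" for i j y
    using exhaust_2[of i] exhaust_2[of j]
    by (elim disjE; simp add: cov_deriv_def X_def sum_2 axis_def)
  note d = smooth_on_differentiable[OF smooth_gam y]
  have h: "cov_deriv D (hlift G (X i)) (hlift G (X j)) z $ k =
      hlift G (\<lambda>y. \<chi> k. G y $ k $ i $ j) z $ k + P (base z) $ i $ j * (if k = 3 then z $ 3 else 0)" for i j k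
  proof -
    have "X i (base z) \<bullet> (P (base z) *v X j (base z)) = P (base z) $ i $ j"
      by (simp add: X_def matrix_vector_mult_basis inner_axis' column_def)
    then show ?thesis
      using horizontal[OF X X, of i j] exhaust_3[of k]
      by (elim disjE; simp add: covX[abs_def] E[OF z])
  qed
  have hlift: "hlift G Y w = vector [Y (base w) $ 1, Y (base w) $ 2,
      w $ 3 * (gam 1 (base w) * Y (base w) $ 1 + gam 2 (base w) * Y (base w) $ 2)]" for Y w
    by (simp add: hlift_def gam_def sum_2 field_simps)
  note simps = hlift D3 D3' cone_conn_def sum_3 sum_2 pd_coord_mult_base[OF d] thomas_a_def thomas_q_def
  have 11: "D z $ 1 $ 1 $ 1 = cone z $ 1 $ 1 $ 1" "D z $ 2 $ 1 $ 1 = cone z $ 2 $ 1 $ 1"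
    "D z $ 3 $ 1 $ 1 = cone z $ 3 $ 1 $ 1"
    using h[of 1 1 1] h[of 1 1 2] h[of 1 1 3] s unfolding cov_deriv_def lift
    by (simp_all add: simps) (simp_all add: field_simps)
  have 12: "D z $ 1 $ 1 $ 2 = cone z $ 1 $ 1 $ 2" "D z $ 2 $ 1 $ 2 = cone z $ 2 $ 1 $ 2"
    "D z $ 3 $ 1 $ 2 = cone z $ 3 $ 1 $ 2"
    using h[of 1 2 1] h[of 1 2 2] h[of 1 2 3] s unfolding cov_deriv_def lift
    by (simp_all add: simps) (simp_all add: field_simps)
  have 21: "D z $ 1 $ 2 $ 1 = cone z $ 1 $ 2 $ 1" "D z $ 2 $ 2 $ 1 = cone z $ 2 $ 2 $ 1"
    "D z $ 3 $ 2 $ 1 = cone z $ 3 $ 2 $ 1"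
    using h[of 2 1 1] h[of 2 1 2] h[of 2 1 3] s unfolding cov_deriv_def lift
    by (simp_all add: simps) (simp_all add: field_simps)
  have 22: "D z $ 1 $ 2 $ 2 = cone z $ 1 $ 2 $ 2" "D z $ 2 $ 2 $ 2 = cone z $ 2 $ 2 $ 2"
    "D z $ 3 $ 2 $ 2 = cone z $ 3 $ 2 $ 2"
    using h[of 2 2 1] h[of 2 2 2] h[of 2 2 3] s unfolding cov_deriv_def lift
    by (simp_all add: simps) (simp_all add: field_simps)
  have "D z $ k $ i $ j = cone z $ k $ i $ j" for i j k
    using exhaust_3[of i] exhaust_3[of j] exhaust_3[of k]
    by (elim disjE; simp add: 11 12 21 22; simp add: D3 D3' cone_conn_def)
  then show ?thesis by (simp add: vec_eq_iff)
qed

section \<open>Charts of an atlas\<close>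

lemma hess_cong:
  assumes "open S" "y \<in> S" "\<And>y. y \<in> S \<Longrightarrow> u y = u' y"
  shows "hess G u y = hess G u' y"
proof -
  have 1: "pd j u w = pd j u' w" if "w \<in> S" for j w
    by (rule pd_cong[OF assms(1) that assms(3)])
  have "pd i (pd j u) y = pd i (pd j u') y" for i j
    by (rule pd_cong[OF assms(1,2) 1])
  then show ?thesis
    by (simp add: hess_def 1[OF assms(2)])
qed

lemma hess_cmult:
  assumes "open S" "y \<in> S" "smooth_on S u"
  shows "hess G (\<lambda>z. r * u z) y = r *\<^sub>R hess G u y"
proof -
  have 1: "pd j (\<lambda>z. r * u z) w = r * pd j u w" if "w \<in> S" for j w
    by (rule pd_cmult[OF smooth_on_differentiable[OF assms(3) that]])
  have "pd i (pd j (\<lambda>z. r * u z)) y = pd i (\<lambda>w. r * pd j u w) y" for i j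
    by (rule pd_cong[OF assms(1,2) 1])
  then have "pd i (pd j (\<lambda>z. r * u z)) y = r * pd i (pd j u) y" for i j
    by (simp add: pd_cmult smooth_on_differentiable[OF smooth_on_pd[OF assms(3)] assms(2)])
  then show ?thesis
    by (simp add: hess_def vec_eq_iff 1[OF assms(2)] right_diff_distrib sum_distrib_left mult_ac)
qed

lemma linear_matrix_works:
  fixes f :: "real^'n::finite \<Rightarrow> real^'m::finite"
  shows "linear f \<Longrightarrow> matrix f *v x = f x"
  using matrix_works[of f] by (simp add: linear_def scalar_mult_eq_scaleR)

section \<open>Transition maps and their Jacobians\<close>

lemma snd_chart_inv:
  assumes "y \<in> cimg c"
  shows "chart_inv c y \<in> fst c" "snd c (chart_inv c y) = y"
  using assms unfolding cimg_def chart_inv_def by (auto intro: inv_into_into f_inv_into_f)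

lemma overlap_subset: "overlap c d \<subseteq> cimg c"
  by (auto simp: overlap_def cimg_def)

lemma jac_nth: "jac c d y $ k $ i = pd i (transition c d) y $ k"
  by (simp add: jac_def matrix_def pd_def)

context
  fixes A :: "('a, 'n::finite) chart set"
  assumes A: "smooth_atlas A"
begin

lemma atlas_inj: "c \<in> A \<Longrightarrow> inj_on (snd c) (fst c)"
  using A by (simp add: smooth_atlas_def)

lemma atlas_open: "c \<in> A \<Longrightarrow> open (cimg c)"
  using A by (simp add: smooth_atlas_def)

lemma open_overlap: "c \<in> A \<Longrightarrow> d \<in> A \<Longrightarrow> open (overlap c d)"
  using A by (simp add: smooth_atlas_def)

lemma smooth_transition: "c \<in> A \<Longrightarrow> d \<in> A \<Longrightarrow> smooth_on (overlap c d) (transition c d)"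
  using A by (simp add: smooth_atlas_def)

lemma chart_inv_snd: "c \<in> A \<Longrightarrow> x \<in> fst c \<Longrightarrow> chart_inv c (snd c x) = x"
  by (simp add: chart_inv_def atlas_inj)

lemma overlap_iff: "c \<in> A \<Longrightarrow> y \<in> overlap c d \<longleftrightarrow> y \<in> cimg c \<and> chart_inv c y \<in> fst d"
proof
  assume "c \<in> A" "y \<in> overlap c d"
  then show "y \<in> cimg c \<and> chart_inv c y \<in> fst d"
    by (auto simp: overlap_def cimg_def chart_inv_snd)
next
  assume "c \<in> A" "y \<in> cimg c \<and> chart_inv c y \<in> fst d"
  then show "y \<in> overlap c d"
    using snd_chart_inv[of y c] unfolding overlap_def by (metis IntI imageI)
qed

lemma transition_snd: "c \<in> A \<Longrightarrow> x \<in> fst c \<Longrightarrow> transition c d (snd c x) = snd d x"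
  by (simp add: transition_def chart_inv_snd)

lemma chart_inv_transition:
  assumes "c \<in> A" "d \<in> A" "y \<in> overlap c d"
  shows "chart_inv d (transition c d y) = chart_inv c y" "transition c d y \<in> overlap d c"
proof -
  have y: "chart_inv c y \<in> fst c" "chart_inv c y \<in> fst d"
    using overlap_iff[OF assms(1), of y d] assms(3) snd_chart_inv(1)[of y c] by simp_all
  then show "chart_inv d (transition c d y) = chart_inv c y"
    by (simp add: transition_def chart_inv_snd assms)
  show "transition c d y \<in> overlap d c"
    unfolding transition_def using y by (auto simp: overlap_def)
qed

lemma has_derivative_transition:
  assumes "c \<in> A" "d \<in> A" "y \<in> overlap c d"
  shows "(transition c d has_derivative frechet_derivative (transition c d) (at y)) (at y)"
  by (rule smooth_on_has_derivative[OF smooth_transition]) (use assms in auto)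

lemma jac_works:
  assumes "c \<in> A" "d \<in> A" "y \<in> overlap c d"
  shows "jac c d y *v a = frechet_derivative (transition c d) (at y) a"
  unfolding jac_def by (rule linear_matrix_works[OF has_derivative_linear[OF has_derivative_transition[OF assms]]])

lemma smooth_jac:
  assumes "c \<in> A" "d \<in> A"
  shows "smooth_on (overlap c d) (jac c d)"
  by (intro smooth_on_vec_lambda open_overlap assms; simp only: jac_nth)
     (intro smooth_on_nth smooth_on_pd smooth_transition open_overlap assms)

lemma jac_trans:
  assumes c: "c \<in> A" "d \<in> A" "e \<in> A" and x: "x \<in> fst c" "x \<in> fst d" "x \<in> fst e"
  shows "jac c e (snd c x) = jac d e (snd d x) ** jac c d (snd c x)"
proof -
  let ?y = "snd c x"
  have y: "?y \<in> overlap c d" "?y \<in> overlap c e" "snd d x \<in> overlap d e"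
    using x by (auto simp: overlap_def)
  note f = has_derivative_transition[OF c(1,2) y(1)]
  have g: "(transition d e has_derivative frechet_derivative (transition d e) (at (snd d x)))
      (at (transition c d ?y))"
    using has_derivative_transition[OF c(2,3) y(3)] by (simp add: transition_snd c x)
  have "frechet_derivative (transition c e) (at ?y) =
      frechet_derivative (\<lambda>y. transition d e (transition c d y)) (at ?y)"
  proof (rule frechet_derivative_cong[OF open_Int[OF open_overlap[OF c(1,2)] open_overlap[OF c(1,3)]]])
    show "?y \<in> overlap c d \<inter> overlap c e" using y by simp
    fix w assume "w \<in> overlap c d \<inter> overlap c e"
    then show "transition c e w = transition d e (transition c d w)"
      using chart_inv_transition[OF c(1,2), of w] by (simp add: transition_def)
  qed
  also have "\<dots> = frechet_derivative (transition d e) (at (snd d x)) \<circ> frechet_derivative (transition c d) (at ?y)"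
    using frechet_derivative_eqI[OF has_derivative_compose[OF f g]] by (simp add: o_def)
  finally show ?thesis
    unfolding jac_def
    by (simp add: matrix_compose has_derivative_linear[OF f] has_derivative_linear[OF g])
qed

lemma jac_self:
  assumes "c \<in> A" "x \<in> fst c"
  shows "jac c c (snd c x) = mat 1"
proof -
  have "frechet_derivative (transition c c) (at (snd c x)) = frechet_derivative (\<lambda>y. y) (at (snd c x))"
    by (rule frechet_derivative_cong[OF atlas_open[OF assms(1)]])
       (use assms snd_chart_inv(2)[of _ c] in \<open>auto simp: transition_def cimg_def\<close>)
  then show ?thesis
    using matrix_id_mat_1 by (simp add: jac_def id_def)
qed

lemma det_jac:
  assumes "c \<in> A" "d \<in> A" "x \<in> fst c" "x \<in> fst d"
  shows "det (jac c d (snd c x)) * det (jac d c (snd d x)) = 1"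
  using jac_trans[OF assms(2,1,2) assms(4,3,4)] jac_self[OF assms(2,4)]
  by (metis det_I det_mul)

lemma det_jac_neq_0:
  assumes "c \<in> A" "d \<in> A" "y \<in> overlap c d"
  shows "det (jac c d y) \<noteq> 0"
proof -
  obtain x where "x \<in> fst c" "x \<in> fst d" "y = snd c x"
    using assms(3) by (auto simp: overlap_def)
  then show ?thesis
    using det_jac[OF assms(1,2)] by force
qed

end

section \<open>The bundle\<close>

text \<open>The point of \<open>Mhat A\<close> over \<open>x\<close> with fibre coordinate
  \<open>s\<close> in the chart \<open>c\<close>. Its cube transforms by Jacobian determinants, and
  real cube roots are unique, so the other components are forced.\<close>

definition lift :: "('a, 2) chart set \<Rightarrow> ('a, 2) chart \<Rightarrow> 'a \<Rightarrow> real \<Rightarrow> 'a hat" where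
  "lift A c x s = (x, \<lambda>d. if d \<in> A \<and> x \<in> fst d then root 3 (det (jac d c (snd d x))) * s else 0)"

lemma fst_lift [simp]: "fst (lift A c x s) = x"
  by (simp add: lift_def)

lemma snd_lift: "d \<in> A \<Longrightarrow> x \<in> fst d \<Longrightarrow> snd (lift A c x s) d = root 3 (det (jac d c (snd d x))) * s"
  by (simp add: lift_def)

lemma Mhat_cube: "p \<in> Mhat A \<Longrightarrow> (\<lambda>c. (snd p c) ^ 3) \<in> det_cotangent A (fst p)"
  by (auto simp: Mhat_def)

lemma Mhat_base: "p \<in> Mhat A \<Longrightarrow> \<exists>c\<in>A. fst p \<in> fst c"
  by (simp add: Mhat_def points_def case_prod_beta)

lemma snd_hat_chart:
  "base (snd (hat_chart A c) p) = snd c (fst p)" "snd (hat_chart A c) p $ 3 = snd p c"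
  by (simp_all add: hat_chart_def vec_eq_iff forall_2)

lemma fst_hat_chart: "fst (hat_chart A c) = {p \<in> Mhat A. fst p \<in> fst c}"
  by (simp add: hat_chart_def)

lemma eq_if_base_3: "base z = base w \<Longrightarrow> z $ 3 = w $ 3 \<Longrightarrow> z = w"
  by (simp add: vec_eq_iff forall_2 forall_3)

context
  fixes A :: "('a, 2) chart set"
  assumes A: "smooth_atlas A"
begin

lemma snd_lift_self [simp]: "c \<in> A \<Longrightarrow> x \<in> fst c \<Longrightarrow> snd (lift A c x s) c = s"
  by (simp add: snd_lift jac_self[OF A])

lemma lift_Mhat:
  assumes c: "c \<in> A" "x \<in> fst c" and s: "s \<noteq> 0"
  shows "lift A c x s \<in> Mhat A"
proof -
  define \<theta> where "\<theta> = snd (lift A c x s)"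
  have cube: "(\<theta> d) ^ 3 = det (jac d c (snd d x)) * s ^ 3" if "d \<in> A" "x \<in> fst d" for d
    using that by (simp add: \<theta>_def snd_lift power_mult_distrib odd_real_root_pow)
  have "(\<lambda>d. (\<theta> d) ^ 3) \<in> det_cotangent A x"
    unfolding det_cotangent_def
  proof (intro CollectI conjI allI ballI impI)
    fix d assume "d \<notin> A \<or> x \<notin> fst d"
    then show "(\<theta> d) ^ 3 = 0" by (auto simp: \<theta>_def lift_def)
  next
    fix d e assume de: "d \<in> A" "e \<in> A" "x \<in> fst d \<inter> fst e"
    then show "(\<theta> d) ^ 3 = det (jac d e (snd d x)) * (\<theta> e) ^ 3"
      using jac_trans[OF A de(1,2) c(1), of x] c(2) by (simp add: cube det_mul)
  qed
  moreover have "(\<theta> c) ^ 3 \<noteq> 0"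
    using c s by (simp add: \<theta>_def)
  then have "(\<lambda>d. (\<theta> d) ^ 3) \<noteq> (\<lambda>d. 0)"
    by (rule contrapos_nn) (rule fun_cong)
  moreover have "lift A c x s = (x, \<theta>)"
    by (simp add: \<theta>_def prod_eq_iff)
  ultimately show ?thesis
    using c by (auto simp: Mhat_def points_def)
qed

lemma Mhat_snd:
  assumes p: "p \<in> Mhat A" and c: "c \<in> A" "fst p \<in> fst c" and d: "d \<in> A" "fst p \<in> fst d"
  shows "snd p d = root 3 (det (jac d c (snd d (fst p)))) * snd p c"
proof -
  have "(snd p d) ^ 3 = det (jac d c (snd d (fst p))) * (snd p c) ^ 3"
    using Mhat_cube[OF p] c d unfolding det_cotangent_def by blast
  then have "root 3 ((snd p d) ^ 3) = root 3 (det (jac d c (snd d (fst p))) * (snd p c) ^ 3)"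
    by simp
  then show ?thesis
    by (simp add: real_root_mult odd_real_root_power_cancel)
qed

lemma Mhat_eq_lift:
  assumes p: "p \<in> Mhat A" and c: "c \<in> A" "fst p \<in> fst c"
  shows "p = lift A c (fst p) (snd p c)"
proof -
  have "snd p d = snd (lift A c (fst p) (snd p c)) d" for d
  proof (cases "d \<in> A \<and> fst p \<in> fst d")
    case True
    then show ?thesis
      using Mhat_snd[OF p c] by (simp add: snd_lift)
  next
    case False
    then have "(snd p d) ^ 3 = 0"
      using Mhat_cube[OF p] unfolding det_cotangent_def by blast
    then show ?thesis
      using False by (auto simp: lift_def)
  qed
  then have "snd p = snd (lift A c (fst p) (snd p c))"
    by (rule ext)
  then show ?thesis
    by (rule prod_eqI[rotated]) simp
qed

text \<open>All components are multiples of the one at \<open>c\<close>, and not all of them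
  vanish.\<close>

lemma Mhat_snd_neq_0:
  assumes p: "p \<in> Mhat A" and c: "c \<in> A" "fst p \<in> fst c"
  shows "snd p c \<noteq> 0"
proof
  assume 0: "snd p c = 0"
  have "snd p = snd (lift A c (fst p) (snd p c))"
    by (rule arg_cong[OF Mhat_eq_lift[OF p c]])
  also have "\<dots> = (\<lambda>d. 0)"
    by (simp add: 0 lift_def fun_eq_iff)
  finally have "(\<lambda>d. (snd p d) ^ 3) = (\<lambda>d. 0)"
    by simp
  then show False
    using p by (simp add: Mhat_def case_prod_beta)
qed

lemma snd_hat_chart_lift:
  assumes "c \<in> A" "base z \<in> cimg c"
  shows "snd (hat_chart A c) (lift A c (chart_inv c (base z)) (z $ 3)) = z"
  by (rule eq_if_base_3) (use snd_chart_inv[OF assms(2)] assms in \<open>auto simp: snd_hat_chart\<close>)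

lemma cimg_hat_chart:
  assumes c: "c \<in> A"
  shows "cimg (hat_chart A c) = {z. base z \<in> cimg c \<and> z $ 3 \<noteq> 0}"
proof (intro set_eqI iffI)
  fix z assume "z \<in> cimg (hat_chart A c)"
  then obtain p where "p \<in> Mhat A" "fst p \<in> fst c" "z = snd (hat_chart A c) p"
    by (auto simp: cimg_def fst_hat_chart)
  then show "z \<in> {z. base z \<in> cimg c \<and> z $ 3 \<noteq> 0}"
    using Mhat_snd_neq_0[OF _ c] by (auto simp: snd_hat_chart cimg_def)
next
  fix z assume z: "z \<in> {z. base z \<in> cimg c \<and> z $ 3 \<noteq> 0}"
  then have "lift A c (chart_inv c (base z)) (z $ 3) \<in> fst (hat_chart A c)"
    using snd_chart_inv[of "base z" c] lift_Mhat[OF c] by (auto simp: fst_hat_chart)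
  then show "z \<in> cimg (hat_chart A c)"
    unfolding cimg_def using snd_hat_chart_lift[OF c, of z] z by (metis (no_types, lifting) imageI mem_Collect_eq)
qed

lemma hat_chart_inj: "c \<in> A \<Longrightarrow> inj_on (snd (hat_chart A c)) (fst (hat_chart A c))"
proof (rule inj_onI)
  fix p q assume c: "c \<in> A" and pq: "p \<in> fst (hat_chart A c)" "q \<in> fst (hat_chart A c)"
    "snd (hat_chart A c) p = snd (hat_chart A c) q"
  then have "snd c (fst p) = snd c (fst q)" "snd p c = snd q c"
    by (metis snd_hat_chart(1), metis snd_hat_chart(2))
  then have "fst p = fst q"
    using atlas_inj[OF A c] pq by (auto simp: fst_hat_chart inj_on_def)
  with \<open>snd p c = snd q c\<close> show "p = q"
    using Mhat_eq_lift[OF _ c] pq by (metis (mono_tags, lifting) fst_hat_chart mem_Collect_eq)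
qed

lemma chart_inv_hat_chart:
  assumes c: "c \<in> A" and z: "z \<in> cimg (hat_chart A c)"
  shows "chart_inv (hat_chart A c) z = lift A c (chart_inv c (base z)) (z $ 3)"
proof -
  have z': "base z \<in> cimg c" "z $ 3 \<noteq> 0"
    using z by (auto simp: cimg_hat_chart[OF c])
  have "lift A c (chart_inv c (base z)) (z $ 3) \<in> fst (hat_chart A c)"
    using snd_chart_inv[OF z'(1)] lift_Mhat[OF c] z' by (auto simp: fst_hat_chart)
  then show ?thesis
    using snd_hat_chart_lift[OF c z'(1)] hat_chart_inj[OF c]
    unfolding chart_inv_def by (metis inv_into_f_f)
qed

lemma overlap_hat_chart:
  assumes c: "c \<in> A" and d: "d \<in> A"
  shows "overlap (hat_chart A c) (hat_chart A d) = {z. base z \<in> overlap c d \<and> z $ 3 \<noteq> 0}"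
proof (intro set_eqI iffI)
  fix z assume "z \<in> overlap (hat_chart A c) (hat_chart A d)"
  then obtain p where "p \<in> Mhat A" "fst p \<in> fst c" "fst p \<in> fst d" "z = snd (hat_chart A c) p"
    by (auto simp: overlap_def fst_hat_chart)
  then show "z \<in> {z. base z \<in> overlap c d \<and> z $ 3 \<noteq> 0}"
    using Mhat_snd_neq_0[OF _ c] by (auto simp: snd_hat_chart overlap_def)
next
  fix z assume z: "z \<in> {z. base z \<in> overlap c d \<and> z $ 3 \<noteq> 0}"
  then have b: "base z \<in> cimg c" "chart_inv c (base z) \<in> fst d"
    using overlap_iff[OF A c] by auto
  then have "lift A c (chart_inv c (base z)) (z $ 3) \<in> fst (hat_chart A c) \<inter> fst (hat_chart A d)"
    using snd_chart_inv[OF b(1)] lift_Mhat[OF c] z by (auto simp: fst_hat_chart)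
  then show "z \<in> overlap (hat_chart A c) (hat_chart A d)"
    unfolding overlap_def using snd_hat_chart_lift[OF c b(1)] by (metis imageI)
qed

lemma transition_hat_chart:
  assumes c: "c \<in> A" and d: "d \<in> A" and z: "z \<in> overlap (hat_chart A c) (hat_chart A d)"
  shows "base (transition (hat_chart A c) (hat_chart A d) z) = transition c d (base z)"
    "transition (hat_chart A c) (hat_chart A d) z $ 3 =
      root 3 (det (jac d c (transition c d (base z)))) * z $ 3"
proof -
  have z': "base z \<in> cimg c" "chart_inv c (base z) \<in> fst d" "z \<in> cimg (hat_chart A c)"
    using z overlap_iff[OF A c, of _ d] by (auto simp: overlap_hat_chart[OF c d] cimg_hat_chart[OF c])
  show "base (transition (hat_chart A c) (hat_chart A d) z) = transition c d (base z)"
    "transition (hat_chart A c) (hat_chart A d) z $ 3 =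
      root 3 (det (jac d c (transition c d (base z)))) * z $ 3"
    using z' d by (simp_all add: transition_def chart_inv_hat_chart[OF c] snd_hat_chart snd_lift)
qed

lemma smooth_transition_hat_chart:
  assumes c: "c \<in> A" and d: "d \<in> A"
  shows "smooth_on (overlap (hat_chart A c) (hat_chart A d)) (transition (hat_chart A c) (hat_chart A d))"
proof (rule smooth_on_vec_lambda)
  let ?O = "overlap (hat_chart A c) (hat_chart A d)" and ?t = "transition (hat_chart A c) (hat_chart A d)"
  show O: "open ?O"
    unfolding overlap_hat_chart[OF c d] by (rule open_base_preimage[OF open_overlap[OF A c d]])
  have O_base: "z \<in> ?O \<Longrightarrow> base z \<in> overlap c d" for z
    by (simp add: overlap_hat_chart[OF c d])
  have 1: "smooth_on ?O (\<lambda>z. transition c d (base z))"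
    by (rule smooth_on_base[OF O open_overlap[OF A c d] smooth_transition[OF A c d] O_base])
  have 2: "smooth_on ?O (\<lambda>z. jac d c (transition c d (base z)))"
    by (rule smooth_on_compose[OF O open_overlap[OF A d c] chart_inv_transition(2)[OF A c d O_base] 1
        smooth_jac[OF A d c]])
  \<comment> \<open>The cube root is smooth here because Jacobian determinants do not
    vanish.\<close>
  have 3: "smooth_on ?O (\<lambda>z. root 3 (det (jac d c (transition c d (base z)))) * z $ 3)"
    using det_jac_neq_0[OF A d c chart_inv_transition(2)[OF A c d O_base]]
    by (intro smooth_on_mult smooth_on_root_3 smooth_on_det_2 2 smooth_on_nth smooth_on_id O)
  have "smooth_on ?O (\<lambda>z. ?t z $ 1)" "smooth_on ?O (\<lambda>z. ?t z $ 2)"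
    using smooth_on_cong[OF O smooth_on_nth[OF O 1, of 1], of "\<lambda>z. ?t z $ 1"]
      smooth_on_cong[OF O smooth_on_nth[OF O 1, of 2], of "\<lambda>z. ?t z $ 2"]
      transition_hat_chart(1)[OF c d] by (metis base_nth)+
  moreover have "smooth_on ?O (\<lambda>z. ?t z $ 3)"
    by (rule smooth_on_cong[OF O 3]) (simp add: transition_hat_chart(2)[OF c d])
  ultimately show "smooth_on ?O (\<lambda>z. ?t z $ i)" for i
    using exhaust_3[of i] by auto
qed

text \<open>Obtained by differentiating the compatibility of the bundle transition with the
  projection. What is needed about the remaining row of the Jacobian, that of the fibre coordinate,
  is supplied by \<open>beta_transform\<close>.\<close>

lemma base_jac_hat_chart:
  assumes c: "c \<in> A" and d: "d \<in> A" and z: "z \<in> overlap (hat_chart A c) (hat_chart A d)"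
  shows "base (jac (hat_chart A c) (hat_chart A d) z *v a) = jac c d (base z) *v base a"
proof -
  let ?O = "overlap (hat_chart A c) (hat_chart A d)" and ?t = "transition (hat_chart A c) (hat_chart A d)"
  have O: "open ?O"
    unfolding overlap_hat_chart[OF c d] by (rule open_base_preimage[OF open_overlap[OF A c d]])
  note t = smooth_on_has_derivative[OF smooth_transition_hat_chart[OF c d] z]
  have bz: "base z \<in> overlap c d"
    using z by (simp add: overlap_hat_chart[OF c d])
  have "frechet_derivative (\<lambda>z. base (?t z)) (at z) = frechet_derivative (\<lambda>z. transition c d (base z)) (at z)"
    by (rule frechet_derivative_cong[OF O z transition_hat_chart(1)[OF c d]])
  moreover have "frechet_derivative (\<lambda>z. base (?t z)) (at z) = (\<lambda>a. base (frechet_derivative ?t (at z) a))"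
    by (rule frechet_derivative_eqI[OF bounded_linear.has_derivative[OF bounded_linear_base t]])
  moreover have "frechet_derivative (\<lambda>z. transition c d (base z)) (at z) =
      (\<lambda>a. frechet_derivative (transition c d) (at (base z)) (base a))"
    by (rule frechet_derivative_eqI[OF has_derivative_compose[OF
        bounded_linear_imp_has_derivative[OF bounded_linear_base] has_derivative_transition[OF A c d bz]]])
  moreover have "jac (hat_chart A c) (hat_chart A d) z *v a = frechet_derivative ?t (at z) a"
    unfolding jac_def by (rule linear_matrix_works[OF has_derivative_linear[OF t]])
  ultimately show ?thesis
    by (simp add: jac_works[OF A c d bz] fun_eq_iff)
qed

end

section \<open>The Hessian metrics\<close>

context AH_data
begin

abbreviation hat :: "('a, 2) chart \<Rightarrow> ('a hat, 3) chart" where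
  "hat \<equiv> hat_chart A"

abbreviation hbeta :: "('a, 2) chart \<Rightarrow> real^3 \<Rightarrow> real^3" where
  "hbeta c \<equiv> AH_chart.beta (Nab c)"

abbreviation hform :: "('a, 2) chart \<Rightarrow> (real^3 \<Rightarrow> real) \<Rightarrow> (real^3 \<Rightarrow> real) \<Rightarrow> real^3 \<Rightarrow> real^3^3" where
  "hform c \<equiv> AH_chart.kform (Nab c) (Sch c)"

abbreviation hlog :: "('a, 2) chart \<Rightarrow> real^3 \<Rightarrow> real" where
  "hlog c \<equiv> AH_chart.logR (R c)"

abbreviation hv :: "('a, 2) chart \<Rightarrow> real^3 \<Rightarrow> real" where
  "hv c \<equiv> AH_chart.vfun (R c)"

lemma cimg_hat: "c \<in> A \<Longrightarrow> cimg (hat c) = AH_chart.Uhat (cimg c)"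
  using AH_chart.Uhat_def[OF AH_chart] by (simp add: cimg_hat_chart[OF atlas])

lemma open_cimg_hat: "c \<in> A \<Longrightarrow> open (cimg (hat c))"
  using AH_chart.open_Uhat[OF AH_chart] by (simp add: cimg_hat)

lemma D_eq_cone:
  assumes c: "c \<in> A" and z: "z \<in> cimg (hat c)"
  shows "D (hat c) z =
    cone_conn (AH_chart.thomas_a (Nab c)) (AH_chart.thomas_q (Nab c) (Sch c)) z"
proof -
  interpret ch: AH_chart "cimg c" "Nab c" "Sch c" "R c" by (rule AH_chart[OF c])
  have euler_eq: "euler (hat c) w = vector [0, 0, w $ 3]" if w: "w \<in> cimg (hat c)" for w
  proof -
    have *: "snd (hat c) (chart_inv (hat c) w) = w"
      by (rule snd_chart_inv(2)[OF w])
    have w12: "snd c (fst (chart_inv (hat c) w)) = base w" "snd (chart_inv (hat c) w) c = w $ 3"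
      using snd_hat_chart[of A c "chart_inv (hat c) w"] by (simp_all add: *)
    have "snd (hat c) (dilate (exp t) (chart_inv (hat c) w)) = vector [w $ 1, w $ 2, exp t * w $ 3]" for t
      by (rule eq_if_base_3) (simp_all add: snd_hat_chart dilate_def w12 vec_eq_iff forall_2)
    moreover have "((\<lambda>t. vector [w $ 1, w $ 2, exp t * w $ 3] :: real^3) has_vector_derivative
        vector [0, 0, w $ 3]) (at 0)"
    proof -
      have eq: "vector [w $ 1, w $ 2, exp t * w $ 3] =
          vector [w $ 1, w $ 2, 0] + (exp t * w $ 3) *\<^sub>R (axis 3 1 :: real^3)" for t
        by (simp add: vec_eq_iff forall_3 axis_def)
      have "vector [0, 0, w $ 3] = (w $ 3) *\<^sub>R (axis 3 1 :: real^3)"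
        by (simp add: vec_eq_iff forall_3 axis_def)
      then show ?thesis
        unfolding eq by (auto intro!: derivative_eq_intros)
    qed
    ultimately show ?thesis
      by (simp add: euler_def vector_derivative_at)
  qed
  have e: "hat c \<in> hat_atlas A" using c by (simp add: hat_atlas_def)
  have zb: "base z \<in> cimg c"
    using z by (simp add: cimg_hat_chart[OF atlas c])
  \<comment> \<open>The skew part of the Ricci tensor vanishes, so only the symmetric term remains
    in \<open>proj_P\<close>.\<close>
  have P: "proj_P (Nab c) (base z) = Sch c (base z)"
    using ricci_eq[OF c zb] by (simp add: proj_P_def)
  show ?thesis
  proof (rule ch.thomas_components[where E = "euler (hat c)"])
    show "z \<in> ch.Uhat" using z c by (simp add: cimg_hat)
    show "euler (hat c) w = vector [0, 0, w $ 3]" if "w \<in> ch.Uhat" for w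
      using euler_eq that c by (simp add: cimg_hat)
    show "D (hat c) z $ k $ i $ j = D (hat c) z $ k $ j $ i" for k i j
      using Thomas e z by (simp add: Thomas_connection_def torsion_free_def)
    show "pd i (\<lambda>w. euler (hat c) w $ j) z + (\<Sum>k\<in>UNIV. D (hat c) z $ j $ i $ k * euler (hat c) z $ k) =
        (if i = j then 1 else 0)" for i j
      using Thomas c z by (simp add: Thomas_connection_def Let_def)
    show "cov_deriv (D (hat c)) (hlift (Nab c) X) (hlift (Nab c) Y) z =
        hlift (Nab c) (cov_deriv (Nab c) X Y) z +
        (X (base z) \<bullet> (Sch c (base z) *v Y (base z))) *\<^sub>R euler (hat c) z"
      if "smooth_on (cimg c) X" "smooth_on (cimg c) Y" for X Y
      using Thomas c z that by (simp add: Thomas_connection_def Let_def P)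
  qed
qed

section \<open>The function R~ and the two tensors in bundle charts\<close>

lemma R_tilde_eq:
  assumes "c \<in> A" "p \<in> Mhat A" "fst p \<in> fst c"
  shows "R c (snd c (fst p)) = Rt p * \<bar>snd p c\<bar> ^ 3"
  using R_tilde assms by (simp add: R_tilde_def power_abs)

lemma chart_inv_hat:
  assumes c: "c \<in> A" and z: "z \<in> cimg (hat c)"
  shows "chart_inv (hat c) z \<in> Mhat A" "fst (chart_inv (hat c) z) = chart_inv c (base z)"
    "snd (chart_inv (hat c) z) c = z $ 3" "fst (chart_inv (hat c) z) \<in> fst c"
proof -
  have zb: "base z \<in> cimg c" "z $ 3 \<noteq> 0"
    using z by (auto simp: cimg_hat_chart[OF atlas c])
  note x = snd_chart_inv[OF zb(1)]
  show "chart_inv (hat c) z \<in> Mhat A" "fst (chart_inv (hat c) z) = chart_inv c (base z)"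
    "snd (chart_inv (hat c) z) c = z $ 3" "fst (chart_inv (hat c) z) \<in> fst c"
    using lift_Mhat[OF atlas c x(1) zb(2)] x(1) c
    by (simp_all add: chart_inv_hat_chart[OF atlas c z] snd_lift_self[OF atlas])
qed

lemma Rt_chart:
  assumes c: "c \<in> A" and z: "z \<in> cimg (hat c)"
  shows "Rt (chart_inv (hat c) z) = R c (base z) / \<bar>z $ 3\<bar> ^ 3"
proof -
  have zb: "base z \<in> cimg c" "z $ 3 \<noteq> 0"
    using z by (auto simp: cimg_hat_chart[OF atlas c])
  then show ?thesis
    using R_tilde_eq[OF c chart_inv_hat(1,4)[OF c z]] chart_inv_hat[OF c z] snd_chart_inv[OF zb(1)]
    by (simp add: field_simps)
qed

lemma v_tilde_chart:
  assumes c: "c \<in> A" and z: "z \<in> cimg (hat c)"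
  shows "v_tilde Rt (chart_inv (hat c) z) = hv c z"
  using z AH_chart.vfun_eq[OF AH_chart[OF c], of z] c
  by (simp add: v_tilde_def Rt_chart[OF c z] cimg_hat)

text \<open>The identity \<open>- 3/2 log v~ = log |R~| - log 2\<close>; the shift disappears in the
  Hessian.\<close>

lemma F_pot_chart:
  assumes c: "c \<in> A" and z: "z \<in> cimg (hat c)"
  shows "F_pot Rt (chart_inv (hat c) z) = hlog c z - ln 2"
  by (simp add: F_pot_def v_tilde_chart[OF c z] AH_chart.vfun_def[OF AH_chart[OF c]])

lemma g_tensor_chart:
  assumes c: "c \<in> A" and z: "z \<in> cimg (hat c)"
  shows "g_tensor D Rt (hat c) z = hform c (hv c) (\<lambda>z. - hv c z) z"
proof -
  interpret ch: AH_chart "cimg c" "Nab c" "Sch c" "R c" by (rule AH_chart[OF c])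
  have "hessian D (v_tilde Rt) (hat c) z = hess (D (hat c)) (hv c) z"
    unfolding hessian_def by (rule hess_cong[OF open_cimg_hat[OF c] z v_tilde_chart[OF c]])
  then show ?thesis
    using ch.hess_vfun[of z "D (hat c)"] z c D_eq_cone[OF c z] by (simp add: g_tensor_def cimg_hat)
qed

lemma f_tensor_chart:
  assumes c: "c \<in> A" and z: "z \<in> cimg (hat c)"
  shows "f_tensor D Rt (hat c) z = hform c (\<lambda>z. 3) (\<lambda>z. 3) z"
proof -
  interpret ch: AH_chart "cimg c" "Nab c" "Sch c" "R c" by (rule AH_chart[OF c])
  have "hessian D (F_pot Rt) (hat c) z = hess (D (hat c)) (\<lambda>z. hlog c z - ln 2) z"
    unfolding hessian_def by (rule hess_cong[OF open_cimg_hat[OF c] z F_pot_chart[OF c]])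
  also have "\<dots> = hess (D (hat c)) (hlog c) z"
  proof -
    have 1: "pd i (\<lambda>z. hlog c z - ln 2) w = pd i (hlog c) w" if "w \<in> ch.Uhat" for i w
      using smooth_on_differentiable[OF ch.smooth_logR that] by (simp add: pd_diff)
    have zU: "z \<in> ch.Uhat" using z c by (simp add: cimg_hat)
    have "pd i (pd j (\<lambda>z. hlog c z - ln 2)) z = pd i (pd j (hlog c)) z" for i j
      by (rule pd_cong[OF ch.open_Uhat zU 1])
    then show ?thesis by (simp add: hess_def 1[OF zU])
  qed
  finally show ?thesis
    using ch.hess_logR[of z "D (hat c)"] z c D_eq_cone[OF c z] by (simp add: f_tensor_def cimg_hat)
qed

text \<open>That \<open>R\<close> is a density is read off \<open>R~\<close>: both components of
  \<open>R\<close> are \<open>R~ |\<theta>^3|\<close> at one point \<open>p\<close> of the bundle,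
  chosen with fibre coordinate 1 in \<open>d\<close>.\<close>

lemma R_transform:
  assumes c: "c \<in> A" and d: "d \<in> A" and y: "y \<in> overlap c d"
  shows "R c y = \<bar>det (jac c d y)\<bar> * R d (transition c d y)"
proof -
  define x where "x = chart_inv c y"
  have x: "x \<in> fst c" "x \<in> fst d" "snd c x = y" "transition c d y = snd d x"
    using y overlap_iff[OF atlas c] snd_chart_inv[of y c] by (auto simp: x_def transition_def)
  define p where "p = lift A d x 1"
  have p: "p \<in> Mhat A" "fst p = x" "snd p d = 1"
    using lift_Mhat[OF atlas d x(2), of 1] snd_lift_self[OF atlas d x(2), of 1]
    by (simp_all add: p_def)
  have "snd p c = root 3 (det (jac c d y))"
    using Mhat_snd[OF atlas p(1) d _ c] x p by simp
  then have "\<bar>snd p c\<bar> ^ 3 = \<bar>det (jac c d y)\<bar>"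
    by (simp add: odd_real_root_pow flip: power_abs)
  then show ?thesis
    using R_tilde_eq[OF c p(1)] R_tilde_eq[OF d p(1)] x p by simp
qed

lemma metric_transform:
  assumes c: "c \<in> A" and d: "d \<in> A" and y: "y \<in> overlap c d"
  shows "metric c y = transpose (jac c d y) ** metric d (transition c d y) ** jac c d y"
  using pseudo_metric_metric assms by (simp add: pseudo_metric_def)

lemma inner_transpose_mult:
  fixes J M :: "real^'n::finite^'n"
  shows "a \<bullet> ((transpose J ** M ** J) *v b) = (J *v a) \<bullet> (M *v (J *v b))"
  by (simp add: matrix_vector_mul_assoc[symmetric] transpose_matrix_vector del: matrix_vector_mul_assoc)
     (metis dot_lmul_matrix inner_commute)

text \<open>\<open>R H\<close> carries no weight: the factor \<open>|det J|\<close> from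
  \<open>R\<close> cancels the one from the square root of the determinant of the metric.\<close>

lemma Sch_transform:
  assumes c: "c \<in> A" and d: "d \<in> A" and y: "y \<in> overlap c d"
  shows "a \<bullet> (Sch c y *v b) = (jac c d y *v a) \<bullet> (Sch d (transition c d y) *v (jac c d y *v b))"
proof -
  define J where "J = jac c d y"
  define w where "w = transition c d y"
  have yc: "y \<in> cimg c" and wd: "w \<in> cimg d"
    using y overlap_subset[of c d] overlap_subset[of d c] chart_inv_transition(2)[OF atlas c d y]
    by (auto simp: w_def)
  have J: "det J \<noteq> 0"
    using det_jac_neq_0[OF atlas c d y] by (simp add: J_def)
  have m: "metric c y = transpose J ** metric d w ** J"
    using metric_transform[OF c d y] by (simp add: J_def w_def)
  have "det (metric c y) = (det J)\<^sup>2 * det (metric d w)"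
    by (simp add: m det_mul power2_eq_square)
  then have s: "sqrt (det (metric c y)) = \<bar>det J\<bar> * sqrt (det (metric d w))"
    by (simp add: real_sqrt_mult)
  have H: "H c y = (1 / sqrt (det (metric c y))) *\<^sub>R metric c y"
    "H d w = (1 / sqrt (det (metric d w))) *\<^sub>R metric d w"
    using H_eq[OF c yc] metric_pos(4)[OF c yc] H_eq[OF d wd] metric_pos(4)[OF d wd]
    by (simp_all add: powr_neg_half)
  have "a \<bullet> (Sch c y *v b) = - (R c y / 2) / sqrt (det (metric c y)) * (a \<bullet> (metric c y *v b))"
    unfolding Sch_def H scaleR_matrix_vector_assoc[symmetric] inner_scaleR_right by simp
  also have "\<dots> = - (R d w / 2) / sqrt (det (metric d w)) * ((J *v a) \<bullet> (metric d w *v (J *v b)))"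
    unfolding s R_transform[OF c d y, folded w_def J_def] unfolding m inner_transpose_mult using J by simp
  also have "\<dots> = (J *v a) \<bullet> (Sch d w *v (J *v b))"
    unfolding Sch_def H scaleR_matrix_vector_assoc[symmetric] inner_scaleR_right by simp
  finally show ?thesis by (simp add: J_def w_def)
qed

lemma overlap_hat_D:
  assumes c: "c \<in> A" and d: "d \<in> A" and z: "z \<in> overlap (hat c) (hat d)"
  shows "base z \<in> overlap c d" "z \<in> cimg (hat c)" "transition (hat c) (hat d) z \<in> cimg (hat d)"
    "chart_inv (hat d) (transition (hat c) (hat d) z) = chart_inv (hat c) z"
proof -
  show b: "base z \<in> overlap c d"
    using z by (simp add: overlap_hat_chart[OF atlas c d])
  show zc: "z \<in> cimg (hat c)"
    using z overlap_subset[of "hat c" "hat d"] by auto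
  obtain p where p: "p \<in> fst (hat c)" "p \<in> fst (hat d)" "z = snd (hat c) p"
    using z by (auto simp: overlap_def)
  have "chart_inv (hat c) z = p" "chart_inv (hat d) (snd (hat d) p) = p"
    using p hat_chart_inj[OF atlas c] hat_chart_inj[OF atlas d] by (simp_all add: chart_inv_def)
  then show "transition (hat c) (hat d) z \<in> cimg (hat d)"
    "chart_inv (hat d) (transition (hat c) (hat d) z) = chart_inv (hat c) z"
    using p by (auto simp: transition_def cimg_def)
qed

lemma open_overlap_hat: "c \<in> A \<Longrightarrow> d \<in> A \<Longrightarrow> open (overlap (hat c) (hat d))"
  using open_base_preimage[OF open_overlap[OF atlas]] by (simp add: overlap_hat_chart[OF atlas])

lemma hv_transition:
  assumes "c \<in> A" "d \<in> A" "z \<in> overlap (hat c) (hat d)"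
  shows "hv c z = hv d (transition (hat c) (hat d) z)"
  using v_tilde_chart[OF assms(1) overlap_hat_D(2)[OF assms]]
    v_tilde_chart[OF assms(2) overlap_hat_D(3)[OF assms]] overlap_hat_D(4)[OF assms] by simp

text \<open>\<open>v~\<close> is a function on the bundle and \<open>d v~ = 2 v~ \<beta>\<close>, so
  the chain rule makes \<open>\<beta>\<close> a global one-form.\<close>

lemma beta_transform:
  assumes c: "c \<in> A" and d: "d \<in> A" and z: "z \<in> overlap (hat c) (hat d)"
  shows "hbeta d (transition (hat c) (hat d) z) \<bullet> (jac (hat c) (hat d) z *v a) = hbeta c z \<bullet> a"
proof -
  interpret c: AH_chart "cimg c" "Nab c" "Sch c" "R c" by (rule AH_chart[OF c])
  interpret d: AH_chart "cimg d" "Nab d" "Sch d" "R d" by (rule AH_chart[OF d])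
  let ?t = "transition (hat c) (hat d)"
  note zD = overlap_hat_D[OF c d z]
  have zc: "z \<in> c.Uhat" and td: "?t z \<in> d.Uhat"
    using zD c d by (simp_all add: cimg_hat)
  note t = smooth_on_differentiable[OF smooth_transition_hat_chart[OF atlas c d] z]
  have "(2 * hv c z) * hbeta c z $ i = (2 * hv c z) * (\<Sum>k\<in>UNIV. jac (hat c) (hat d) z $ k $ i * hbeta d (?t z) $ k)" for i
  proof -
    have "pd i (hv c) z = pd i (\<lambda>w. hv d (?t w)) z"
      by (rule pd_cong[OF open_overlap_hat[OF c d] z hv_transition[OF c d]])
    also have "\<dots> = (\<Sum>k\<in>UNIV. jac (hat c) (hat d) z $ k $ i * pd k (hv d) (?t z))"
      using pd_chain[OF t smooth_on_differentiable[OF d.smooth_vfun td], of i]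
      by (simp add: jac_def matrix_def pd_def[of i ?t])
    finally show ?thesis
      by (simp add: c.pd_vfun[OF zc] d.pd_vfun[OF td] hv_transition[OF c d z] sum_distrib_left mult_ac
          del: mult_cancel_left mult_cancel_right)
  qed
  then have "hbeta c z $ i = (\<Sum>k\<in>UNIV. jac (hat c) (hat d) z $ k $ i * hbeta d (?t z) $ k)" for i
    using c.vfun_pos[of z] by simp
  then show ?thesis
    by (simp add: inner_vec_def matrix_vector_mult_def sum_3 algebra_simps)
qed

lemma hform_transform:
  assumes c: "c \<in> A" and d: "d \<in> A" and z: "z \<in> overlap (hat c) (hat d)"
    and mn: "m z = m' (transition (hat c) (hat d) z)" "n z = n' (transition (hat c) (hat d) z)"
  shows "hform c m n z = transpose (jac (hat c) (hat d) z) **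
    hform d m' n' (transition (hat c) (hat d) z) ** jac (hat c) (hat d) z"
proof (rule matrix_eqI)
  note zD = overlap_hat_D[OF c d z]
  show "a \<bullet> (hform c m n z *v b) = a \<bullet> ((transpose (jac (hat c) (hat d) z) **
    hform d m' n' (transition (hat c) (hat d) z) ** jac (hat c) (hat d) z) *v b)" for a b
    using Sch_transform[OF c d zD(1), of "base a" "base b"]
    by (simp add: inner_transpose_mult AH_chart.kform_form[OF AH_chart[OF c]]
        AH_chart.kform_form[OF AH_chart[OF d]] beta_transform[OF c d z] mn
        base_jac_hat_chart[OF atlas c d z] transition_hat_chart(1)[OF atlas c d z])
qed

section \<open>Global statements on the bundle\<close>

lemma ball_hat_atlas: "(\<forall>e\<in>hat_atlas A. Q e) \<longleftrightarrow> (\<forall>c\<in>A. Q (hat c))"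
  by (simp add: hat_atlas_def)

lemma pseudo_metric_hform:
  assumes T: "\<And>c z. c \<in> A \<Longrightarrow> z \<in> cimg (hat c) \<Longrightarrow> T (hat c) z = hform c (m c) (n c) z"
    and smooth: "\<And>c. c \<in> A \<Longrightarrow> smooth_on (cimg (hat c)) (m c)"
      "\<And>c. c \<in> A \<Longrightarrow> smooth_on (cimg (hat c)) (n c)"
    and sig: "\<And>c z. c \<in> A \<Longrightarrow> z \<in> cimg (hat c) \<Longrightarrow> has_signature p q (hform c (m c) (n c) z)"
    and inv: "\<And>c d z. c \<in> A \<Longrightarrow> d \<in> A \<Longrightarrow> z \<in> overlap (hat c) (hat d) \<Longrightarrow>
      m c z = m d (transition (hat c) (hat d) z) \<and> n c z = n d (transition (hat c) (hat d) z)"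
  shows "pseudo_metric p q (hat_atlas A) T"
  unfolding pseudo_metric_def ball_hat_atlas
proof (intro conjI ballI)
  fix c assume c: "c \<in> A"
  interpret ch: AH_chart "cimg c" "Nab c" "Sch c" "R c" by (rule AH_chart[OF c])
  show "smooth_on (cimg (hat c)) (T (hat c))"
    by (rule smooth_on_cong[OF open_cimg_hat[OF c] _ T[OF c, symmetric]])
       (use ch.smooth_kform smooth[OF c] c in \<open>auto simp: cimg_hat\<close>)
  fix z assume z: "z \<in> cimg (hat c)"
  show "transpose (T (hat c) z) = T (hat c) z"
    using ch.transpose_kform z c by (simp add: T[OF c z] cimg_hat)
  show "has_signature p q (T (hat c) z)"
    by (simp add: T[OF c z] sig[OF c z])
next
  fix c d z assume c: "c \<in> A" and d: "d \<in> A" and z: "z \<in> overlap (hat c) (hat d)"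
  show "T (hat c) z = transpose (jac (hat c) (hat d) z) ** T (hat d) (transition (hat c) (hat d) z) **
      jac (hat c) (hat d) z"
    using hform_transform[OF c d z, of "m c" "m d" "n c" "n d"] inv[OF c d z] overlap_hat_D[OF c d z]
    by (simp add: T c d)
qed

lemma D_structure:
  "connection (hat_atlas A) D" "torsion_free (hat_atlas A) D" "flat (hat_atlas A) D"
proof -
  show "connection (hat_atlas A) D" "torsion_free (hat_atlas A) D"
    using Thomas by (auto simp: Thomas_connection_def)
  show "flat (hat_atlas A) D"
    unfolding flat_def ball_hat_atlas
  proof (intro ballI allI)
    fix c z i j p k assume c: "c \<in> A" and z: "z \<in> cimg (hat c)"
    interpret ch: AH_chart "cimg c" "Nab c" "Sch c" "R c" by (rule AH_chart[OF c])
    have "pd l (\<lambda>w. D (hat c) w $ k $ i $ j) z = pd l (\<lambda>w. ch.cone w $ k $ i $ j) z" for l k i j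
      by (rule pd_cong[OF open_cimg_hat[OF c] z]) (simp add: D_eq_cone[OF c])
    then have "curv (D (hat c)) z i j p k = curv ch.cone z i j p k"
      by (simp add: curv_def D_eq_cone[OF c z])
    also have "\<dots> = 0"
      using z by (intro ch.curv_thomas) (auto simp: cimg_hat_chart[OF atlas c])
    finally show "curv (D (hat c)) z i j p k = 0" .
  qed
qed

lemma Hessian_metric_g: "Hessian_metric 1 2 (hat_atlas A) D (g_tensor D Rt)"
proof -
  have s: "smooth_on (cimg (hat c)) (hv c)" if "c \<in> A" for c
    using AH_chart.smooth_vfun[OF AH_chart[OF that]] that by (simp add: cimg_hat)
  have "pseudo_metric 1 2 (hat_atlas A) (g_tensor D Rt)"
  proof (rule pseudo_metric_hform[where m = hv and n = "\<lambda>c z. - hv c z", OF g_tensor_chart s])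
    show "smooth_on (cimg (hat c)) (\<lambda>z. - hv c z)" if "c \<in> A" for c
      by (rule smooth_on_minus[OF open_cimg_hat[OF that] s[OF that]])
    show "has_signature 1 2 (hform c (hv c) (\<lambda>z. - hv c z) z)" if "c \<in> A" "z \<in> cimg (hat c)" for c z
      using AH_chart.has_signature_kform_1_2[OF AH_chart[OF that(1)], of z "hv c" "\<lambda>z. - hv c z"] that
        AH_chart.vfun_pos[OF AH_chart[OF that(1)]] by (simp add: cimg_hat)
  qed (auto simp: hv_transition)
  moreover have "\<exists>F. smooth_function (hat_atlas A) F \<and>
      (\<forall>e\<in>hat_atlas A. \<forall>z\<in>cimg e. g_tensor D Rt e z = hessian D F e z)"
    unfolding ball_hat_atlas
  proof (intro exI conjI ballI)
    show "smooth_function (hat_atlas A) (\<lambda>p. (1/2) * v_tilde Rt p)"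
      unfolding smooth_function_def ball_hat_atlas
    proof (intro ballI)
      fix c assume c: "c \<in> A"
      show "smooth_on (cimg (hat c)) (\<lambda>z. 1 / 2 * v_tilde Rt (chart_inv (hat c) z))"
        by (intro smooth_on_mult smooth_on_const open_cimg_hat[OF c]
            smooth_on_cong[OF open_cimg_hat[OF c] s[OF c] v_tilde_chart[OF c, symmetric]])
    qed
    fix c z assume c: "c \<in> A" and z: "z \<in> cimg (hat c)"
    have sv: "smooth_on (cimg (hat c)) (\<lambda>z. v_tilde Rt (chart_inv (hat c) z))"
      using smooth_on_cong[OF open_cimg_hat[OF c] s[OF c] v_tilde_chart[OF c, symmetric]] by simp
    show "g_tensor D Rt (hat c) z = hessian D (\<lambda>p. (1/2) * v_tilde Rt p) (hat c) z"
      unfolding g_tensor_def hessian_def by (rule hess_cmult[OF open_cimg_hat[OF c] z sv, symmetric])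
  qed
  ultimately show ?thesis
    using D_structure by (simp add: Hessian_metric_def)
qed

lemma Hessian_metric_f: "Hessian_metric 3 0 (hat_atlas A) D (f_tensor D Rt)"
proof -
  have "pseudo_metric 3 0 (hat_atlas A) (f_tensor D Rt)"
  proof (rule pseudo_metric_hform[where m = "\<lambda>c z. 3" and n = "\<lambda>c z. 3", OF f_tensor_chart])
    show "has_signature 3 0 (hform c (\<lambda>z. 3) (\<lambda>z. 3) z)" if "c \<in> A" "z \<in> cimg (hat c)" for c z
      using AH_chart.has_signature_kform_3_0[OF AH_chart[OF that(1)], of z "\<lambda>z. 3" "\<lambda>z. 3"] that
      by (simp add: cimg_hat)
  qed (auto intro: smooth_on_const)
  moreover have "smooth_function (hat_atlas A) (F_pot Rt)"
    unfolding smooth_function_def ball_hat_atlas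
  proof (intro ballI)
    fix c assume c: "c \<in> A"
    have "smooth_on (cimg (hat c)) (\<lambda>z. hlog c z - ln 2)"
      using AH_chart.smooth_logR[OF AH_chart[OF c]] c
      by (intro smooth_on_diff smooth_on_const open_cimg_hat) (auto simp: cimg_hat)
    then show "smooth_on (cimg (hat c)) (\<lambda>z. F_pot Rt (chart_inv (hat c) z))"
      by (rule smooth_on_cong[OF open_cimg_hat[OF c] _ F_pot_chart[OF c, symmetric]])
  qed
  ultimately show ?thesis
    using D_structure by (auto simp: Hessian_metric_def f_tensor_def)
qed

lemma Monge_Ampere_g: "Monge_Ampere (hat_atlas A) D (g_tensor D Rt)"
  unfolding Monge_Ampere_def ball_hat_atlas
proof (intro ballI)
  fix c z assume c: "c \<in> A" and z: "z \<in> cimg (hat c)"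
  interpret ch: AH_chart "cimg c" "Nab c" "Sch c" "R c" by (rule AH_chart[OF c])
  note U = cimg_hat[OF c]
  show "KA_ricci D (g_tensor D Rt) (hat c) z = 0"
    unfolding KA_ricci_def Let_def U
    by (subst ch.KA_ricci_g[OF z[unfolded U] D_eq_cone[OF c, unfolded U] refl
          g_tensor_chart[OF c, unfolded U]]) auto
qed

text \<open>The Einstein constant is \<open>- 2\<close>, since \<open>KA_ricci\<close> is minus a
  Hessian that equals twice the metric.\<close>

lemma Hessian_Einstein_f: "Hessian_Einstein (hat_atlas A) D (f_tensor D Rt)"
  unfolding Hessian_Einstein_def ball_hat_atlas
proof (intro exI ballI)
  fix c z assume c: "c \<in> A" and z: "z \<in> cimg (hat c)"
  interpret ch: AH_chart "cimg c" "Nab c" "Sch c" "R c" by (rule AH_chart[OF c])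
  note U = cimg_hat[OF c]
  show "KA_ricci D (f_tensor D Rt) (hat c) z = (- 2) *\<^sub>R f_tensor D Rt (hat c) z"
    unfolding KA_ricci_def Let_def f_tensor_chart[OF c z] U
    by (subst ch.KA_ricci_f[OF z[unfolded U] D_eq_cone[OF c, unfolded U] refl
          f_tensor_chart[OF c, unfolded U]]) auto
qed

end

section \<open>Topology of atlases\<close>

lemma openin_chart_domain:
  assumes "\<And>c. c \<in> B \<Longrightarrow> inj_on (snd c) (fst c)" "\<And>c. c \<in> B \<Longrightarrow> open (cimg c)"
    "\<And>c d. c \<in> B \<Longrightarrow> d \<in> B \<Longrightarrow> open (overlap c d)" and c: "c \<in> B"
  shows "openin (atlas_topology B) (fst c)"
proof -
  have "snd d ` (fst c \<inter> fst d) = overlap d c" for d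
    by (simp add: overlap_def Int_commute)
  then show ?thesis
    using assms(3) c by (subst openin_atlas_topology[OF assms(1,2)]) (auto simp: points_def)
qed

text \<open>Preimages of a countable basis of Euclidean space under countably many charts form a
  countable basis.\<close>

lemma second_countable_atlas_topology:
  fixes B :: "('a, 'n::finite) chart set"
  assumes B: "\<And>c. c \<in> B \<Longrightarrow> inj_on (snd c) (fst c)" "\<And>c. c \<in> B \<Longrightarrow> open (cimg c)"
    and overlap: "\<And>c d. c \<in> B \<Longrightarrow> d \<in> B \<Longrightarrow> open (overlap c d)"
      "\<And>c d. c \<in> B \<Longrightarrow> d \<in> B \<Longrightarrow> continuous_on (overlap c d) (transition c d)"
    and countable: "countable B"
  shows "second_countable (atlas_topology B)"
proof -
  have openin: "openin (atlas_topology B) U \<longleftrightarrow> U \<subseteq> points B \<and> (\<forall>c\<in>B. open (snd c ` (U \<inter> fst c)))" for U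
    by (rule openin_atlas_topology) (fact B)+
  obtain Q :: "(real^'n) set set" where Q: "countable Q" "topological_basis Q"
    using ex_countable_basis by blast
  define W where "W c S = {x \<in> fst c. snd c x \<in> S}" for c :: "('a, 'n) chart" and S
  have "openin (atlas_topology B) (W c S)" if c: "c \<in> B" and S: "S \<in> Q" for c S
    unfolding openin
  proof (intro conjI ballI)
    show "W c S \<subseteq> points B" using c by (auto simp: W_def points_def)
    fix d assume d: "d \<in> B"
    have tr: "transition d c (snd d x) = snd c x" if "x \<in> fst d" for x
      using that B(1)[OF d] by (simp add: transition_def chart_inv_def)
    have "snd d ` (W c S \<inter> fst d) = overlap d c \<inter> transition d c -` S"
      using tr by (force simp: W_def overlap_def)
    moreover have "open (overlap d c \<inter> transition d c -` S)"
      using continuous_open_preimage[OF overlap(2)[OF d c] overlap(1)[OF d c]]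
        topological_basis_open[OF Q(2) S] by simp
    ultimately show "open (snd d ` (W c S \<inter> fst d))" by simp
  qed
  moreover have "\<exists>V\<in>(\<lambda>(c, S). W c S) ` (B \<times> Q). x \<in> V \<and> V \<subseteq> U"
    if U: "openin (atlas_topology B) U" "x \<in> U" for U x
  proof -
    obtain c where c: "c \<in> B" "x \<in> fst c"
      using U openin[of U] unfolding points_def by blast
    have "open (snd c ` (U \<inter> fst c))" "snd c x \<in> snd c ` (U \<inter> fst c)"
      using U openin c by auto
    then obtain S where S: "S \<in> Q" "snd c x \<in> S" "S \<subseteq> snd c ` (U \<inter> fst c)"
      by (rule topological_basisE[OF Q(2)])
    have "W c S \<subseteq> U"
    proof
      fix w assume w: "w \<in> W c S"
      then obtain w' where w': "w' \<in> U" "w' \<in> fst c" "snd c w = snd c w'"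
        using S(3) by (auto simp: W_def)
      have "w \<in> fst c" using w by (simp add: W_def)
      then have "w = w'"
        using inj_onD[OF B(1)[OF c(1)] w'(3)] w'(2) by blast
      then show "w \<in> U" using w'(1) by simp
    qed
    moreover have "x \<in> W c S" using c S by (simp add: W_def)
    ultimately show ?thesis using c S by blast
  qed
  moreover have "countable ((\<lambda>(c, S). W c S) ` (B \<times> Q))"
    using countable Q(1) by simp
  ultimately show ?thesis
    unfolding second_countable_def
    by (intro exI[of _ "(\<lambda>(c, S). W c S) ` (B \<times> Q)"]) auto
qed

text \<open>A second countable space is Lindelof, so countably many of the chart domains cover it;
  the atlas itself may be uncountable.\<close>

lemma countable_subatlas:
  assumes A: "smooth_atlas A"
  obtains A0 where "countable A0" "A0 \<subseteq> A" "points A0 = points A"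
proof -
  have openin: "openin (atlas_topology A) U \<longleftrightarrow> U \<subseteq> points A \<and> (\<forall>c\<in>A. open (snd c ` (U \<inter> fst c)))" for U
    by (rule openin_atlas_topology) (fact atlas_inj[OF A] atlas_open[OF A])+
  have "openin (atlas_topology A) (points A)"
    unfolding openin
  proof (intro conjI ballI order_refl)
    fix c assume c: "c \<in> A"
    then have "snd c ` (points A \<inter> fst c) = cimg c"
      by (auto simp: points_def cimg_def)
    then show "open (snd c ` (points A \<inter> fst c))"
      using atlas_open[OF A c] by simp
  qed
  then have top: "topspace (atlas_topology A) = points A"
    using openin[of "topspace (atlas_topology A)"] by (metis openin_subset openin_topspace subset_antisym)
  have "Lindelof_space (atlas_topology A)"
    using A by (simp add: smooth_atlas_def second_countable_imp_Lindelof_space)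
  moreover have "openin (atlas_topology A) U" if "U \<in> fst ` A" for U
    using that openin_chart_domain[of A, OF atlas_inj[OF A] atlas_open[OF A] open_overlap[OF A]] by auto
  moreover have "\<Union>(fst ` A) = topspace (atlas_topology A)"
    by (simp add: top points_def)
  ultimately obtain V where V: "countable V" "V \<subseteq> fst ` A" "\<Union>V = points A"
    unfolding Lindelof_space_def top by metis
  then obtain A0 where "countable A0" "A0 \<subseteq> A" "V = fst ` A0"
    by (metis countable_subset_image)
  then show ?thesis
    using V that by (auto simp: points_def)
qed

section \<open>The level surfaces\<close>

locale AH_level = AH_data +
  fixes k :: real
  assumes k: "k \<in> Rt ` Mhat A"
begin

lemma k_neg: "k < 0"
proof -
  obtain p where p: "p \<in> Mhat A" "Rt p = k" using k by blast
  obtain c where c: "c \<in> A" "fst p \<in> fst c" using Mhat_base[OF p(1)] by blast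
  have "k * \<bar>snd p c\<bar> ^ 3 < 0"
    using R_tilde_eq[OF c(1) p(1) c(2)] scal_neg[OF c(1), of "snd c (fst p)"] p c
    by (auto simp: cimg_def)
  moreover have "\<bar>snd p c\<bar> ^ 3 \<ge> 0" by simp
  ultimately show ?thesis
    by (simp add: mult_less_0_iff)
qed

text \<open>The constant value of \<open>v_tilde Rt\<close> on the level surface.\<close>

definition vk :: real where
  "vk = 2 powr (2/3) * \<bar>k\<bar> powr (-2/3)"

lemma vk_pos: "vk > 0"
  using k_neg by (simp add: vk_def)

abbreviation gD :: "('a hat, 3) tensor2" where
  "gD \<equiv> g_tensor D Rt"

abbreviation fD :: "('a hat, 3) tensor2" where
  "fD \<equiv> f_tensor D Rt"

text \<open>On the level surface \<open>R = k |s|^3\<close>, so this is the absolute value of the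
  fibre coordinate; the base of the power is a quotient of two negative numbers.\<close>

definition rad :: "('a, 2) chart \<Rightarrow> real^2 \<Rightarrow> real" where
  "rad c y = (R c y / k) powr (1/3)"

lemma rad:
  assumes "c \<in> A" "y \<in> cimg c"
  shows "rad c y > 0" "rad c y ^ 3 = R c y / k"
proof -
  have pos: "R c y / k > 0"
    using scal_neg[OF assms] k_neg by (simp add: divide_neg_neg)
  then show r: "rad c y > 0"
    unfolding rad_def powr_gt_zero by (rule less_imp_neq[symmetric])
  show "rad c y ^ 3 = R c y / k"
    using powr_realpow[OF r, of 3] powr_powr[of "R c y / k" "1/3" 3] abs_of_pos[OF pos]
    by (simp add: rad_def)
qed

lemma smooth_rad: "c \<in> A \<Longrightarrow> smooth_on (cimg c) (rad c)"
  unfolding rad_def[abs_def]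
  using scal_neg k_neg
  by (intro smooth_on_powr smooth_on_divide smooth_on_const smooth_R open_cimg)
     (auto simp: divide_neg_neg)

abbreviation L :: "'a hat set" where
  "L \<equiv> level_set A Rt k"

lemma abs_snd_level:
  assumes "p \<in> L" "c \<in> A" "fst p \<in> fst c"
  shows "\<bar>snd p c\<bar> = rad c (snd c (fst p))"
proof -
  have y: "snd c (fst p) \<in> cimg c" using assms by (auto simp: cimg_def)
  have "rad c (snd c (fst p)) ^ 3 = \<bar>snd p c\<bar> ^ 3"
    using R_tilde_eq[OF assms(2) _ assms(3)] assms(1) k_neg rad(2)[OF assms(2) y]
    by (simp add: level_set_def)
  then have "rad c (snd c (fst p)) = \<bar>snd p c\<bar>"
    by (rule power_eq_imp_eq_base[OF _ less_imp_le[OF rad(1)[OF assms(2) y]] abs_ge_zero]) simp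
  then show ?thesis ..
qed

text \<open>The level surface is a double cover of \<open>M\<close>, with one chart for each sign \<open>\<epsilon>\<close> of the fibre
  coordinate.\<close>
definition lchart :: "('a, 2) chart \<Rightarrow> real \<Rightarrow> ('a hat, 2) chart" where
  "lchart c \<epsilon> = ({p \<in> L. fst p \<in> fst c \<and> \<epsilon> * snd p c > 0}, \<lambda>p. snd c (fst p))"

abbreviation lrep :: "('a, 2) chart \<Rightarrow> real \<Rightarrow> ('a, 2) chart \<Rightarrow> real^2 \<Rightarrow> real^3" where
  "lrep c \<epsilon> d \<equiv> local_rep (\<lambda>p. p) (lchart c \<epsilon>) (hat d)"

definition lpoint :: "('a, 2) chart \<Rightarrow> real \<Rightarrow> real^2 \<Rightarrow> 'a hat" where
  "lpoint c \<epsilon> y = lift A c (chart_inv c y) (\<epsilon> * rad c y)"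

lemma snd_lchart: "snd (lchart c \<epsilon>) p = snd c (fst p)"
  by (simp add: lchart_def)

lemma fst_lchart: "p \<in> fst (lchart c \<epsilon>) \<longleftrightarrow> p \<in> L \<and> fst p \<in> fst c \<and> \<epsilon> * snd p c > 0"
  by (simp add: lchart_def)

context
  fixes c :: "('a, 2) chart" and \<epsilon> :: real
  assumes c: "c \<in> A" and \<epsilon>: "\<epsilon> \<in> {1, -1}"
begin

lemma lpoint:
  assumes y: "y \<in> cimg c"
  shows "fst (lpoint c \<epsilon> y) = chart_inv c y" "snd (lpoint c \<epsilon> y) c = \<epsilon> * rad c y"
    "lpoint c \<epsilon> y \<in> Mhat A" "lpoint c \<epsilon> y \<in> L" "lpoint c \<epsilon> y \<in> fst (lchart c \<epsilon>)"
    "snd (lchart c \<epsilon>) (lpoint c \<epsilon> y) = y"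
proof -
  note x = snd_chart_inv[OF y]
  note r = rad[OF c y]
  show 1: "fst (lpoint c \<epsilon> y) = chart_inv c y" by (simp add: lpoint_def)
  show 2: "snd (lpoint c \<epsilon> y) c = \<epsilon> * rad c y"
    by (simp add: lpoint_def snd_lift_self[OF atlas c x(1)])
  show 3: "lpoint c \<epsilon> y \<in> Mhat A"
    unfolding lpoint_def using r(1) \<epsilon> by (intro lift_Mhat[OF atlas c x(1)]) auto
  have "\<bar>snd (lpoint c \<epsilon> y) c\<bar> ^ 3 = R c y / k"
    using \<epsilon> r by (auto simp: 2 abs_mult)
  then have "R c y = Rt (lpoint c \<epsilon> y) * (R c y / k)"
    using R_tilde_eq[OF c 3] by (simp add: 1 x)
  then have "Rt (lpoint c \<epsilon> y) = k"
    using scal_neg[OF c y] k_neg by (simp add: field_simps)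
  with 3 show 4: "lpoint c \<epsilon> y \<in> L" by (simp add: level_set_def)
  show "lpoint c \<epsilon> y \<in> fst (lchart c \<epsilon>)"
    using 4 x r(1) \<epsilon> by (auto simp: fst_lchart 1 2)
  show "snd (lchart c \<epsilon>) (lpoint c \<epsilon> y) = y"
    by (simp add: snd_lchart 1 x)
qed

lemma cimg_lchart: "cimg (lchart c \<epsilon>) = cimg c"
proof (intro set_eqI iffI)
  fix y assume "y \<in> cimg (lchart c \<epsilon>)"
  then show "y \<in> cimg c" by (auto simp: cimg_def snd_lchart fst_lchart)
next
  fix y assume "y \<in> cimg c"
  then show "y \<in> cimg (lchart c \<epsilon>)"
    using lpoint(5,6)[of y] unfolding cimg_def[of "lchart c \<epsilon>"] by (metis imageI)
qed

lemma inj_lchart: "inj_on (snd (lchart c \<epsilon>)) (fst (lchart c \<epsilon>))"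
proof (rule inj_onI)
  fix p q assume p: "p \<in> fst (lchart c \<epsilon>)" and q: "q \<in> fst (lchart c \<epsilon>)"
    and eq: "snd (lchart c \<epsilon>) p = snd (lchart c \<epsilon>) q"
  note pL = p[unfolded fst_lchart] and qL = q[unfolded fst_lchart]
  have "snd c (fst p) = snd c (fst q)" using eq by (simp add: snd_lchart)
  then have b: "fst p = fst q"
    using inj_onD[OF atlas_inj[OF atlas c]] pL qL by blast
  then have "\<bar>snd p c\<bar> = \<bar>snd q c\<bar>"
    using abs_snd_level[of p c] abs_snd_level[of q c] pL qL c by simp
  then have s: "snd p c = snd q c"
    using pL qL \<epsilon> by (auto simp: abs_if split: if_splits)
  have "p = lift A c (fst p) (snd p c)" "q = lift A c (fst q) (snd q c)"
    using Mhat_eq_lift[OF atlas _ c] pL qL by (auto simp: level_set_def)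
  then show "p = q" using b s by metis
qed

lemma chart_inv_lchart:
  assumes "y \<in> cimg c"
  shows "chart_inv (lchart c \<epsilon>) y = lpoint c \<epsilon> y"
  using lpoint(5,6)[OF assms] inj_lchart unfolding chart_inv_def by (metis inv_into_f_f)

lemma snd_lpoint:
  assumes d: "d \<in> A" and y: "y \<in> overlap c d"
  shows "snd (lpoint c \<epsilon> y) d = root 3 (det (jac d c (transition c d y))) * (\<epsilon> * rad c y)"
proof -
  have "y \<in> cimg c" "chart_inv c y \<in> fst d"
    using y overlap_iff[OF atlas c] by auto
  then show ?thesis
    using d by (simp add: lpoint_def snd_lift transition_def)
qed

text \<open>The fibre coordinate is multiplied by the cube root of the Jacobian determinant, so the
  signs decide which sheets over the two base charts meet. The level surface is thus the orientation
  double cover.\<close>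

lemma overlap_lchart:
  assumes d: "d \<in> A"
  shows "overlap (lchart c \<epsilon>) (lchart d \<delta>) =
    {y \<in> overlap c d. 0 < \<delta> * \<epsilon> * det (jac d c (transition c d y))}"
proof (intro set_eqI iffI)
  fix y assume "y \<in> overlap (lchart c \<epsilon>) (lchart d \<delta>)"
  then obtain p where p: "p \<in> fst (lchart c \<epsilon>)" "p \<in> fst (lchart d \<delta>)" "y = snd c (fst p)"
    by (auto simp: overlap_def snd_lchart)
  then have yd: "y \<in> overlap c d" by (auto simp: overlap_def fst_lchart)
  then have yc: "y \<in> cimg c" using overlap_subset[of c d] by blast
  have "p = lpoint c \<epsilon> y"
    using p chart_inv_lchart[OF yc] inj_lchart by (metis chart_inv_def inv_into_f_f snd_lchart)
  then have "0 < \<delta> * (root 3 (det (jac d c (transition c d y))) * (\<epsilon> * rad c y))"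
    using p(2) snd_lpoint[OF d yd] by (simp add: fst_lchart)
  then have "0 < (\<delta> * \<epsilon> * root 3 (det (jac d c (transition c d y)))) * rad c y"
    by (simp add: mult_ac)
  then have "0 < \<delta> * \<epsilon> * root 3 (det (jac d c (transition c d y)))"
    using rad(1)[OF c yc] by (simp add: zero_less_mult_iff)
  then show "y \<in> {y \<in> overlap c d. 0 < \<delta> * \<epsilon> * det (jac d c (transition c d y))}"
    using yd by (simp add: zero_less_mult_iff)
next
  fix y assume y: "y \<in> {y \<in> overlap c d. 0 < \<delta> * \<epsilon> * det (jac d c (transition c d y))}"
  then have yd: "y \<in> overlap c d" and s: "0 < \<delta> * \<epsilon> * root 3 (det (jac d c (transition c d y)))"
    by (auto simp: zero_less_mult_iff)
  then have yc: "y \<in> cimg c" using overlap_subset[of c d] by blast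
  have "0 < (\<delta> * \<epsilon> * root 3 (det (jac d c (transition c d y)))) * rad c y"
    by (rule mult_pos_pos[OF s rad(1)[OF c yc]])
  then have "0 < \<delta> * snd (lpoint c \<epsilon> y) d"
    by (simp add: snd_lpoint[OF d yd] mult_ac)
  moreover have "chart_inv c y \<in> fst d"
    using yd overlap_iff[OF atlas c] by auto
  ultimately have "lpoint c \<epsilon> y \<in> fst (lchart d \<delta>)"
    using lpoint[OF yc] by (simp add: fst_lchart)
  then show "y \<in> overlap (lchart c \<epsilon>) (lchart d \<delta>)"
    unfolding overlap_def using lpoint(5,6)[OF yc] by (metis IntI imageI)
qed

lemma open_overlap_lchart:
  assumes d: "d \<in> A"
  shows "open (overlap (lchart c \<epsilon>) (lchart d \<delta>))"
proof -
  note O = open_overlap[OF atlas c d]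
  have "smooth_on (overlap c d) (\<lambda>y. jac d c (transition c d y))"
    by (rule smooth_on_compose[OF O open_overlap[OF atlas d c] chart_inv_transition(2)[OF atlas c d]
        smooth_transition[OF atlas c d] smooth_jac[OF atlas d c]])
  then have "smooth_on (overlap c d) (\<lambda>y. \<delta> * \<epsilon> * det (jac d c (transition c d y)))"
    by (intro smooth_on_mult smooth_on_const smooth_on_det_2 O)
  then have "open (overlap c d \<inter> (\<lambda>y. \<delta> * \<epsilon> * det (jac d c (transition c d y))) -` {0<..})"
    by (intro continuous_open_preimage smooth_on_continuous_on O) auto
  moreover have "overlap (lchart c \<epsilon>) (lchart d \<delta>) =
      overlap c d \<inter> (\<lambda>y. \<delta> * \<epsilon> * det (jac d c (transition c d y))) -` {0<..}"
    unfolding overlap_lchart[OF d] by auto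
  ultimately show ?thesis by simp
qed

lemma smooth_transition_lchart:
  assumes d: "d \<in> A"
  shows "smooth_on (overlap (lchart c \<epsilon>) (lchart d \<delta>)) (transition (lchart c \<epsilon>) (lchart d \<delta>))"
proof (rule smooth_on_cong[OF open_overlap_lchart[OF d]])
  show "smooth_on (overlap (lchart c \<epsilon>) (lchart d \<delta>)) (transition c d)"
    by (rule smooth_on_subset[OF smooth_transition[OF atlas c d]]) (auto simp: overlap_lchart[OF d])
  fix y assume "y \<in> overlap (lchart c \<epsilon>) (lchart d \<delta>)"
  then have "y \<in> cimg c"
    using overlap_subset[of c d] by (auto simp: overlap_lchart[OF d])
  then show "transition c d y = transition (lchart c \<epsilon>) (lchart d \<delta>) y"
    using lpoint(1) by (simp add: transition_def chart_inv_lchart snd_lchart)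
qed

text \<open>The whole overlap appears for either \<open>\<epsilon>\<close>, because the bundle chart
  \<open>hat d\<close> contains both signs of the fibre coordinate.\<close>

lemma local_src_lchart:
  assumes d: "d \<in> A"
  shows "local_src (\<lambda>p. p) (lchart c \<epsilon>) (hat d) = overlap c d"
proof (intro set_eqI iffI)
  fix y assume "y \<in> local_src (\<lambda>p. p) (lchart c \<epsilon>) (hat d)"
  then show "y \<in> overlap c d"
    by (auto simp: local_src_def overlap_def snd_lchart fst_lchart fst_hat_chart)
next
  fix y assume y: "y \<in> overlap c d"
  then have yc: "y \<in> cimg c" "chart_inv c y \<in> fst d"
    using overlap_iff[OF atlas c] by auto
  then have "lpoint c \<epsilon> y \<in> {p \<in> fst (lchart c \<epsilon>). p \<in> fst (hat d)}"
    using lpoint[OF yc(1)] by (simp add: fst_hat_chart)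
  then show "y \<in> local_src (\<lambda>p. p) (lchart c \<epsilon>) (hat d)"
    unfolding local_src_def using lpoint(6)[OF yc(1)] by (metis (no_types, lifting) imageI)
qed

lemma local_rep_lchart:
  assumes d: "d \<in> A" and y: "y \<in> overlap c d"
  defines "u \<equiv> lrep c \<epsilon> d"
  shows "u y = snd (hat d) (lpoint c \<epsilon> y)" "base (u y) = transition c d y"
    "u y $ 3 = root 3 (det (jac d c (transition c d y))) * (\<epsilon> * rad c y)"
    "u y \<in> cimg (hat d)" "chart_inv (hat d) (u y) = lpoint c \<epsilon> y"
proof -
  have yc: "y \<in> cimg c" "chart_inv c y \<in> fst d"
    using y overlap_iff[OF atlas c] by auto
  show 1: "u y = snd (hat d) (lpoint c \<epsilon> y)"
    by (simp add: u_def local_rep_def chart_inv_lchart[OF yc(1)])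
  show "base (u y) = transition c d y"
    by (simp add: 1 snd_hat_chart lpoint(1)[OF yc(1)] transition_def)
  show "u y $ 3 = root 3 (det (jac d c (transition c d y))) * (\<epsilon> * rad c y)"
    by (simp add: 1 snd_hat_chart snd_lpoint[OF d y])
  have p: "lpoint c \<epsilon> y \<in> fst (hat d)"
    using lpoint[OF yc(1)] yc(2) by (simp add: fst_hat_chart)
  then show "u y \<in> cimg (hat d)"
    by (simp add: 1 cimg_def)
  show "chart_inv (hat d) (u y) = lpoint c \<epsilon> y"
    using p hat_chart_inj[OF atlas d] by (simp add: 1 chart_inv_def)
qed

lemma smooth_local_rep_lchart:
  assumes d: "d \<in> A"
  shows "smooth_on (overlap c d) (lrep c \<epsilon> d)"
proof (rule smooth_on_vec_lambda[OF open_overlap[OF atlas c d]])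
  let ?u = "lrep c \<epsilon> d"
  note O = open_overlap[OF atlas c d]
  have 1: "smooth_on (overlap c d) (\<lambda>y. transition c d y $ i)" for i
    by (rule smooth_on_nth[OF O smooth_transition[OF atlas c d]])
  have J: "smooth_on (overlap c d) (\<lambda>y. jac d c (transition c d y))"
    by (rule smooth_on_compose[OF O open_overlap[OF atlas d c] chart_inv_transition(2)[OF atlas c d]
        smooth_transition[OF atlas c d] smooth_jac[OF atlas d c]])
  have 3: "smooth_on (overlap c d) (\<lambda>y. root 3 (det (jac d c (transition c d y))) * (\<epsilon> * rad c y))"
    using det_jac_neq_0[OF atlas d c chart_inv_transition(2)[OF atlas c d]]
    by (intro smooth_on_mult smooth_on_root_3 smooth_on_det_2 J smooth_on_const O
        smooth_on_subset[OF smooth_rad[OF c] overlap_subset])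
  have "?u y $ 1 = transition c d y $ 1" "?u y $ 2 = transition c d y $ 2" if "y \<in> overlap c d" for y
    using local_rep_lchart(2)[OF d that] by (metis base_nth)+
  then have "smooth_on (overlap c d) (\<lambda>y. ?u y $ 1)" "smooth_on (overlap c d) (\<lambda>y. ?u y $ 2)"
    using smooth_on_cong[OF O 1[of 1], of "\<lambda>y. ?u y $ 1"] smooth_on_cong[OF O 1[of 2], of "\<lambda>y. ?u y $ 2"]
    by simp_all
  moreover have "smooth_on (overlap c d) (\<lambda>y. ?u y $ 3)"
    by (rule smooth_on_cong[OF O 3]) (simp add: local_rep_lchart(3)[OF d])
  ultimately show "smooth_on (overlap c d) (\<lambda>y. ?u y $ i)" for i
    using exhaust_3[of i] by auto
qed

text \<open>Composed with the projection to the base, the local representative is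
  \<open>transition c d\<close>, whose derivative is invertible.\<close>

lemma inj_local_rep_lchart:
  assumes d: "d \<in> A" and y: "y \<in> overlap c d"
  shows "inj (frechet_derivative (lrep c \<epsilon> d) (at y))"
proof -
  let ?u = "lrep c \<epsilon> d"
  note O = open_overlap[OF atlas c d]
  note u = smooth_on_has_derivative[OF smooth_local_rep_lchart[OF d] y]
  have "frechet_derivative (\<lambda>y. base (?u y)) (at y) = frechet_derivative (transition c d) (at y)"
    by (rule frechet_derivative_cong[OF O y local_rep_lchart(2)[OF d]])
  moreover have "frechet_derivative (\<lambda>y. base (?u y)) (at y) =
      (\<lambda>a. base (frechet_derivative ?u (at y) a))"
    by (rule frechet_derivative_eqI[OF bounded_linear.has_derivative[OF bounded_linear_base u]])
  ultimately have eq: "base (frechet_derivative ?u (at y) a) = jac c d y *v a" for a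
    by (simp add: jac_works[OF atlas c d y] fun_eq_iff)
  have "a = 0" if "frechet_derivative ?u (at y) a = 0" for a
  proof -
    have "jac c d y *v a = 0"
      using eq[of a] that by (simp add: base_simps)
    moreover have "invertible (jac c d y)"
      using det_jac_neq_0[OF atlas c d y] by (simp add: invertible_det_nz)
    ultimately show ?thesis
      by (metis invertible_left_inverse matrix_left_invertible_ker)
  qed
  then show ?thesis
    using linear_injective_0[OF has_derivative_linear[OF u]] by blast
qed

lemma hlog_local_rep_lchart:
  assumes d: "d \<in> A" and y: "y \<in> overlap c d"
  shows "hlog d (lrep c \<epsilon> d y) = - (3/2) * ln vk + ln 2"
    "hv d (lrep c \<epsilon> d y) = vk"
proof -
  note u = local_rep_lchart[OF d y]
  have "Rt (lpoint c \<epsilon> y) = k"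
    using lpoint(4)[of y] y overlap_subset[of c d] by (auto simp: level_set_def)
  then show "hlog d (lrep c \<epsilon> d y) = - (3/2) * ln vk + ln 2"
    "hv d (lrep c \<epsilon> d y) = vk"
    using F_pot_chart[OF d u(4)] v_tilde_chart[OF d u(4)] u(5)
    by (simp_all add: F_pot_def v_tilde_def vk_def)
qed

end

text \<open>Countability makes the level surface second countable.\<close>
definition A0 :: "('a, 2) chart set" where
  "A0 = (SOME A0. countable A0 \<and> A0 \<subseteq> A \<and> points A0 = points A)"

lemma A0: "countable A0" "A0 \<subseteq> A" "points A0 = points A"
proof -
  have "countable A0 \<and> A0 \<subseteq> A \<and> points A0 = points A"
    unfolding A0_def using countable_subatlas[OF atlas] by (rule someI_ex) metis
  then show "countable A0" "A0 \<subseteq> A" "points A0 = points A" by auto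
qed

definition latlas :: "('a hat, 2) chart set" where
  "latlas = (\<lambda>(c, \<epsilon>). lchart c \<epsilon>) ` (A0 \<times> {1, -1})"

lemma ball_latlas: "(\<forall>b\<in>latlas. Q b) \<longleftrightarrow> (\<forall>c\<in>A0. \<forall>\<epsilon>\<in>{1,-1}. Q (lchart c \<epsilon>))"
  by (auto simp: latlas_def)

lemma latlasE:
  assumes "b \<in> latlas"
  obtains c \<epsilon> where "c \<in> A" "\<epsilon> \<in> {1, -1}" "b = lchart c \<epsilon>"
  using assms A0(2) by (fastforce simp: latlas_def)

lemma lchart_cover:
  assumes "p \<in> L"
  obtains c \<epsilon> where "c \<in> A0" "c \<in> A" "\<epsilon> \<in> {1, -1}" "p \<in> fst (lchart c \<epsilon>)"
proof -
  have p: "p \<in> Mhat A" using assms by (simp add: level_set_def)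
  then have "fst p \<in> points A0"
    using A0(3) by (simp add: Mhat_def case_prod_beta)
  then obtain c where c: "c \<in> A0" "c \<in> A" "fst p \<in> fst c"
    using A0(2) by (auto simp: points_def)
  have "snd p c \<noteq> 0" by (rule Mhat_snd_neq_0[OF atlas p c(2,3)])
  then have "p \<in> fst (lchart c 1) \<or> p \<in> fst (lchart c (-1))"
    using assms c by (auto simp: fst_lchart)
  then show ?thesis using that c by blast
qed

lemma points_latlas: "points latlas = L"
proof
  show "points latlas \<subseteq> L"
    by (auto simp: points_def latlas_def fst_lchart)
  show "L \<subseteq> points latlas"
  proof
    fix p assume "p \<in> L"
    then obtain c \<epsilon> where "c \<in> A0" "\<epsilon> \<in> {1, -1}" "p \<in> fst (lchart c \<epsilon>)"
      by (rule lchart_cover)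
    then show "p \<in> points latlas"
      unfolding points_def latlas_def by (intro UN_I[of "lchart c \<epsilon>"]) auto
  qed
qed

lemma latlas_charts:
  assumes "b \<in> latlas"
  shows "inj_on (snd b) (fst b)" "open (cimg b)"
    "b' \<in> latlas \<Longrightarrow> open (overlap b b')" "b' \<in> latlas \<Longrightarrow> smooth_on (overlap b b') (transition b b')"
proof -
  obtain c \<epsilon> where c: "c \<in> A" "\<epsilon> \<in> {1, -1}" and b: "b = lchart c \<epsilon>"
    using assms by (rule latlasE)
  show "inj_on (snd b) (fst b)" "open (cimg b)"
    unfolding b using inj_lchart[OF c] cimg_lchart[OF c] open_cimg[OF c(1)] by simp_all
  assume "b' \<in> latlas"
  then obtain d \<delta> where d: "d \<in> A" and b': "b' = lchart d \<delta>"
    by (rule latlasE)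
  show "open (overlap b b')" "smooth_on (overlap b b') (transition b b')"
    unfolding b b' by (rule open_overlap_lchart[OF c d], rule smooth_transition_lchart[OF c d])
qed

text \<open>Continuity of the projection from the level surface to the base, used to separate points
  over different base points.\<close>

lemma openin_lift:
  assumes U: "openin (atlas_topology A) U"
  shows "openin (atlas_topology latlas) {p \<in> L. fst p \<in> U}"
proof -
  have U': "\<And>c. c \<in> A \<Longrightarrow> open (snd c ` (U \<inter> fst c))"
    using U openin_atlas_topology[OF atlas_inj[OF atlas] atlas_open[OF atlas]] by auto
  have "open (snd b ` ({p \<in> L. fst p \<in> U} \<inter> fst b))" if b: "b \<in> latlas" for b
  proof -
    obtain c \<epsilon> where c: "c \<in> A" "\<epsilon> \<in> {1, -1}" "b = lchart c \<epsilon>"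
      using b by (rule latlasE)
    have "snd b ` ({p \<in> L. fst p \<in> U} \<inter> fst b) = snd c ` (U \<inter> fst c)"
    proof (intro set_eqI iffI)
      fix y assume "y \<in> snd c ` (U \<inter> fst c)"
      then obtain x where x: "x \<in> U" "x \<in> fst c" "y = snd c x" by blast
      then have y: "y \<in> cimg c" "chart_inv c y = x"
        using c chart_inv_snd[OF atlas] by (auto simp: cimg_def)
      then have "lpoint c \<epsilon> y \<in> {p \<in> L. fst p \<in> U} \<inter> fst b"
        using lpoint[OF c(1,2) y(1)] x c by simp
      moreover have "y = snd b (lpoint c \<epsilon> y)"
        using lpoint(6)[OF c(1,2) y(1)] c(3) by simp
      ultimately show "y \<in> snd b ` ({p \<in> L. fst p \<in> U} \<inter> fst b)"
        by (rule rev_image_eqI)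
    qed (auto simp: c(3) snd_lchart fst_lchart)
    then show ?thesis using U'[OF c(1)] by simp
  qed
  then show ?thesis
    by (subst openin_atlas_topology[OF latlas_charts(1,2)]) (auto simp: points_latlas)
qed

text \<open>Points over distinct base points are separated by preimages of open sets of the base.
  Two points over the same base point lie in the sheets \<open>\<epsilon>\<close> and
  \<open>- \<epsilon>\<close> of one chart, which are open and disjoint.\<close>

lemma Hausdorff_latlas: "Hausdorff_space (atlas_topology latlas)"
  unfolding Hausdorff_space_def
proof (intro allI impI)
  fix p q assume pq: "p \<in> topspace (atlas_topology latlas) \<and> q \<in> topspace (atlas_topology latlas) \<and> p \<noteq> q"
  have "openin (atlas_topology latlas) (topspace (atlas_topology latlas))" by simp
  then have "topspace (atlas_topology latlas) \<subseteq> L"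
    by (subst (asm) openin_atlas_topology[OF latlas_charts(1,2)]) (auto simp: points_latlas)
  then have pL: "p \<in> L" and qL: "q \<in> L" and neq: "p \<noteq> q"
    using pq by auto
  obtain c \<epsilon> where c: "c \<in> A0" "c \<in> A" "\<epsilon> \<in> {1, -1}" "p \<in> fst (lchart c \<epsilon>)"
    using lchart_cover[OF pL] by blast
  show "\<exists>U V. openin (atlas_topology latlas) U \<and> openin (atlas_topology latlas) V \<and>
      p \<in> U \<and> q \<in> V \<and> disjnt U V"
  proof (cases "fst p = fst q")
    case False
    have in_top: "fst r \<in> topspace (atlas_topology A)" if "r \<in> L" for r
    proof -
      have "r \<in> Mhat A" using that by (simp add: level_set_def)
      then obtain d where d: "d \<in> A" "fst r \<in> fst d"
        using Mhat_base by blast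
      then have "openin (atlas_topology A) (fst d)"
        by (intro openin_chart_domain atlas_inj[OF atlas] atlas_open[OF atlas] open_overlap[OF atlas])
      then show ?thesis using d openin_subset by blast
    qed
    have "Hausdorff_space (atlas_topology A)"
      using atlas by (simp add: smooth_atlas_def)
    then obtain U V where UV: "openin (atlas_topology A) U" "openin (atlas_topology A) V"
      "fst p \<in> U" "fst q \<in> V" "disjnt U V"
      using in_top[OF pL] in_top[OF qL] False unfolding Hausdorff_space_def by meson
    show ?thesis
      using UV pL qL
      by (intro exI[of _ "{p \<in> L. fst p \<in> U}"] exI[of _ "{p \<in> L. fst p \<in> V}"])
         (auto simp: openin_lift disjnt_def)
  next
    case True
    have qc: "fst q \<in> fst c" using True c(4) by (simp add: fst_lchart)
    have "q \<notin> fst (lchart c \<epsilon>)"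
      using inj_onD[OF inj_lchart[OF c(2,3)], of q p] c(4) neq True by (auto simp: snd_lchart)
    moreover have "snd q c \<noteq> 0"
      using Mhat_snd_neq_0[OF atlas _ c(2) qc] qL by (simp add: level_set_def)
    ultimately have q: "q \<in> fst (lchart c (- \<epsilon>))"
      using qL qc c(3) by (auto simp: fst_lchart)
    have "lchart c \<epsilon> \<in> latlas" "lchart c (- \<epsilon>) \<in> latlas"
      using c(1,3) by (auto simp: latlas_def)
    then have "openin (atlas_topology latlas) (fst (lchart c \<epsilon>))"
      "openin (atlas_topology latlas) (fst (lchart c (- \<epsilon>)))"
      by (auto intro!: openin_chart_domain[OF latlas_charts(1-3)])
    moreover have "disjnt (fst (lchart c \<epsilon>)) (fst (lchart c (- \<epsilon>)))"
      by (auto simp: disjnt_def fst_lchart)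
    ultimately show ?thesis using c(4) q by blast
  qed
qed

lemma immersed_latlas: "immersed_submanifold latlas (hat_atlas A) L"
proof -
  have "countable latlas"
    unfolding latlas_def using A0(1) by simp
  then have "second_countable (atlas_topology latlas)"
    by (intro second_countable_atlas_topology latlas_charts smooth_on_continuous_on)
  then have "smooth_atlas latlas"
    using Hausdorff_latlas by (auto simp: smooth_atlas_def latlas_charts)
  moreover have "immersion latlas (hat_atlas A) (\<lambda>p. p)"
    unfolding immersion_def ball_latlas ball_hat_atlas
  proof (intro conjI ballI)
    show "(\<lambda>p. p) ` points latlas \<subseteq> points (hat_atlas A)"
    proof
      fix p assume "p \<in> (\<lambda>p. p) ` points latlas"
      then have "p \<in> Mhat A" by (simp add: points_latlas level_set_def)
      moreover from this obtain c where "c \<in> A" "fst p \<in> fst c"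
        using Mhat_base by blast
      ultimately show "p \<in> points (hat_atlas A)"
        unfolding points_def hat_atlas_def by (intro UN_I[of "hat c"]) (auto simp: fst_hat_chart)
    qed
    fix c \<epsilon> d assume "c \<in> A0" and \<epsilon>: "\<epsilon> \<in> {1, - 1::real}" and d: "d \<in> A"
    then have c: "c \<in> A" using A0(2) by blast
    note src = local_src_lchart[OF c \<epsilon> d]
    show "open (local_src (\<lambda>p. p) (lchart c \<epsilon>) (hat d))"
      unfolding src by (rule open_overlap[OF atlas c d])
    show "smooth_on (local_src (\<lambda>p. p) (lchart c \<epsilon>) (hat d)) (lrep c \<epsilon> d)"
      unfolding src by (rule smooth_local_rep_lchart[OF c \<epsilon> d])
    show "inj (frechet_derivative (lrep c \<epsilon> d) (at y))"
      if "y \<in> local_src (\<lambda>p. p) (lchart c \<epsilon>) (hat d)" for y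
      using that inj_local_rep_lchart[OF c \<epsilon> d] by (simp add: src)
  qed
  ultimately show ?thesis
    by (simp add: immersed_submanifold_def points_latlas)
qed

section \<open>Induced metric and second fundamental form of the level surfaces\<close>

lemma local_rep_Uhat:
  assumes c: "c \<in> A" "\<epsilon> \<in> {1, -1}" and d: "d \<in> A" and y: "y \<in> overlap c d"
  shows "lrep c \<epsilon> d y \<in> AH_chart.Uhat (cimg d)"
  using local_rep_lchart(4)[OF c d y] by (simp add: cimg_hat[OF d])

lemma induced_form_g:
  assumes c: "c \<in> A" "\<epsilon> \<in> {1, -1}" and d: "d \<in> A" and y: "y \<in> overlap c d" and v: "v \<noteq> 0"
  shows "v \<bullet> (induced_form (\<lambda>p. p) gD (lchart c \<epsilon>) (hat d) y *v v) < 0"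
proof -
  interpret d: AH_chart "cimg d" "Nab d" "Sch d" "R d" by (rule AH_chart[OF d])
  show ?thesis
    by (rule d.induced_form_level[where T = "gD" and m = "hv d" and n = "\<lambda>z. - hv d z"])
       (fact open_overlap[OF atlas c(1) d] y smooth_local_rep_lchart[OF c d] v
          local_rep_Uhat[OF c d] hlog_local_rep_lchart(1)[OF c d] inj_local_rep_lchart[OF c d y]
          g_tensor_chart[OF d, unfolded cimg_hat[OF d]] | simp add: d.vfun_pos)+
qed

lemma second_form_g:
  assumes c: "c \<in> A" "\<epsilon> \<in> {1, -1}" and d: "d \<in> A" and y: "y \<in> overlap c d"
    and normal: "normal_vector (\<lambda>p. p) gD (lchart c \<epsilon>) (hat d) y \<nu>"
  shows "second_form (\<lambda>p. p) gD (lchart c \<epsilon>) (hat d) y \<nu> =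
    (- \<nu> $ 3 / lrep c \<epsilon> d y $ 3) *\<^sub>R
      induced_form (\<lambda>p. p) gD (lchart c \<epsilon>) (hat d) y"
proof -
  interpret d: AH_chart "cimg d" "Nab d" "Sch d" "R d" by (rule AH_chart[OF d])
  let ?u = "lrep c \<epsilon> d"
  note uU = local_rep_Uhat[OF c d y]
  have 1: "smooth_on d.Uhat (\<lambda>z. - hv d z)"
    by (rule smooth_on_minus[OF d.open_Uhat d.smooth_vfun])
  have 2: "pd i (\<lambda>z. - hv d z) (?u y) = 2 * 1 * - hv d (?u y) * hbeta d (?u y) $ i" for i
    using pd_minus[OF smooth_on_differentiable[OF d.smooth_vfun uU]] by (simp add: d.pd_vfun[OF uU])
  have "second_form (\<lambda>p. p) gD (lchart c \<epsilon>) (hat d) y \<nu> =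
      (- 1 * \<nu> $ 3 / ?u y $ 3) *\<^sub>R induced_form (\<lambda>p. p) gD (lchart c \<epsilon>) (hat d) y"
    by (rule d.second_form_level(2)[where T = "gD" and m = "hv d" and n = "\<lambda>z. - hv d z"])
       (fact open_overlap[OF atlas c(1) d] y smooth_local_rep_lchart[OF c d] normal 1 2 d.smooth_vfun
          local_rep_Uhat[OF c d] hlog_local_rep_lchart(1)[OF c d] inj_local_rep_lchart[OF c d y]
          g_tensor_chart[OF d, unfolded cimg_hat[OF d]] |
        simp add: d.vfun_pos[THEN less_imp_neq, symmetric] d.pd_vfun[OF uU])+
  then show ?thesis by simp
qed

lemma second_form_f:
  assumes c: "c \<in> A" "\<epsilon> \<in> {1, -1}" and d: "d \<in> A" and y: "y \<in> overlap c d"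
    and normal: "normal_vector (\<lambda>p. p) fD (lchart c \<epsilon>) (hat d) y \<nu>"
  shows "second_form (\<lambda>p. p) fD (lchart c \<epsilon>) (hat d) y \<nu> = 0"
proof -
  interpret d: AH_chart "cimg d" "Nab d" "Sch d" "R d" by (rule AH_chart[OF d])
  let ?u = "lrep c \<epsilon> d"
  have "second_form (\<lambda>p. p) fD (lchart c \<epsilon>) (hat d) y \<nu> =
      (- 0 * \<nu> $ 3 / ?u y $ 3) *\<^sub>R induced_form (\<lambda>p. p) fD (lchart c \<epsilon>) (hat d) y"
    by (rule d.second_form_level(2)[where T = "fD" and m = "\<lambda>z. 3" and n = "\<lambda>z. 3"])
       (fact open_overlap[OF atlas c(1) d] y smooth_local_rep_lchart[OF c d] normal smooth_on_const
          local_rep_Uhat[OF c d] hlog_local_rep_lchart(1)[OF c d] inj_local_rep_lchart[OF c d y]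
          f_tensor_chart[OF d, unfolded cimg_hat[OF d]] | simp)+
  then show ?thesis by simp
qed

lemma spacelike_g: "spacelike latlas (hat_atlas A) (\<lambda>p. p) gD"
  unfolding spacelike_def ball_latlas ball_hat_atlas
  using A0(2) induced_form_g local_src_lchart by blast

lemma umbilic_g: "umbilic latlas (hat_atlas A) (\<lambda>p. p) gD"
  unfolding umbilic_def ball_latlas ball_hat_atlas
  using A0(2) second_form_g local_src_lchart by blast

lemma totally_geodesic_f: "totally_geodesic latlas (hat_atlas A) (\<lambda>p. p) fD"
  unfolding totally_geodesic_def ball_latlas ball_hat_atlas
  using A0(2) second_form_f local_src_lchart by blast

text \<open>The dilation field \<open>s \<partial>_s\<close> divided by its length:
  \<open>\<beta>\<close> takes the value 1 on it, so its square with respect to g is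
  \<open>v~\<close>, which is \<open>vk\<close> on the surface. The field is global, so both sheets
  get consistent normals.\<close>

definition unormal :: "('a hat, 3) chart \<Rightarrow> 'a hat \<Rightarrow> real^3" where
  "unormal e p = vector [0, 0, snd e p $ 3 / sqrt vk]"

lemma base_unormal: "base (unormal e p) = 0"
  by (simp add: unormal_def vec_eq_iff forall_2)

lemma unormal_lchart:
  assumes c: "c \<in> A" "\<epsilon> \<in> {1, -1}" and d: "d \<in> A" and y: "y \<in> overlap c d"
  shows "unormal (hat d) (chart_inv (lchart c \<epsilon>) y) =
    vector [0, 0, lrep c \<epsilon> d y $ 3 / sqrt vk]"
  by (simp add: unormal_def local_rep_def)

lemma normal_unormal:
  assumes c: "c \<in> A" "\<epsilon> \<in> {1, -1}" and d: "d \<in> A" and y: "y \<in> overlap c d"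
  shows "normal_vector (\<lambda>p. p) gD (lchart c \<epsilon>) (hat d) y
      (unormal (hat d) (chart_inv (lchart c \<epsilon>) y))"
proof -
  interpret d: AH_chart "cimg d" "Nab d" "Sch d" "R d" by (rule AH_chart[OF d])
  show ?thesis
    using g_tensor_chart[OF d local_rep_lchart(4)[OF c d y]]
      d.beta_tangent[OF open_overlap[OF atlas c(1) d] y smooth_local_rep_lchart[OF c d]
        local_rep_Uhat[OF c d] hlog_local_rep_lchart(1)[OF c d]]
    by (simp add: normal_vector_def Let_def d.kform_form base_unormal)
qed

lemma unit_unormal:
  assumes c: "c \<in> A" "\<epsilon> \<in> {1, -1}" and d: "d \<in> A" and y: "y \<in> overlap c d"
  defines "\<nu> \<equiv> unormal (hat d) (chart_inv (lchart c \<epsilon>) y)"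
  shows "\<bar>\<nu> \<bullet> (gD (hat d) (lrep c \<epsilon> d y) *v \<nu>)\<bar> = 1"
proof -
  interpret d: AH_chart "cimg d" "Nab d" "Sch d" "R d" by (rule AH_chart[OF d])
  let ?u = "lrep c \<epsilon> d"
  have b: "base \<nu> = 0" by (simp add: \<nu>_def base_unormal)
  have "?u y $ 3 \<noteq> 0" using d.Uhat_D(2)[OF local_rep_Uhat[OF c d y]] .
  then have "hbeta d (?u y) \<bullet> \<nu> = 1 / sqrt vk"
    using d.base_eq_0_D[OF b, of "?u y"] unormal_lchart[OF c d y] by (simp add: \<nu>_def)
  moreover have "hv d (?u y) = vk"
    by (rule hlog_local_rep_lchart(2)[OF c d y])
  ultimately show ?thesis
    using g_tensor_chart[OF d local_rep_lchart(4)[OF c d y]] vk_pos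
    by (simp add: d.kform_form b)
qed

text \<open>The image of a vertical vector is vertical, and a vertical vector is determined by its
  value under \<open>\<beta>\<close>, which the transition preserves.\<close>

lemma unormal_transform:
  assumes p: "p \<in> L" and c: "c \<in> A" and d: "d \<in> A" and pcd: "p \<in> fst (hat c) \<inter> fst (hat d)"
  shows "unormal (hat d) p = jac (hat c) (hat d) (snd (hat c) p) *v unormal (hat c) p"
proof -
  interpret c: AH_chart "cimg c" "Nab c" "Sch c" "R c" by (rule AH_chart[OF c])
  interpret d: AH_chart "cimg d" "Nab d" "Sch d" "R d" by (rule AH_chart[OF d])
  let ?z = "snd (hat c) p" and ?N = "unormal (hat c) p"
  let ?JN = "jac (hat c) (hat d) ?z *v ?N"
  have z: "?z \<in> overlap (hat c) (hat d)"
    using pcd by (auto simp: overlap_def)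
  have t: "transition (hat c) (hat d) ?z = snd (hat d) p"
    using pcd hat_chart_inj[OF atlas c] by (simp add: transition_def chart_inv_def)
  have b: "base ?JN = 0"
    by (simp add: base_jac_hat_chart[OF atlas c d z] base_unormal)
  have z3: "?z $ 3 \<noteq> 0" "snd (hat d) p $ 3 \<noteq> 0"
    using pcd c d Mhat_snd_neq_0[OF atlas] by (auto simp: snd_hat_chart fst_hat_chart)
  have "?JN $ 3 / snd (hat d) p $ 3 = ?N $ 3 / ?z $ 3"
    using beta_transform[OF c d z, of ?N] c.base_eq_0_D[OF base_unormal, of ?z "hat c" p]
      d.base_eq_0_D[OF b, of "snd (hat d) p"] by (simp add: t)
  then have "?JN $ 3 = snd (hat d) p $ 3 / sqrt vk"
    using z3 by (simp add: unormal_def field_simps)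
  then show ?thesis
    by (intro eq_if_base_3) (simp_all add: b base_unormal, simp add: unormal_def)
qed

lemma unit_normal_field_unormal:
  "unit_normal_field latlas (hat_atlas A) (\<lambda>p. p) gD unormal"
  unfolding unit_normal_field_def ball_latlas ball_hat_atlas points_latlas
proof (intro conjI ballI)
  fix c \<epsilon> d assume "c \<in> A0" and \<epsilon>: "\<epsilon> \<in> {1, - 1::real}" and d: "d \<in> A"
  then have c: "c \<in> A" using A0(2) by blast
  note src = local_src_lchart[OF c \<epsilon> d]
  note O = open_overlap[OF atlas c d]
  have s3: "smooth_on (overlap c d) (\<lambda>y. lrep c \<epsilon> d y $ 3 / sqrt vk)"
    using vk_pos by (intro smooth_on_divide smooth_on_nth smooth_local_rep_lchart c \<epsilon> d smooth_on_const O) auto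
  show "smooth_on (local_src (\<lambda>p. p) (lchart c \<epsilon>) (hat d)) (\<lambda>y. unormal (hat d) (chart_inv (lchart c \<epsilon>) y))"
    unfolding src
  proof (rule smooth_on_vec_lambda[OF O])
    show "smooth_on (overlap c d) (\<lambda>y. unormal (hat d) (chart_inv (lchart c \<epsilon>) y) $ i)" for i
      using exhaust_3[of i] s3
      by (elim disjE) (simp_all add: unormal_def smooth_on_const local_rep_def)
  qed
  fix y assume "y \<in> local_src (\<lambda>p. p) (lchart c \<epsilon>) (hat d)"
  then have y: "y \<in> overlap c d" by (simp add: src)
  show "let \<nu> = unormal (hat d) (chart_inv (lchart c \<epsilon>) y)
       in normal_vector (\<lambda>p. p) gD (lchart c \<epsilon>) (hat d) y \<nu> \<and>
          \<bar>\<nu> \<bullet> (gD (hat d) (lrep c \<epsilon> d y) *v \<nu>)\<bar> = 1"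
    using normal_unormal[OF c \<epsilon> d y] unit_unormal[OF c \<epsilon> d y] by (simp add: Let_def)
next
  fix p c d assume "p \<in> L" "c \<in> A" "d \<in> A"
  then show "p \<in> fst (hat c) \<inter> fst (hat d) \<longrightarrow>
      unormal (hat d) p = jac (hat c) (hat d) (snd (hat c) p) *v unormal (hat c) p"
    using unormal_transform by blast
qed

text \<open>With \<open>\<nu> $ 3 = s / sqrt vk\<close> the factor \<open>- \<nu> $ 3 / s\<close> of
  \<open>second_form_g\<close> becomes the constant \<open>- 1 / sqrt vk\<close>; its sign belongs
  to the normal along the dilation field.\<close>

lemma constant_mean_curvature_g:
  "constant_mean_curvature latlas (hat_atlas A) (\<lambda>p. p) gD"
  unfolding constant_mean_curvature_def
proof (intro exI conjI)
  show "unit_normal_field latlas (hat_atlas A) (\<lambda>p. p) gD unormal"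
    by (rule unit_normal_field_unormal)
  show "\<forall>b\<in>latlas. \<forall>e\<in>hat_atlas A. \<forall>y\<in>local_src (\<lambda>p. p) b e.
    trace (matrix_inv (induced_form (\<lambda>p. p) gD b e y) **
      second_form (\<lambda>p. p) gD b e y (unormal e (chart_inv b y))) / CARD(2) = - 1 / sqrt vk"
    unfolding ball_latlas ball_hat_atlas
  proof (intro ballI)
    fix c \<epsilon> d y assume "c \<in> A0" and \<epsilon>: "\<epsilon> \<in> {1, - 1::real}" and d: "d \<in> A"
      and y: "y \<in> local_src (\<lambda>p. p) (lchart c \<epsilon>) (hat d)"
    then have c: "c \<in> A" using A0(2) by blast
    interpret d: AH_chart "cimg d" "Nab d" "Sch d" "R d" by (rule AH_chart[OF d])
    have y: "y \<in> overlap c d" using y by (simp add: local_src_lchart[OF c \<epsilon> d])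
    let ?I = "induced_form (\<lambda>p. p) gD (lchart c \<epsilon>) (hat d) y"
    have "invertible ?I"
      by (rule pos_def_invertible) (use induced_form_g[OF c \<epsilon> d y] in force)
    moreover have "lrep c \<epsilon> d y $ 3 \<noteq> 0"
      using d.Uhat_D(2)[OF local_rep_Uhat[OF c \<epsilon> d y]] .
    then have "second_form (\<lambda>p. p) gD (lchart c \<epsilon>) (hat d) y
        (unormal (hat d) (chart_inv (lchart c \<epsilon>) y)) = (- 1 / sqrt vk) *\<^sub>R ?I"
      unfolding second_form_g[OF c \<epsilon> d y normal_unormal[OF c \<epsilon> d y]]
      by (simp add: unormal_lchart[OF c \<epsilon> d y])
    ultimately show "trace (matrix_inv ?I ** second_form (\<lambda>p. p) gD (lchart c \<epsilon>) (hat d) y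
        (unormal (hat d) (chart_inv (lchart c \<epsilon>) y))) / CARD(2) = - 1 / sqrt vk"
      by (simp only: trace_matrix_inv_scaleR) simp
  qed
qed

end

theorem theorem11p2:
  fixes A :: "('a, 2) chart set"
    and P :: "('a, 2) connection set"
    and C :: "('a, 2) tensor2 set"
    and Nab :: "('a, 2) connection"
    and D :: "('a hat, 3) connection"
    and Rt :: "'a hat \<Rightarrow> real"
  assumes "smooth_atlas A"
    and "AH_structure A P C"
    and "aligned_representative A P C Nab"
    and "Einstein_AH A C Nab"
    and "exact_AH A C Nab"
    and "\<And>c y. c \<in> A \<Longrightarrow> y \<in> cimg c \<Longrightarrow> weighted_scal C Nab c y < 0"
    and "Thomas_connection A Nab D"
    and "R_tilde A C Nab Rt"
  shows "(Hessian_metric 1 2 (hat_atlas A) D (g_tensor D Rt) \<and>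
          Monge_Ampere (hat_atlas A) D (g_tensor D Rt) \<and>
          (\<forall>k \<in> Rt ` Mhat A. \<exists>B :: ('a hat, 2) chart set.
             immersed_submanifold B (hat_atlas A) (level_set A Rt k) \<and>
             spacelike B (hat_atlas A) (\<lambda>p. p) (g_tensor D Rt) \<and>
             umbilic B (hat_atlas A) (\<lambda>p. p) (g_tensor D Rt) \<and>
             constant_mean_curvature B (hat_atlas A) (\<lambda>p. p) (g_tensor D Rt))) \<and>
         (Hessian_metric 3 0 (hat_atlas A) D (f_tensor D Rt) \<and>
          Hessian_Einstein (hat_atlas A) D (f_tensor D Rt) \<and>
          (\<forall>k \<in> Rt ` Mhat A. \<exists>B :: ('a hat, 2) chart set.
             immersed_submanifold B (hat_atlas A) (level_set A Rt k) \<and>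
             totally_geodesic B (hat_atlas A) (\<lambda>p. p) (f_tensor D Rt)))"
proof -
  interpret AH_data A P C Nab D Rt
    by unfold_locales (use assms in auto)
  have level: "AH_level A P C Nab D Rt k" if "k \<in> Rt ` Mhat A" for k
    by unfold_locales (rule that)
  show ?thesis
  proof (intro conjI ballI)
    fix k assume "k \<in> Rt ` Mhat A"
    then interpret AH_level A P C Nab D Rt k by (rule level)
    show "\<exists>B :: ('a hat, 2) chart set. immersed_submanifold B (hat_atlas A) (level_set A Rt k) \<and>
        spacelike B (hat_atlas A) (\<lambda>p. p) (g_tensor D Rt) \<and>
        umbilic B (hat_atlas A) (\<lambda>p. p) (g_tensor D Rt) \<and>
        constant_mean_curvature B (hat_atlas A) (\<lambda>p. p) (g_tensor D Rt)"
      using immersed_latlas spacelike_g umbilic_g constant_mean_curvature_g by blast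
    show "\<exists>B :: ('a hat, 2) chart set. immersed_submanifold B (hat_atlas A) (level_set A Rt k) \<and>
        totally_geodesic B (hat_atlas A) (\<lambda>p. p) (f_tensor D Rt)"
      using immersed_latlas totally_geodesic_f by blast
  qed (fact Hessian_metric_g Monge_Ampere_g Hessian_metric_f Hessian_Einstein_f)+
qed

end
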